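(* In the setting fixed in the context (assumptions (a) and (b), measure $m$, semigroup $(T_t)_{t\ge 0}$, Hunt process $\mathbb{M}$), the following hold. (i) Let $\widetilde{\mathbb{M}}=(\widetilde\Omega,\widetilde{\mathcal{F}},(\widetilde X_t)_{t\ge0},(\widetilde{\mathbb{P}}_x)_{x\in\mathbb{R}^d\cup\{\Delta\}})$ be a right process with state space $\mathbb{R}^d$ that solves the martingale problem for $(L,C_0^\infty(\mathbb{R}^d))$ and such that $m$ is a sub-invariant measure for $\widetilde{\mathbb{M}}$, and let $(L,C_0^\infty(\mathbb{R}^d))$ be $L^1$-unique. Then $p^{\widetilde{\mathbb{M}}}_tf(x):=\widetilde{\mathbb{E}}_x[f(\widetilde X_t)]$ is an $m$-version of $T_tf$ for all bounded Borel functions $f\in L^1(\mathbb{R}^d,m)$ and all $t\ge0$, and $m$ is an invariant measure for $\widetilde{\mathbb{M}}$. (ii) If, additionally to the assumptions in (i), $(p^{\widetilde{\mathbb{M}}}_t)_{t\ge0}$ is strong Feller, then $\widetilde{\mathbb{P}}_x=\mathbb{P}_x$ for any $x\in\mathbb{R}^d$ (i.e. the law of $\widetilde X$ under $\widetilde{\mathbb{P}}_x$ coincides with the law of $X$ under $\mathbb{P}_x$).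
   Context: Setting. $d\ge2$. Assumption (a): $p>d$; $A=(a_{ij})_{1\le i,j\le d}$ with $a_{ji}=a_{ij}\in H^{1,2}_{loc}(\mathbb{R}^d)\cap C(\mathbb{R}^d)$, and for every open ball $B$ there are $\lambda_B,\Lambda_B>0$ with $\lambda_B\|\xi\|^2\le\langle A(x)\xi,\xi\rangle\le\Lambda_B\|\xi\|^2$ for all $\xi\in\mathbb{R}^d$, $x\in B$; $C=(c_{ij})$ with $-c_{ji}=c_{ij}\in H^{1,2}_{loc}(\mathbb{R}^d)\cap C(\mathbb{R}^d)$; $\mathbf{H}=(h_1,\dots,h_d)\in L^p_{loc}(\mathbb{R}^d,\mathbb{R}^d)$. Put $g_i=\frac12\sum_j\partial_j(a_{ij}+c_{ji})+h_i$, $\mathbf{G}=(g_1,\dots,g_d)$, and $Lf=\frac12\sum_{i,j}a_{ij}\partial_i\partial_jf+\langle\mathbf{G},\nabla f\rangle$ for $f\in C_0^\infty(\mathbb{R}^d)$. Assumption (b): $\mathbf{G}\in L^q_{loc}(\mathbb{R}^d,\mathbb{R}^d)$, where $q=\frac{pd}{p+d}$. Density. $\rho\in H^{1,p}_{loc}(\mathbb{R}^d)\cap C(\mathbb{R}^d)$ is a fixed function with $\rho>0$ everywhere and $\int L\varphi\,\rho\,dx=0$ for all $\varphi\in C_0^\infty(\mathbb{R}^d)$ (such $\rho$ exists under (a)); $m:=\rho\,dx$. Let $\beta^{\rho,A}$ have components $\beta^{\rho,A}_i=\frac12\sum_j(\partial_ja_{ij}+a_{ij}\frac{\partial_j\rho}{\rho})$,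 and put $\mathbf{B}:=\mathbf{G}-\beta^{\rho,A}\in L^2_{loc}(\mathbb{R}^d,\mathbb{R}^d,m)$; then $\int\langle\mathbf{B},\nabla f\rangle\,dm=0$ for all $f\in C_0^\infty(\mathbb{R}^d)$. Semigroup (construction of Stannat). For $V\subset\mathbb{R}^d$ open (including $V=\mathbb{R}^d$), let $(L^{0,V},D(L^{0,V}))$ be the generator on $L^2(V,m)$ of the closure of the symmetric form $\mathcal{E}^0(f,g)=\frac12\int\langle A\nabla f,\nabla g\rangle\,dm$, $f,g\in C_0^\infty(V)$; write $L^0=L^{0,\mathbb{R}^d}$. For $V$ bounded, the operator $L^{0,V}u+\langle\mathbf{B},\nabla u\rangle$ on bounded $u\in D(L^{0,V})$ is closable in $L^1(V,m)$ and its closure generates a sub-Markovian $C_0$-semigroup of contractions on $L^1(V,m)$; let $G^V_\alpha$ be its resolvent (extended by $0$ outside $V$). Define $G_\alpha f=\lim_nG^{V_n}_\alpha(f1_{V_n})$ in $L^1(\mathbb{R}^d,m)$ for $f\in L^1(\mathbb{R}^d,m)$, where $V_n$ are bounded open sets increasing to $\mathbb{R}^d$ with $\overline{V_n}\subset V_{n+1}$ (the limit does not depend on the choice). Then $(G_\alpha)_{\alpha>0}$ is the resolvent of a sub-Markovian $C_0$-semigroup of contractions $(T_t)_{t>0}$ on $L^1(\mathbb{R}^d,m)$ ($T_0:=\mathrm{id}$), whose generator extends $u\mapsto L^0u+\langle\mathbf{B},\nabla u\rangle$ on the bounded compactly supported $u\in D(L^0)$, in particular extends $(L,C_0^\infty(\mathbb{R}^d))$.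 $(T_t)$ restricted to $L^1\cap L^\infty$ extends to a $C_0$-semigroup of contractions on every $L^r(\mathbb{R}^d,m)$, $r\in[1,\infty)$, and, by monotone limits ($T_tf=\lim_nT_tf_n$ for $0\le f_n\uparrow f$, $f_n\in L^1\cap L^\infty$) and linearity, to $L^\infty(\mathbb{R}^d,m)$. Transition function and Hunt process. For $f\in L^s(\mathbb{R}^d,m)$, $s\in[1,\infty]$, $t>0$, $P_tf$ denotes the continuous $m$-version of $T_tf$ (it exists, and $(x,t)\mapsto P_tf(x)$ is continuous on $\mathbb{R}^d\times(0,\infty)$); $P_0:=\mathrm{id}$. $\mathbb{M}=(\Omega,\mathcal{F},(\mathcal{F}_t)_{t\ge0},(X_t)_{t\ge0},(\mathbb{P}_x)_{x\in\mathbb{R}^d\cup\{\Delta\}})$ is a Hunt process with state space $\mathbb{R}^d$, continuous sample paths in the one point compactification $\mathbb{R}^d_\Delta$ (cemetery $\Delta$ as point at infinity), and transition semigroup $(P_t)_{t\ge0}$, i.e. $\mathbb{E}_x[f(X_t)]=P_tf(x)$ for all $x\in\mathbb{R}^d$, $t\ge0$, bounded Borel $f$; such a process exists. Functions on $\mathbb{R}^d$ are extended by $0$ at $\Delta$. Definitions. $(L,C_0^\infty(\mathbb{R}^d))$ is $L^1$-unique if there is exactly one $C_0$-semigroup on $L^1(\mathbb{R}^d,m)$ whose generator extends $(L,C_0^\infty(\mathbb{R}^d))$. For a measure $\nu$ on $\mathbb{R}^d$, $\widetilde{\mathbb{P}}_\nu=\int\widetilde{\mathbb{P}}_x\,\nu(dx)$;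 $\widetilde{\mathbb{E}}_x$ is expectation under $\widetilde{\mathbb{P}}_x$. A right process $\widetilde{\mathbb{M}}$ with state space $\mathbb{R}^d$ and natural filtration $(\widetilde{\mathcal{F}}_t)_{t\ge0}$ solves the martingale problem for $(L,C_0^\infty(\mathbb{R}^d))$ if for all $u\in C_0^\infty(\mathbb{R}^d)$: (1) $\int_0^tLu(\widetilde X_s)\,ds$, $t\ge0$, is $\widetilde{\mathbb{P}}_m$-a.e. independent of the measurable $m$-version chosen for $Lu$; (2) $u(\widetilde X_t)-u(\widetilde X_0)-\int_0^tLu(\widetilde X_s)\,ds$, $t\ge0$, is a continuous $(\widetilde{\mathcal{F}}_t)_{t\ge0}$-martingale under $\widetilde{\mathbb{P}}_{vm}$ for any bounded nonnegative Borel $v$ with $\int v\,dm=1$. The measure $m$ is sub-invariant for $\widetilde{\mathbb{M}}$ if $\int\widetilde{\mathbb{E}}_x[f(\widetilde X_t)]\,m(dx)\le\int f\,dm$ for all bounded Borel $f\ge0$ in $L^1(\mathbb{R}^d,m)$ and all $t\ge0$; it is invariant for $\widetilde{\mathbb{M}}$ if "$\le$" can be replaced by "$=$". Strong Feller: for $t>0$ the transition function maps bounded Borel functions to continuous functions. *)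

theory Defs
  imports "HOL-Probability.Probability"
begin

section \<open>Test functions, weak derivatives, local Sobolev spaces\<close>

definition partial :: "'n::finite \<Rightarrow> (real^'n \<Rightarrow> real) \<Rightarrow> real^'n \<Rightarrow> real" where
  "partial i f x = frechet_derivative f (at x) (axis i 1)"

definition gradient :: "(real^'n::finite \<Rightarrow> real) \<Rightarrow> real^'n \<Rightarrow> real^'n" where
  "gradient f x = (\<chi> i. partial i f x)"

fun C_k :: "nat \<Rightarrow> (real^'n::finite \<Rightarrow> real) \<Rightarrow> bool" where
  "C_k 0 f \<longleftrightarrow> continuous_on UNIV f"
| "C_k (Suc k) f \<longleftrightarrow> f differentiable_on UNIV \<and> (\<forall>i. C_k k (partial i f))"

definition test_functions :: "(real^'n::finite) set \<Rightarrow> (real^'n \<Rightarrow> real) set" where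
  "test_functions V = {f. (\<forall>k. C_k k f) \<and>
     compact (closure {x. f x \<noteq> 0}) \<and> closure {x. f x \<noteq> 0} \<subseteq> V}"

definition locally_integrable_on :: "(real^'n::finite) set \<Rightarrow> (real^'n \<Rightarrow> real) \<Rightarrow> bool" where
  "locally_integrable_on V f \<longleftrightarrow>
     (\<forall>K. compact K \<and> K \<subseteq> V \<longrightarrow> set_integrable lborel K f)"

definition has_weak_partial ::
  "(real^'n::finite) set \<Rightarrow> 'n \<Rightarrow> (real^'n \<Rightarrow> real) \<Rightarrow> (real^'n \<Rightarrow> real) \<Rightarrow> bool" where
  "has_weak_partial V i f g \<longleftrightarrow>
     locally_integrable_on V f \<and> locally_integrable_on V g \<and>
     (\<forall>\<phi>\<in>test_functions V.
        (LINT x:V|lborel. f x * partial i \<phi> x) = - (LINT x:V|lborel. g x * \<phi> x))"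

text \<open>A representative; the weak derivative is determined only up to null sets. Nothing below
  depends on the representative chosen.\<close>

definition weak_partial ::
  "(real^'n::finite) set \<Rightarrow> 'n \<Rightarrow> (real^'n \<Rightarrow> real) \<Rightarrow> real^'n \<Rightarrow> real" where
  "weak_partial V i f = (SOME g. has_weak_partial V i f g)"

definition weak_gradient :: "(real^'n::finite) set \<Rightarrow> (real^'n \<Rightarrow> real) \<Rightarrow> real^'n \<Rightarrow> real^'n" where
  "weak_gradient V f x = (\<chi> i. weak_partial V i f x)"

definition Lp_loc :: "real \<Rightarrow> (real^'n::finite \<Rightarrow> real) \<Rightarrow> bool" where
  "Lp_loc r f \<longleftrightarrow> f \<in> borel_measurable borel \<and>
     (\<forall>K. compact K \<longrightarrow> set_integrable lborel K (\<lambda>x. \<bar>f x\<bar> powr r))"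

definition H1p_loc :: "real \<Rightarrow> (real^'n::finite \<Rightarrow> real) \<Rightarrow> bool" where
  "H1p_loc r f \<longleftrightarrow> Lp_loc r f \<and> (\<forall>i. \<exists>g. has_weak_partial UNIV i f g \<and> Lp_loc r g)"


section \<open>The coefficients, the operator and the density\<close>

definition assumption_a ::
  "real \<Rightarrow> (real^'n::finite \<Rightarrow> real^'n^'n) \<Rightarrow> (real^'n \<Rightarrow> real^'n^'n) \<Rightarrow> (real^'n \<Rightarrow> real^'n) \<Rightarrow> bool"
where
  "assumption_a p A C H \<longleftrightarrow>
     p > real CARD('n) \<and>
     (\<forall>i j. (\<forall>x. A x $ j $ i = A x $ i $ j) \<and>
            H1p_loc 2 (\<lambda>x. A x $ i $ j) \<and> continuous_on UNIV (\<lambda>x. A x $ i $ j)) \<and>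
     (\<forall>z r. r > 0 \<longrightarrow> (\<exists>l>0. \<exists>u>0. \<forall>\<xi>. \<forall>x\<in>ball z r.
            l * (norm \<xi>)\<^sup>2 \<le> (A x *v \<xi>) \<bullet> \<xi> \<and> (A x *v \<xi>) \<bullet> \<xi> \<le> u * (norm \<xi>)\<^sup>2)) \<and>
     (\<forall>i j. (\<forall>x. - (C x $ j $ i) = C x $ i $ j) \<and>
            H1p_loc 2 (\<lambda>x. C x $ i $ j) \<and> continuous_on UNIV (\<lambda>x. C x $ i $ j)) \<and>
     (\<forall>i. Lp_loc p (\<lambda>x. H x $ i))"

definition drift ::
  "(real^'n::finite \<Rightarrow> real^'n^'n) \<Rightarrow> (real^'n \<Rightarrow> real^'n^'n) \<Rightarrow> (real^'n \<Rightarrow> real^'n) \<Rightarrow>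
   real^'n \<Rightarrow> real^'n" where
  "drift A C H x =
     (\<chi> i. 1/2 * (\<Sum>j\<in>UNIV. weak_partial UNIV j (\<lambda>y. A y $ i $ j + C y $ j $ i) x) + H x $ i)"

definition assumption_b :: "real \<Rightarrow> (real^'n::finite \<Rightarrow> real^'n) \<Rightarrow> bool" where
  "assumption_b p G \<longleftrightarrow>
     (\<forall>i. Lp_loc (p * real CARD('n) / (p + real CARD('n))) (\<lambda>x. G x $ i))"

definition L_op ::
  "(real^'n::finite \<Rightarrow> real^'n^'n) \<Rightarrow> (real^'n \<Rightarrow> real^'n) \<Rightarrow> (real^'n \<Rightarrow> real) \<Rightarrow> real^'n \<Rightarrow> real"
where
  "L_op A G f x =
     1/2 * (\<Sum>i\<in>UNIV. \<Sum>j\<in>UNIV. A x $ i $ j * partial i (partial j f) x) + G x \<bullet> gradient f x"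

definition density_function ::
  "real \<Rightarrow> (real^'n::finite \<Rightarrow> real^'n^'n) \<Rightarrow> (real^'n \<Rightarrow> real^'n) \<Rightarrow> (real^'n \<Rightarrow> real) \<Rightarrow> bool" where
  "density_function p A G \<rho> \<longleftrightarrow>
     H1p_loc p \<rho> \<and> continuous_on UNIV \<rho> \<and> (\<forall>x. \<rho> x > 0) \<and>
     (\<forall>\<phi>\<in>test_functions UNIV. (LINT x|lborel. L_op A G \<phi> x * \<rho> x) = 0)"

definition m_of :: "(real^'n::finite \<Rightarrow> real) \<Rightarrow> (real^'n) measure" where
  "m_of \<rho> = density lborel (\<lambda>x. ennreal (\<rho> x))"

definition log_drift ::
  "(real^'n::finite \<Rightarrow> real^'n^'n) \<Rightarrow> (real^'n \<Rightarrow> real) \<Rightarrow> real^'n \<Rightarrow> real^'n" where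
  "log_drift A \<rho> x =
     (\<chi> i. 1/2 * (\<Sum>j\<in>UNIV. weak_partial UNIV j (\<lambda>y. A y $ i $ j) x
                        + A x $ i $ j * (weak_partial UNIV j \<rho> x / \<rho> x)))"


section \<open>Lebesgue spaces and operator semigroups\<close>

text \<open>Elements of $L^r(M)$ are handled through representatives. Operators act on
  representatives and are required to respect equality almost everywhere; operators with a
  domain are given by their graphs.\<close>

definition Lp_mem :: "real \<Rightarrow> 'a measure \<Rightarrow> ('a \<Rightarrow> real) \<Rightarrow> bool" where
  "Lp_mem r M f \<longleftrightarrow> f \<in> borel_measurable M \<and> integrable M (\<lambda>x. \<bar>f x\<bar> powr r)"

definition Linf_mem :: "'a measure \<Rightarrow> ('a \<Rightarrow> real) \<Rightarrow> bool" where
  "Linf_mem M f \<longleftrightarrow> f \<in> borel_measurable M \<and> (\<exists>c. AE x in M. \<bar>f x\<bar> \<le> c)"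

definition Lp_norm :: "real \<Rightarrow> 'a measure \<Rightarrow> ('a \<Rightarrow> real) \<Rightarrow> real" where
  "Lp_norm r M f = (LINT x|M. \<bar>f x\<bar> powr r) powr (1 / r)"

definition Lp_conv ::
  "real \<Rightarrow> 'a measure \<Rightarrow> ('i \<Rightarrow> 'a \<Rightarrow> real) \<Rightarrow> ('a \<Rightarrow> real) \<Rightarrow> 'i filter \<Rightarrow> bool" where
  "Lp_conv r M fs f F \<longleftrightarrow>
     Lp_mem r M f \<and> (\<forall>\<^sub>F i in F. Lp_mem r M (fs i)) \<and>
     ((\<lambda>i. Lp_norm r M (\<lambda>x. fs i x - f x)) \<longlongrightarrow> 0) F"

definition m_version :: "'a measure \<Rightarrow> ('a \<Rightarrow> real) \<Rightarrow> ('a \<Rightarrow> real) \<Rightarrow> bool" where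
  "m_version M f g \<longleftrightarrow> g \<in> borel_measurable M \<and> (AE x in M. g x = f x)"

definition C0_semigroup ::
  "real \<Rightarrow> 'a measure \<Rightarrow> (real \<Rightarrow> ('a \<Rightarrow> real) \<Rightarrow> 'a \<Rightarrow> real) \<Rightarrow> bool" where
  "C0_semigroup r M S \<longleftrightarrow>
     (\<forall>t\<ge>0. \<forall>f. Lp_mem r M f \<longrightarrow> Lp_mem r M (S t f)) \<and>
     (\<forall>t\<ge>0. \<forall>f g. Lp_mem r M f \<and> Lp_mem r M g \<and> (AE x in M. f x = g x) \<longrightarrow>
        (AE x in M. S t f x = S t g x)) \<and>
     (\<forall>t\<ge>0. \<forall>f g a b. Lp_mem r M f \<and> Lp_mem r M g \<longrightarrow>
        (AE x in M. S t (\<lambda>y. a * f y + b * g y) x = a * S t f x + b * S t g x)) \<and>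
     (\<forall>t\<ge>0. \<exists>c. \<forall>f. Lp_mem r M f \<longrightarrow> Lp_norm r M (S t f) \<le> c * Lp_norm r M f) \<and>
     (\<forall>f. Lp_mem r M f \<longrightarrow> (AE x in M. S 0 f x = f x)) \<and>
     (\<forall>s\<ge>0. \<forall>t\<ge>0. \<forall>f. Lp_mem r M f \<longrightarrow> (AE x in M. S (s + t) f x = S s (S t f) x)) \<and>
     (\<forall>f. Lp_mem r M f \<longrightarrow> Lp_conv r M (\<lambda>t. S t f) f (at_right 0))"

definition contractive ::
  "real \<Rightarrow> 'a measure \<Rightarrow> (real \<Rightarrow> ('a \<Rightarrow> real) \<Rightarrow> 'a \<Rightarrow> real) \<Rightarrow> bool" where
  "contractive r M S \<longleftrightarrow>
     (\<forall>t\<ge>0. \<forall>f. Lp_mem r M f \<longrightarrow> Lp_norm r M (S t f) \<le> Lp_norm r M f)"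

definition sub_Markovian ::
  "real \<Rightarrow> 'a measure \<Rightarrow> (real \<Rightarrow> ('a \<Rightarrow> real) \<Rightarrow> 'a \<Rightarrow> real) \<Rightarrow> bool" where
  "sub_Markovian r M S \<longleftrightarrow>
     (\<forall>t\<ge>0. \<forall>f. Lp_mem r M f \<and> (AE x in M. 0 \<le> f x \<and> f x \<le> 1) \<longrightarrow>
        (AE x in M. 0 \<le> S t f x \<and> S t f x \<le> 1))"

definition generator ::
  "real \<Rightarrow> 'a measure \<Rightarrow> (real \<Rightarrow> ('a \<Rightarrow> real) \<Rightarrow> 'a \<Rightarrow> real) \<Rightarrow>
   ('a \<Rightarrow> real) \<Rightarrow> ('a \<Rightarrow> real) \<Rightarrow> bool" where
  "generator r M S u w \<longleftrightarrow>
     Lp_mem r M u \<and> Lp_conv r M (\<lambda>t x. (S t u x - u x) / t) w (at_right 0)"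

text \<open>\<open>u\<close> represents $(\alpha - Q)^{-1} f$ for the operator with graph \<open>Q\<close>.\<close>

definition resolvent ::
  "'a measure \<Rightarrow> (('a \<Rightarrow> real) \<Rightarrow> ('a \<Rightarrow> real) \<Rightarrow> bool) \<Rightarrow> real \<Rightarrow>
   ('a \<Rightarrow> real) \<Rightarrow> ('a \<Rightarrow> real) \<Rightarrow> bool" where
  "resolvent M Q \<alpha> f u \<longleftrightarrow> (\<exists>w. Q u w \<and> (AE x in M. \<alpha> * u x - w x = f x))"

definition L1_closure ::
  "'a measure \<Rightarrow> (('a \<Rightarrow> real) \<Rightarrow> ('a \<Rightarrow> real) \<Rightarrow> bool) \<Rightarrow>
   ('a \<Rightarrow> real) \<Rightarrow> ('a \<Rightarrow> real) \<Rightarrow> bool" where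
  "L1_closure M Q u w \<longleftrightarrow>
     (\<exists>us ws. (\<forall>n. Q (us n) (ws n)) \<and>
        Lp_conv 1 M us u sequentially \<and> Lp_conv 1 M ws w sequentially)"

definition extends_L ::
  "(real^'n::finite \<Rightarrow> real^'n^'n) \<Rightarrow> (real^'n \<Rightarrow> real^'n) \<Rightarrow> (real^'n) measure \<Rightarrow>
   (real \<Rightarrow> (real^'n \<Rightarrow> real) \<Rightarrow> real^'n \<Rightarrow> real) \<Rightarrow> bool" where
  "extends_L A G m S \<longleftrightarrow> (\<forall>u\<in>test_functions UNIV. generator 1 m S u (L_op A G u))"

definition L1_unique ::
  "(real^'n::finite \<Rightarrow> real^'n^'n) \<Rightarrow> (real^'n \<Rightarrow> real^'n) \<Rightarrow> (real^'n) measure \<Rightarrow> bool" where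
  "L1_unique A G m \<longleftrightarrow>
     (\<exists>S. C0_semigroup 1 m S \<and> extends_L A G m S \<and>
        (\<forall>S'. C0_semigroup 1 m S' \<and> extends_L A G m S' \<longrightarrow>
           (\<forall>t\<ge>0. \<forall>f. Lp_mem 1 m f \<longrightarrow> (AE x in m. S' t f x = S t f x))))"


section \<open>Stannat's semigroup\<close>

definition E0 ::
  "(real^'n::finite \<Rightarrow> real^'n^'n) \<Rightarrow> (real^'n) measure \<Rightarrow> (real^'n \<Rightarrow> real) \<Rightarrow> (real^'n \<Rightarrow> real) \<Rightarrow> real"
where
  "E0 A m f g = 1/2 * (LINT x|m. (A x *v gradient f x) \<bullet> gradient g x)"

definition form_approx ::
  "(real^'n::finite \<Rightarrow> real^'n^'n) \<Rightarrow> (real^'n) measure \<Rightarrow> (real^'n) set \<Rightarrow>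
   (nat \<Rightarrow> real^'n \<Rightarrow> real) \<Rightarrow> (real^'n \<Rightarrow> real) \<Rightarrow> bool" where
  "form_approx A m V us u \<longleftrightarrow>
     (\<forall>n. us n \<in> test_functions V) \<and>
     Lp_conv 2 (restrict_space m V) us u sequentially \<and>
     (\<forall>e>0. \<exists>N. \<forall>k\<ge>N. \<forall>l\<ge>N. E0 A m (\<lambda>x. us k x - us l x) (\<lambda>x. us k x - us l x) < e)"

text \<open>\<open>L0 A m V u w\<close>: \<open>u\<close> is in the domain of the generator of the closed form and is mapped
  to \<open>w\<close>, that is, $\mathcal{E}(u,v) = -(w,v)$ for all \<open>v\<close> in the domain of the closed form.\<close>

definition L0 ::
  "(real^'n::finite \<Rightarrow> real^'n^'n) \<Rightarrow> (real^'n) measure \<Rightarrow> (real^'n) set \<Rightarrow>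
   (real^'n \<Rightarrow> real) \<Rightarrow> (real^'n \<Rightarrow> real) \<Rightarrow> bool" where
  "L0 A m V u w \<longleftrightarrow>
     (\<exists>us. form_approx A m V us u) \<and> Lp_mem 2 (restrict_space m V) w \<and>
     (\<forall>us v vs. form_approx A m V us u \<and> form_approx A m V vs v \<longrightarrow>
        (\<lambda>n. E0 A m (us n) (vs n)) \<longlonglongrightarrow> - (LINT x|restrict_space m V. w x * v x))"

definition LV ::
  "(real^'n::finite \<Rightarrow> real^'n^'n) \<Rightarrow> (real^'n \<Rightarrow> real^'n) \<Rightarrow> (real^'n) measure \<Rightarrow> (real^'n) set \<Rightarrow>
   (real^'n \<Rightarrow> real) \<Rightarrow> (real^'n \<Rightarrow> real) \<Rightarrow> bool" where
  "LV A B m V u w \<longleftrightarrow>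
     Linf_mem (restrict_space m V) u \<and>
     (\<exists>w0. L0 A m V u w0 \<and> m_version (restrict_space m V) (\<lambda>x. w0 x + B x \<bullet> weak_gradient V u x) w)"

text \<open>In the resolvent clause \<open>g n\<close> represents $G^{V_n}_\alpha (f 1_{V_n})$ and \<open>u\<close> represents
  $G_\alpha f$. The semigroup properties, the existence of these resolvents and the last two
  clauses are known facts of the construction; they are part of what it means here to be given
  the semigroup.\<close>

definition stannat_semigroup ::
  "(real^'n::finite \<Rightarrow> real^'n^'n) \<Rightarrow> (real^'n \<Rightarrow> real^'n) \<Rightarrow> (real^'n \<Rightarrow> real) \<Rightarrow>
   (real \<Rightarrow> (real^'n \<Rightarrow> real) \<Rightarrow> real^'n \<Rightarrow> real) \<Rightarrow> bool" where
  "stannat_semigroup A G \<rho> T \<longleftrightarrow>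
     (let m = m_of \<rho>; B = (\<lambda>x. G x - log_drift A \<rho> x) in
       C0_semigroup 1 m T \<and> contractive 1 m T \<and> sub_Markovian 1 m T \<and>
       (\<forall>V. (\<forall>n. open (V n) \<and> bounded (V n) \<and> closure (V n) \<subseteq> V (Suc n)) \<and>
            (\<Union>n. V n) = UNIV \<longrightarrow>
          (\<forall>\<alpha>>0. \<forall>f. Lp_mem 1 m f \<longrightarrow>
             (\<exists>g u. (\<forall>n::nat. resolvent (restrict_space m (V n))
                          (L1_closure (restrict_space m (V n)) (LV A B m (V n))) \<alpha> f (g n)) \<and>
                  Lp_conv 1 m (\<lambda>n x. indicator (V n) x * g n x) u sequentially \<and>
                  resolvent m (generator 1 m T) \<alpha> f u))) \<and>
       (\<forall>u w. LV A B m UNIV u w \<and> (\<exists>K. compact K \<and> (AE x in m. x \<notin> K \<longrightarrow> u x = 0)) \<longrightarrow>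
          generator 1 m T u w) \<and>
       extends_L A G m T)"

text \<open>\<open>T_Lr\<close> and \<open>T_Linf\<close>: \<open>g\<close> represents the value at \<open>f\<close> of the extension of \<open>T t\<close> from
  $L^1 \cap L^\infty$ to $L^r$ and, by monotone limits and linearity, to $L^\infty$.\<close>

definition T_Lr ::
  "(real^'n::finite) measure \<Rightarrow> (real \<Rightarrow> (real^'n \<Rightarrow> real) \<Rightarrow> real^'n \<Rightarrow> real) \<Rightarrow>
   real \<Rightarrow> real \<Rightarrow> (real^'n \<Rightarrow> real) \<Rightarrow> (real^'n \<Rightarrow> real) \<Rightarrow> bool" where
  "T_Lr m T r t f g \<longleftrightarrow>
     (\<exists>fs. (\<forall>n. Lp_mem 1 m (fs n) \<and> Linf_mem m (fs n)) \<and>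
        Lp_conv r m fs f sequentially \<and> Lp_conv r m (\<lambda>n. T t (fs n)) g sequentially)"

definition T_mono ::
  "(real^'n::finite) measure \<Rightarrow> (real \<Rightarrow> (real^'n \<Rightarrow> real) \<Rightarrow> real^'n \<Rightarrow> real) \<Rightarrow>
   real \<Rightarrow> (real^'n \<Rightarrow> real) \<Rightarrow> (real^'n \<Rightarrow> real) \<Rightarrow> bool" where
  "T_mono m T t f g \<longleftrightarrow>
     (\<exists>fs. (\<forall>n. Lp_mem 1 m (fs n) \<and> Linf_mem m (fs n)) \<and>
        (AE x in m. (\<forall>n. 0 \<le> fs n x \<and> fs n x \<le> fs (Suc n) x) \<and> (\<lambda>n. fs n x) \<longlonglongrightarrow> f x) \<and>
        (AE x in m. (\<lambda>n. T t (fs n) x) \<longlonglongrightarrow> g x))"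

definition T_Linf ::
  "(real^'n::finite) measure \<Rightarrow> (real \<Rightarrow> (real^'n \<Rightarrow> real) \<Rightarrow> real^'n \<Rightarrow> real) \<Rightarrow>
   real \<Rightarrow> (real^'n \<Rightarrow> real) \<Rightarrow> (real^'n \<Rightarrow> real) \<Rightarrow> bool" where
  "T_Linf m T t f g \<longleftrightarrow>
     (\<exists>g1 g2. T_mono m T t (\<lambda>x. max (f x) 0) g1 \<and> T_mono m T t (\<lambda>x. max (- f x) 0) g2 \<and>
        m_version m (\<lambda>x. g1 x - g2 x) g)"

definition continuous_version_of ::
  "(real^'n::finite) measure \<Rightarrow> (real \<Rightarrow> (real^'n \<Rightarrow> real) \<Rightarrow> real^'n \<Rightarrow> real) \<Rightarrow>
   (real \<Rightarrow> (real^'n \<Rightarrow> real) \<Rightarrow> real^'n \<Rightarrow> real) \<Rightarrow> bool" where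
  "continuous_version_of m T P \<longleftrightarrow>
     (\<forall>f. P 0 f = f) \<and>
     (\<forall>r\<ge>1. \<forall>f. Lp_mem r m f \<longrightarrow>
        (\<forall>t>0. T_Lr m T r t f (P t f)) \<and>
        continuous_on (UNIV \<times> {0<..}) (\<lambda>(x, t). P t f x)) \<and>
     (\<forall>f. Linf_mem m f \<longrightarrow>
        (\<forall>t>0. T_Linf m T t f (P t f)) \<and>
        continuous_on (UNIV \<times> {0<..}) (\<lambda>(x, t). P t f x))"


section \<open>Right processes and Hunt processes\<close>

text \<open>The cemetery is \<open>None\<close>. A process is given by a measurable space \<open>F\<close> (only \<open>space F\<close> and
  \<open>sets F\<close> matter), a filtration \<open>Ft\<close>, the coordinates \<open>X\<close> (times are nonnegative) and the
  laws \<open>Pr\<close> indexed by the starting point. The definitions follow Ma and Roeckner,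
  Introduction to the Theory of (Non-Symmetric) Dirichlet Forms, Chapter IV.1.\<close>

abbreviation Delta_top :: "(real^'n::finite) option topology" where
  "Delta_top \<equiv> Alexandroff_compactification euclidean"

definition Delta_borel :: "(real^'n::finite) option measure" where
  "Delta_borel = sigma UNIV {U. openin Delta_top U}"

definition ext0 :: "('a \<Rightarrow> real) \<Rightarrow> 'a option \<Rightarrow> real" where
  "ext0 f z = (case z of None \<Rightarrow> 0 | Some x \<Rightarrow> f x)"

definition universal_completion :: "'a measure \<Rightarrow> 'a measure" where
  "universal_completion M = sigma (space M)
     {A. A \<subseteq> space M \<and> (\<forall>\<mu>. prob_space \<mu> \<and> sets \<mu> = sets M \<longrightarrow> A \<in> sets (completion \<mu>))}"

text \<open>$\int P_z\,\mu(dz)$; the completion is there because the kernel is only universally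
  measurable.\<close>

definition mix :: "'w measure \<Rightarrow> ('s \<Rightarrow> 'w measure) \<Rightarrow> 's measure \<Rightarrow> 'w measure" where
  "mix F Pr \<mu> = measure_of (space F) (sets F) (\<lambda>\<Gamma>. \<integral>\<^sup>+z. emeasure (Pr z) \<Gamma> \<partial>completion \<mu>)"

definition past :: "'w measure \<Rightarrow> (real \<Rightarrow> 'w \<Rightarrow> (real^'n::finite) option) \<Rightarrow> real set \<Rightarrow> 'w measure" where
  "past F X J = sigma (space F) {X s -` A \<inter> space F |s A. s \<in> J \<and> A \<in> sets Delta_borel}"

text \<open>The natural filtration is the usual completion of $\sigma(X_s : s \le t)$ with respect to
  all initial distributions.\<close>

definition natural_filtration ::
  "'w measure \<Rightarrow> (real \<Rightarrow> 'w \<Rightarrow> (real^'n::finite) option) \<Rightarrow> ((real^'n) option \<Rightarrow> 'w measure) \<Rightarrow>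
   real \<Rightarrow> 'w measure" where
  "natural_filtration F X Pr t = sigma (space F)
     {\<Gamma>. \<Gamma> \<subseteq> space F \<and>
        (\<forall>\<mu>. prob_space \<mu> \<and> sets \<mu> = sets Delta_borel \<longrightarrow>
           (\<exists>\<Gamma>'\<in>sets (past F X {0..t}). \<exists>N\<in>sets (past F X {0..}).
              emeasure (mix F Pr \<mu>) N = 0 \<and> (\<Gamma> - \<Gamma>') \<union> (\<Gamma>' - \<Gamma>) \<subseteq> N))}"

definition stopping :: "'w measure \<Rightarrow> (real \<Rightarrow> 'w measure) \<Rightarrow> ('w \<Rightarrow> ennreal) \<Rightarrow> bool" where
  "stopping F Ft \<sigma> \<longleftrightarrow> (\<forall>t\<ge>0. {\<omega>\<in>space F. \<sigma> \<omega> \<le> ennreal t} \<in> sets (Ft t))"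

definition stopped_algebra ::
  "'w measure \<Rightarrow> (real \<Rightarrow> 'w measure) \<Rightarrow> ('w \<Rightarrow> ennreal) \<Rightarrow> 'w measure" where
  "stopped_algebra F Ft \<sigma> = sigma (space F)
     {\<Gamma>\<in>sets F. \<forall>t\<ge>0. \<Gamma> \<inter> {\<omega>\<in>space F. \<sigma> \<omega> \<le> ennreal t} \<in> sets (Ft t)}"

definition markov_process ::
  "'w measure \<Rightarrow> (real \<Rightarrow> 'w measure) \<Rightarrow> (real \<Rightarrow> 'w \<Rightarrow> (real^'n::finite) option) \<Rightarrow>
   ((real^'n) option \<Rightarrow> 'w measure) \<Rightarrow> bool" where
  "markov_process F Ft X Pr \<longleftrightarrow>
     (\<forall>t\<ge>0. space (Ft t) = space F \<and> sets (Ft t) \<subseteq> sets F) \<and>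
     (\<forall>s t. 0 \<le> s \<and> s \<le> t \<longrightarrow> sets (Ft s) \<subseteq> sets (Ft t)) \<and>
     (\<forall>t\<ge>0. X t \<in> Ft t \<rightarrow>\<^sub>M Delta_borel) \<and>
     (\<exists>\<zeta>\<in>borel_measurable F. \<forall>\<omega>\<in>space F. \<forall>t\<ge>0. X t \<omega> = None \<longleftrightarrow> \<zeta> \<omega> \<le> ennreal t) \<and>
     (\<forall>t\<ge>0. \<exists>\<theta>. (\<forall>\<omega>\<in>space F. \<theta> \<omega> \<in> space F \<and> (\<forall>s\<ge>0. X s (\<theta> \<omega>) = X (s + t) \<omega>))) \<and>
     (\<forall>z. prob_space (Pr z) \<and> space (Pr z) = space F \<and> sets (Pr z) = sets F) \<and>
     (\<forall>\<Gamma>\<in>sets F. (\<lambda>z. emeasure (Pr z) \<Gamma>) \<in> borel_measurable (universal_completion Delta_borel)) \<and>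
     (\<forall>\<Gamma>\<in>sets (past F X {0..}). (\<lambda>z. emeasure (Pr z) \<Gamma>) \<in> borel_measurable Delta_borel) \<and>
     (\<forall>A\<in>sets Delta_borel. \<forall>s\<ge>0. \<forall>t\<ge>0. \<forall>z. AE \<omega> in Pr z.
        real_cond_exp (Pr z) (Ft s) (indicator {\<omega>'\<in>space F. X (s + t) \<omega>' \<in> A}) \<omega> =
        measure (Pr (X s \<omega>)) {\<omega>'\<in>space F. X t \<omega>' \<in> A})"

definition right_process ::
  "'w measure \<Rightarrow> (real \<Rightarrow> 'w measure) \<Rightarrow> (real \<Rightarrow> 'w \<Rightarrow> (real^'n::finite) option) \<Rightarrow>
   ((real^'n) option \<Rightarrow> 'w measure) \<Rightarrow> bool" where
  "right_process F Ft X Pr \<longleftrightarrow>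
     markov_process F Ft X Pr \<and>
     (\<forall>z. AE \<omega> in Pr z. X 0 \<omega> = z) \<and>
     (\<forall>\<omega>\<in>space F. \<forall>t\<ge>0. limitin Delta_top (\<lambda>s. X s \<omega>) (X t \<omega>) (at_right t)) \<and>
     (\<forall>t\<ge>0. sets (Ft t) = (\<Inter>s\<in>{t<..}. sets (Ft s))) \<and>
     (\<forall>\<sigma>. stopping F Ft \<sigma> \<longrightarrow>
        (\<forall>\<mu>. prob_space \<mu> \<and> sets \<mu> = sets Delta_borel \<longrightarrow>
          (\<forall>A\<in>sets Delta_borel. \<forall>t\<ge>0. AE \<omega> in mix F Pr \<mu>. \<sigma> \<omega> < \<infinity> \<longrightarrow>
             real_cond_exp (mix F Pr \<mu>) (stopped_algebra F Ft \<sigma>)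
               (indicator {\<omega>'\<in>space F. \<sigma> \<omega>' < \<infinity> \<and> X (enn2real (\<sigma> \<omega>') + t) \<omega>' \<in> A}) \<omega> =
             measure (Pr (X (enn2real (\<sigma> \<omega>)) \<omega>)) {\<omega>'\<in>space F. X t \<omega>' \<in> A})))"

definition hunt_process ::
  "'w measure \<Rightarrow> (real \<Rightarrow> 'w measure) \<Rightarrow> (real \<Rightarrow> 'w \<Rightarrow> (real^'n::finite) option) \<Rightarrow>
   ((real^'n) option \<Rightarrow> 'w measure) \<Rightarrow> bool" where
  "hunt_process F Ft X Pr \<longleftrightarrow>
     right_process F Ft X Pr \<and>
     (\<forall>\<omega>\<in>space F. \<forall>t>0. \<exists>z. limitin Delta_top (\<lambda>s. X s \<omega>) z (at_left t)) \<and>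
     (\<forall>\<sigma>s \<sigma>. (\<forall>n::nat. stopping F Ft (\<sigma>s n)) \<and>
        (\<forall>\<omega>\<in>space F. incseq (\<lambda>n. \<sigma>s n \<omega>) \<and> (\<lambda>n. \<sigma>s n \<omega>) \<longlonglongrightarrow> \<sigma> \<omega>) \<longrightarrow>
        (\<forall>\<mu>. prob_space \<mu> \<and> sets \<mu> = sets Delta_borel \<longrightarrow>
          (AE \<omega> in mix F Pr \<mu>. \<sigma> \<omega> < \<infinity> \<longrightarrow>
             limitin Delta_top (\<lambda>n. X (enn2real (\<sigma>s n \<omega>)) \<omega>) (X (enn2real (\<sigma> \<omega>)) \<omega>) sequentially)))"

definition continuous_paths ::
  "'w measure \<Rightarrow> (real \<Rightarrow> 'w \<Rightarrow> (real^'n::finite) option) \<Rightarrow> bool" where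
  "continuous_paths F X \<longleftrightarrow>
     (\<forall>\<omega>\<in>space F. continuous_map (top_of_set {0..}) Delta_top (\<lambda>t. X t \<omega>))"

definition transition ::
  "(real \<Rightarrow> 'w \<Rightarrow> (real^'n::finite) option) \<Rightarrow> ((real^'n) option \<Rightarrow> 'w measure) \<Rightarrow>
   real \<Rightarrow> (real^'n \<Rightarrow> real) \<Rightarrow> real^'n \<Rightarrow> real" where
  "transition X Pr t f x = (LINT \<omega>|Pr (Some x). ext0 f (X t \<omega>))"

definition bounded_Borel :: "(real^'n::finite \<Rightarrow> real) set" where
  "bounded_Borel = {f. f \<in> borel_measurable borel \<and> bounded (range f)}"

definition has_transition_semigroup ::
  "(real \<Rightarrow> 'w \<Rightarrow> (real^'n::finite) option) \<Rightarrow> ((real^'n) option \<Rightarrow> 'w measure) \<Rightarrow>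
   (real \<Rightarrow> (real^'n \<Rightarrow> real) \<Rightarrow> real^'n \<Rightarrow> real) \<Rightarrow> bool" where
  "has_transition_semigroup X Pr P \<longleftrightarrow>
     (\<forall>t\<ge>0. \<forall>f\<in>bounded_Borel. \<forall>x. transition X Pr t f x = P t f x)"

definition strong_Feller ::
  "(real \<Rightarrow> 'w \<Rightarrow> (real^'n::finite) option) \<Rightarrow> ((real^'n) option \<Rightarrow> 'w measure) \<Rightarrow> bool" where
  "strong_Feller X Pr \<longleftrightarrow>
     (\<forall>t>0. \<forall>f\<in>bounded_Borel. continuous_on UNIV (transition X Pr t f))"

definition sub_invariant ::
  "(real^'n::finite) measure \<Rightarrow> (real \<Rightarrow> 'w \<Rightarrow> (real^'n) option) \<Rightarrow>
   ((real^'n) option \<Rightarrow> 'w measure) \<Rightarrow> bool" where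
  "sub_invariant m X Pr \<longleftrightarrow>
     (\<forall>f\<in>bounded_Borel. (\<forall>x. f x \<ge> 0) \<and> Lp_mem 1 m f \<longrightarrow>
        (\<forall>t\<ge>0. (\<integral>\<^sup>+x. ennreal (transition X Pr t f x) \<partial>m) \<le> (\<integral>\<^sup>+x. ennreal (f x) \<partial>m)))"

definition invariant ::
  "(real^'n::finite) measure \<Rightarrow> (real \<Rightarrow> 'w \<Rightarrow> (real^'n) option) \<Rightarrow>
   ((real^'n) option \<Rightarrow> 'w measure) \<Rightarrow> bool" where
  "invariant m X Pr \<longleftrightarrow>
     (\<forall>f\<in>bounded_Borel. (\<forall>x. f x \<ge> 0) \<and> Lp_mem 1 m f \<longrightarrow>
        (\<forall>t\<ge>0. (\<integral>\<^sup>+x. ennreal (transition X Pr t f x) \<partial>m) = (\<integral>\<^sup>+x. ennreal (f x) \<partial>m)))"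

definition path_law ::
  "(real \<Rightarrow> 'w \<Rightarrow> (real^'n::finite) option) \<Rightarrow> 'w measure \<Rightarrow> (real \<Rightarrow> (real^'n) option) measure" where
  "path_law X Q = distr Q (Pi\<^sub>M {0..} (\<lambda>_. Delta_borel)) (\<lambda>\<omega>. \<lambda>t\<in>{0..}. X t \<omega>)"


section \<open>The martingale problem\<close>

definition continuous_martingale ::
  "'w measure \<Rightarrow> (real \<Rightarrow> 'w measure) \<Rightarrow> (real \<Rightarrow> 'w \<Rightarrow> real) \<Rightarrow> bool" where
  "continuous_martingale Q Ft Y \<longleftrightarrow>
     (\<forall>t\<ge>0. Y t \<in> borel_measurable (Ft t) \<and> integrable Q (Y t)) \<and>
     (\<forall>s t. 0 \<le> s \<and> s \<le> t \<longrightarrow> (AE \<omega> in Q. real_cond_exp Q (Ft s) (Y t) \<omega> = Y s \<omega>)) \<and>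
     (AE \<omega> in Q. continuous_on {0..} (\<lambda>t. Y t \<omega>))"

definition initial :: "(real^'n::finite) measure \<Rightarrow> (real^'n) option measure" where
  "initial \<nu> = distr \<nu> Delta_borel Some"

text \<open>Clause (1) includes the existence of the integrals, which its informal version tacitly
  presupposes; by clause (1), the version \<open>w\<close> in clause (2) is immaterial.\<close>

definition solves_martingale_problem ::
  "(real^'n::finite \<Rightarrow> real^'n^'n) \<Rightarrow> (real^'n \<Rightarrow> real^'n) \<Rightarrow> (real^'n) measure \<Rightarrow>
   'w measure \<Rightarrow> (real \<Rightarrow> 'w measure) \<Rightarrow> (real \<Rightarrow> 'w \<Rightarrow> (real^'n) option) \<Rightarrow>
   ((real^'n) option \<Rightarrow> 'w measure) \<Rightarrow> bool" where
  "solves_martingale_problem A G m F Ft X Pr \<longleftrightarrow>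
     (\<forall>u\<in>test_functions UNIV.
        (\<forall>w w'. m_version m (L_op A G u) w \<and> m_version m (L_op A G u) w' \<longrightarrow>
           (AE \<omega> in mix F Pr (initial m). \<forall>t\<ge>0.
              set_integrable lborel {0..t} (\<lambda>s. ext0 w (X s \<omega>)) \<and>
              (LINT s:{0..t}|lborel. ext0 w (X s \<omega>)) = (LINT s:{0..t}|lborel. ext0 w' (X s \<omega>)))) \<and>
        (\<forall>w. m_version m (L_op A G u) w \<longrightarrow>
           (\<forall>v\<in>bounded_Borel. (\<forall>x. v x \<ge> 0) \<and> (\<integral>\<^sup>+x. ennreal (v x) \<partial>m) = 1 \<longrightarrow>
              continuous_martingale (mix F Pr (initial (density m (\<lambda>x. ennreal (v x))))) Ft
                (\<lambda>t \<omega>. ext0 u (X t \<omega>) - ext0 u (X 0 \<omega>) - (LINT s:{0..t}|lborel. ext0 w (X s \<omega>))))))"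

end

(* Idea. By right-continuity of paths and sub-invariance, the transition function p_t of the right
   process acts as a strongly continuous contraction semigroup on L^1(m). Taking expectations in the
   martingale problem for all starting densities gives  p_t u - u = int_0^t p_s (L u) ds  for test
   functions u, so its generator extends L and L^1-uniqueness identifies p_t with T_t.

   Uniqueness also forces conservation of mass: if mass were lost, one could reinject it with an
   arbitrary profile e, which replaces the generator value w of u by  w - (int w dm) e.  As
   int (L u) dm = 0 for test functions, the modified semigroup has a generator extending L as well,
   hence coincides with p_t; thus  int w dm = 0  for all generator pairs (u, w), in particular for
   u = int_0^t p_s f ds  and  w = p_t f - f,  which is invariance.

   If p_t is strong Feller, p_t f and P_t f are continuous m-versions of T_t f, so they agree
   everywhere because m has full support, and the Markov property determines the laws. *)
theory Submission
  imports Defs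
begin

section \<open>Kernels acting on $L^1$\<close>

text \<open>\<open>L1_unique\<close> ranges over all C0-semigroups whose generator extends L,
  positive and contractive or not. So the reinjected semigroup, which is neither shown to be
  positive nor contractive, is a legitimate competitor. Its generator is not a bounded perturbation:
  int w dm depends on the generator value w, not on u. The semigroup is therefore built by hand: the
  reinjected amount solves a scalar renewal equation, and a profile e in the domain of the generator
  gives this equation a continuous kernel. Such profiles are time integrals
  \<open>J \<tau> e0\<close>; a small \<tau> keeps int e dm away from 0, which the final
  cancellation needs.

  Strong continuity is the other obstacle. Right-continuous paths yield only the pointwise
  convergence of p_t 1_U to 1 on an open set U. Sub-invariance bounds the total mass and thereby the
  excess outside U; a Dynkin argument then reaches all of L^1.

  Operators act on representatives. On integrable functions the algebraic laws hold almost
  everywhere, on bounded ones at every point; this is why truncations and bounded profiles keep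
  appearing.\<close>

lemma Lp_mem_1: "Lp_mem 1 M f \<longleftrightarrow> integrable M f"
proof -
  have "f \<in> borel_measurable M \<Longrightarrow> integrable M (\<lambda>x. \<bar>f x\<bar>) \<longleftrightarrow> integrable M f"
    by (rule integrable_abs_iff)
  then show ?thesis unfolding Lp_mem_def by auto
qed

lemma Lp_norm_1: "Lp_norm 1 M f = (LINT x|M. \<bar>f x\<bar>)"
  unfolding Lp_norm_def by simp

lemma Lp_conv_1:
  "Lp_conv 1 M fs f F \<longleftrightarrow> integrable M f \<and> (\<forall>\<^sub>F i in F. integrable M (fs i)) \<and>
     ((\<lambda>i. LINT x|M. \<bar>fs i x - f x\<bar>) \<longlongrightarrow> 0) F"
  unfolding Lp_conv_def Lp_mem_1 Lp_norm_1 by simp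

lemma L1_triangle:
  fixes f g h :: "'a \<Rightarrow> real"
  assumes "integrable M f" "integrable M g" "integrable M h"
  shows "(LINT x|M. \<bar>f x - h x\<bar>) \<le> (LINT x|M. \<bar>f x - g x\<bar>) + (LINT x|M. \<bar>g x - h x\<bar>)"
proof -
  have "(LINT x|M. \<bar>f x - h x\<bar>) \<le> (LINT x|M. \<bar>f x - g x\<bar> + \<bar>g x - h x\<bar>)"
    using assms by (intro integral_mono) auto
  also have "\<dots> = (LINT x|M. \<bar>f x - g x\<bar>) + (LINT x|M. \<bar>g x - h x\<bar>)"
    using assms by (intro Bochner_Integration.integral_add) auto
  finally show ?thesis .
qed

lemma L1_add_le:
  fixes f g :: "'a \<Rightarrow> real"
  assumes "integrable M f" "integrable M g"
  shows "(LINT x|M. \<bar>f x + g x\<bar>) \<le> (LINT x|M. \<bar>f x\<bar>) + (LINT x|M. \<bar>g x\<bar>)"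
proof -
  have "(LINT x|M. \<bar>f x + g x\<bar>) \<le> (LINT x|M. \<bar>f x\<bar> + \<bar>g x\<bar>)"
    using assms by (intro integral_mono) auto
  also have "\<dots> = (LINT x|M. \<bar>f x\<bar>) + (LINT x|M. \<bar>g x\<bar>)"
    using assms by (intro Bochner_Integration.integral_add) auto
  finally show ?thesis .
qed

lemma L1_eq_0_AE:
  fixes f g :: "'a \<Rightarrow> real"
  assumes "integrable M f" "integrable M g" "(LINT x|M. \<bar>f x - g x\<bar>) = 0"
  shows "AE x in M. f x = g x"
proof -
  have "AE x in M. \<bar>f x - g x\<bar> = 0"
    using assms by (subst integral_nonneg_eq_0_iff_AE[symmetric]) auto
  then show ?thesis by auto
qed

lemma integrable_truncate:
  fixes f :: "'a \<Rightarrow> real"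
  assumes "integrable M f" "c \<ge> 0"
  shows "integrable M (\<lambda>x. max (-c) (min c (f x)))"
  using assms(1) by (rule Bochner_Integration.integrable_bound) (use assms in auto)

lemma truncate_L1_tendsto:
  fixes f :: "'a \<Rightarrow> real"
  assumes "integrable M f"
  shows "(\<lambda>n. LINT x|M. \<bar>max (- real n) (min (real n) (f x)) - f x\<bar>) \<longlonglongrightarrow> 0"
proof -
  have "(\<lambda>n. LINT x|M. \<bar>max (- real n) (min (real n) (f x)) - f x\<bar>) \<longlonglongrightarrow> (LINT x|M. 0)"
  proof (rule integral_dominated_convergence[where w="\<lambda>x. \<bar>f x\<bar>"])
    show "AE x in M. (\<lambda>n. \<bar>max (- real n) (min (real n) (f x)) - f x\<bar>) \<longlonglongrightarrow> 0"
    proof (rule AE_I2)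
      fix x
      obtain N where N: "\<bar>f x\<bar> \<le> real N" using real_arch_simple by blast
      have "\<forall>\<^sub>F n in sequentially. \<bar>max (- real n) (min (real n) (f x)) - f x\<bar> = 0"
        using eventually_ge_at_top[of N] by eventually_elim (use N in auto)
      then show "(\<lambda>n. \<bar>max (- real n) (min (real n) (f x)) - f x\<bar>) \<longlonglongrightarrow> 0"
        by (rule tendsto_eventually)
    qed
  qed (use assms in auto)
  then show ?thesis by simp
qed

text \<open>The analytic half of the proof uses no topology, only sub-Markov kernels on a
  sigma-finite space. Joint measurability is required on the whole time line so that Lebesgue
  integrals over time can be formed freely; the algebraic axioms concern nonnegative times.\<close>

locale subinvariant_kernels = sigma_finite_measure m
  for m :: "'a measure" +
  fixes k :: "real \<Rightarrow> 'a \<Rightarrow> 'a measure"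
  assumes kernel_measurable: "(\<lambda>(t, x). k t x) \<in> borel \<Otimes>\<^sub>M m \<rightarrow>\<^sub>M subprob_algebra m"
    and kernel_0: "x \<in> space m \<Longrightarrow> k 0 x = return m x"
    and kernel_add: "0 \<le> s \<Longrightarrow> 0 \<le> t \<Longrightarrow> x \<in> space m \<Longrightarrow> A \<in> sets m \<Longrightarrow>
      emeasure (k (s + t) x) A = (\<integral>\<^sup>+y. emeasure (k t y) A \<partial>k s x)"
    and subinvariant: "0 \<le> t \<Longrightarrow> A \<in> sets m \<Longrightarrow>
      (\<integral>\<^sup>+x. emeasure (k t x) A \<partial>m) \<le> emeasure m A"
begin

text \<open>Where \<open>f\<close> is not integrable with respect to \<open>k t x\<close>, \<open>p t f x\<close> is the junk value 0; for
  integrable \<open>f\<close> this concerns a null set of \<open>x\<close> only.\<close>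

definition p :: "real \<Rightarrow> ('a \<Rightarrow> real) \<Rightarrow> 'a \<Rightarrow> real" where
  "p t f x = (\<integral>y. f y \<partial>k t x)"

lemma kernel_measurable_snd: "k t \<in> m \<rightarrow>\<^sub>M subprob_algebra m"
  using measurable_compose[OF measurable_Pair1' kernel_measurable, of t] by simp

lemma subprob_kernel: "x \<in> space m \<Longrightarrow> subprob_space (k t x)"
  and sets_kernel: "x \<in> space m \<Longrightarrow> sets (k t x) = sets m"
  and space_kernel: "x \<in> space m \<Longrightarrow> space (k t x) = space m"
proof -
  assume "x \<in> space m"
  then have "k t x \<in> space (subprob_algebra m)"
    using kernel_measurable_snd[of t] by (rule measurable_space[rotated])
  then show "subprob_space (k t x)" "sets (k t x) = sets m"
    by (auto simp: space_subprob_algebra)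
  then show "space (k t x) = space m" by (auto dest: sets_eq_imp_space_eq)
qed

lemma measurable_kernel:
  "f \<in> m \<rightarrow>\<^sub>M N \<Longrightarrow> x \<in> space m \<Longrightarrow> f \<in> k t x \<rightarrow>\<^sub>M N"
  using measurable_cong_sets[OF sets_kernel refl] by blast

lemma finite_kernel: "x \<in> space m \<Longrightarrow> finite_measure (k t x)"
  using subprob_kernel by (simp add: subprob_space_def)

text \<open>As an equality of measures, the Chapman-Kolmogorov equation can be integrated against
  functions and not only evaluated on sets.\<close>

lemma kernel_add_bind:
  assumes "0 \<le> s" "0 \<le> t" "x \<in> space m"
  shows "k (s + t) x = k s x \<bind> k t"
proof (rule measure_eqI)
  have k: "k t \<in> k s x \<rightarrow>\<^sub>M subprob_algebra m"
    using kernel_measurable_snd assms(3) by (rule measurable_kernel)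
  have ne: "space (k s x) \<noteq> {}" using assms space_kernel by auto
  show "sets (k (s + t) x) = sets (k s x \<bind> k t)"
    using assms(3) sets_kernel sets_bind[of "k s x" "k t" m] ne space_kernel by simp
  fix A assume "A \<in> sets (k (s + t) x)"
  then have A: "A \<in> sets m" using assms sets_kernel by simp
  show "emeasure (k (s + t) x) A = emeasure (k s x \<bind> k t) A"
    using kernel_add[OF assms A] emeasure_bind[OF ne k A] by simp
qed

lemma p_measurable2:
  assumes "f \<in> borel_measurable m"
  shows "(\<lambda>(t, x). p t f x) \<in> borel_measurable (borel \<Otimes>\<^sub>M m)"
proof -
  have "(\<lambda>M. \<integral>y. f y \<partial>M) \<in> borel_measurable (subprob_algebra m)"
    using assms by simp
  from measurable_compose[OF kernel_measurable this]
  show ?thesis by (simp add: p_def case_prod_unfold)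
qed

lemma p_measurable [measurable]:
  assumes "f \<in> borel_measurable m"
  shows "p t f \<in> borel_measurable m"
  using measurable_compose[OF measurable_Pair1' p_measurable2[OF assms], of t] by simp

lemma p_measurable_time:
  assumes "f \<in> borel_measurable m" "x \<in> space m"
  shows "(\<lambda>t. p t f x) \<in> borel_measurable borel"
  using measurable_compose[OF measurable_Pair2' p_measurable2[OF assms(1)], of x] assms(2) by simp

lemma nn_kernel_measurable:
  assumes "f \<in> borel_measurable m"
  shows "(\<lambda>x. \<integral>\<^sup>+y. f y \<partial>k t x) \<in> borel_measurable m"
  using assms kernel_measurable_snd
  by (intro measurable_compose[OF kernel_measurable_snd nn_integral_measurable_subprob_algebra])

text \<open>Sub-invariance says that the measure \<open>m \<bind> k t\<close> lies below
  \<open>m\<close>. Monotonicity of the integral in the measure then settles all nonnegative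
  functions at once.\<close>

lemma nn_subinvariant:
  assumes "0 \<le> t" and f: "f \<in> borel_measurable m"
  shows "(\<integral>\<^sup>+x. \<integral>\<^sup>+y. f y \<partial>k t x \<partial>m) \<le> (\<integral>\<^sup>+x. f x \<partial>m)"
\<comment> \<open>The rules for \<open>bind\<close> presuppose a nonempty space.\<close>
proof (cases "space m = {}")
  case False
  have sets: "sets (m \<bind> k t) = sets m"
    using sets_bind[OF sets_kernel False] by simp
  have "m \<bind> k t \<le> m"
    using subinvariant[OF assms(1)]
    by (subst le_measure[OF sets]) (simp add: sets emeasure_bind[OF False kernel_measurable_snd])
  then show ?thesis
    using nn_integral_mono_measure[OF sets _, of f] nn_integral_bind[OF f kernel_measurable_snd, of t] by simp
qed (simp add: nn_integral_empty)

text \<open>The iterated integral of the absolute value is finite by sub-invariance, so the inner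
  one is finite almost everywhere. The exceptional null set is the reason why linearity of
  \<open>p t\<close> is stated almost everywhere below.\<close>

lemma AE_kernel_integrable:
  fixes f :: "'a \<Rightarrow> real"
  assumes t: "0 \<le> t" and f: "integrable m f"
  shows "AE x in m. integrable (k t x) f"
proof -
  have "(\<integral>\<^sup>+x. \<integral>\<^sup>+y. norm (f y) \<partial>k t x \<partial>m) \<le> (\<integral>\<^sup>+x. norm (f x) \<partial>m)"
    using t f by (intro nn_subinvariant) auto
  also have "\<dots> < \<infinity>" using f by (auto simp: integrable_iff_bounded)
  finally have "AE x in m. (\<integral>\<^sup>+y. norm (f y) \<partial>k t x) \<noteq> \<infinity>"
    using f nn_kernel_measurable by (intro nn_integral_PInf_AE) auto
  then show ?thesis
  proof (rule AE_mp, intro AE_I2 impI)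
    fix x assume "x \<in> space m" "(\<integral>\<^sup>+y. norm (f y) \<partial>k t x) \<noteq> \<infinity>"
    then show "integrable (k t x) f"
      using f measurable_kernel
      by (auto simp: integrable_iff_bounded top.not_eq_extremum)
  qed
qed

text \<open>Both claims are \<open>nn_subinvariant\<close> applied to the absolute value of
  f.\<close>

lemma p_L1:
  fixes f :: "'a \<Rightarrow> real"
  assumes t: "0 \<le> t" and f: "integrable m f"
  shows p_integrable: "integrable m (p t f)"
    and p_contraction: "(LINT x|m. \<bar>p t f x\<bar>) \<le> (LINT x|m. \<bar>f x\<bar>)"
proof -
  have meas: "p t f \<in> borel_measurable m" using f by (intro p_measurable) auto
  have "(\<integral>\<^sup>+x. norm (p t f x) \<partial>m) \<le> (\<integral>\<^sup>+x. \<integral>\<^sup>+y. norm (f y) \<partial>k t x \<partial>m)"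
    using AE_kernel_integrable[OF t f]
    by (intro nn_integral_mono_AE, eventually_elim) (simp add: p_def integral_norm_bound_ennreal del: real_norm_def)
  also have "\<dots> \<le> (\<integral>\<^sup>+x. norm (f x) \<partial>m)"
    using t f by (intro nn_subinvariant) auto
  finally have *: "(\<integral>\<^sup>+x. norm (p t f x) \<partial>m) \<le> (\<integral>\<^sup>+x. norm (f x) \<partial>m)" .
  also have "\<dots> < \<infinity>" using f by (auto simp: integrable_iff_bounded)
  finally show int: "integrable m (p t f)" using meas by (auto simp: integrable_iff_bounded)
  show "(LINT x|m. \<bar>p t f x\<bar>) \<le> (LINT x|m. \<bar>f x\<bar>)"
    using * f int by (simp add: nn_integral_eq_integral)
qed

lemma p_linear_AE:
  fixes f g :: "'a \<Rightarrow> real"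
  assumes "0 \<le> t" "integrable m f" "integrable m g"
  shows "AE x in m. p t (\<lambda>y. a * f y + b * g y) x = a * p t f x + b * p t g x"
  using AE_kernel_integrable[OF assms(1,2)] AE_kernel_integrable[OF assms(1,3)]
  by eventually_elim (simp add: p_def)

lemma p_add_AE:
  assumes "0 \<le> t" "integrable m f" "integrable m g"
  shows "AE x in m. p t (\<lambda>y. f y + g y) x = p t f x + p t g x"
  using p_linear_AE[OF assms, of 1 1] by simp

lemma p_diff_AE:
  assumes "0 \<le> t" "integrable m f" "integrable m g"
  shows "AE x in m. p t (\<lambda>y. f y - g y) x = p t f x - p t g x"
  using p_linear_AE[OF assms, of 1 "-1"] by simp

text \<open>No exceptional set here: if f is not integrable for the kernel, both sides are
  0.\<close>

lemma p_cmult: "p t (\<lambda>y. c * f y) x = c * p t f x"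
  unfolding p_def by simp

lemma p_L1_dist:
  assumes "0 \<le> t" "integrable m f" "integrable m g"
  shows "(LINT x|m. \<bar>p t f x - p t g x\<bar>) \<le> (LINT x|m. \<bar>f x - g x\<bar>)"
proof -
  have "(LINT x|m. \<bar>p t f x - p t g x\<bar>) = (LINT x|m. \<bar>p t (\<lambda>y. f y - g y) x\<bar>)"
    using p_diff_AE[OF assms] assms p_integrable by (intro integral_cong_AE) (auto intro!: borel_measurable_integrable)
  also have "\<dots> \<le> (LINT x|m. \<bar>f x - g x\<bar>)"
    using assms by (intro p_contraction) auto
  finally show ?thesis .
qed

text \<open>Single kernels may charge \<open>m\<close>-null sets, but the contraction estimate shows
  that this happens for almost no x in a way that could be seen by f and g. Thus \<open>p t\<close>
  is well defined on classes.\<close>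

lemma p_cong_AE:
  assumes "0 \<le> t" "integrable m f" "integrable m g" "AE x in m. f x = g x"
  shows "AE x in m. p t f x = p t g x"
proof (rule L1_eq_0_AE)
  have "(LINT x|m. \<bar>f x - g x\<bar>) = 0"
    using assms by (intro integral_eq_zero_AE) auto
  then show "(LINT x|m. \<bar>p t f x - p t g x\<bar>) = 0"
    using p_L1_dist[OF assms(1-3)] by (simp add: order_antisym)
qed (use assms p_integrable in auto)

lemma p_0: "f \<in> borel_measurable m \<Longrightarrow> x \<in> space m \<Longrightarrow> p 0 f x = f x"
  unfolding p_def by (simp add: kernel_0 integral_return)

lemma p_bounded:
  assumes "f \<in> borel_measurable m" "\<And>y. y \<in> space m \<Longrightarrow> \<bar>f y\<bar> \<le> c" "x \<in> space m"
  shows "\<bar>p t f x\<bar> \<le> c"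
proof -
  interpret subprob_space "k t x" using subprob_kernel assms(3) .
  have c: "c \<ge> 0" using assms(2)[OF assms(3)] by simp
  have "\<bar>p t f x\<bar> \<le> (LINT y|k t x. \<bar>f y\<bar>)" unfolding p_def using integral_norm_bound[of "k t x" f] by simp
  also have "\<dots> \<le> (LINT y|k t x. c)"
    using assms c space_kernel
    by (intro integral_mono integrable_const_bound[where B=c] measurable_kernel) auto
  also have "\<dots> \<le> c" using c subprob_measure_le_1 by (simp add: mult_left_le_one_le)
  finally show ?thesis .
qed

text \<open>Bounded functions are integrable for every kernel, so the semigroup law holds at every
  point. The time integrals below rely on this, since they involve uncountably many times at
  once.\<close>

lemma p_add_bounded:
  assumes "0 \<le> s" "0 \<le> t" "f \<in> borel_measurable m" "\<And>y. y \<in> space m \<Longrightarrow> \<bar>f y\<bar> \<le> c" "x \<in> space m"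
  shows "p (s + t) f x = p s (p t f) x"
proof -
  interpret subprob_space "k s x" using subprob_kernel assms(5) .
  have k: "k t \<in> k s x \<rightarrow>\<^sub>M subprob_algebra m"
    using kernel_measurable_snd assms(5) by (rule measurable_kernel)
  have ne: "space (k s x) \<noteq> {}" using assms space_kernel by auto
  have "p (s + t) f x = (\<integral>z. f z \<partial>(k s x \<bind> k t))"
    unfolding p_def using kernel_add_bind assms by simp
  also have "\<dots> = (\<integral>y. \<integral>z. f z \<partial>k t y \<partial>k s x)"
    using assms space_kernel
    by (intro integral_bind[OF assms(3) _ k, where B=c and B'=1])
      (auto intro!: finite_kernel AE_I2 simp: subprob_space.subprob_emeasure_le_1[OF subprob_kernel])
  finally show ?thesis unfolding p_def .
qed

text \<open>Truncations of f obey the law pointwise. Replacing f by a truncation costs one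
  truncation error on each side, hence the factor 2 in the estimate.\<close>

lemma p_semigroup_AE:
  assumes "0 \<le> s" "0 \<le> t" "integrable m f"
  shows "AE x in m. p (s + t) f x = p s (p t f) x"
proof (rule L1_eq_0_AE)
  let ?f = "\<lambda>n x. max (- real n) (min (real n) (f x))"
  have fi: "integrable m (?f n)" for n using assms by (intro integrable_truncate) auto
  have "(LINT x|m. \<bar>p (s + t) f x - p s (p t f) x\<bar>) \<le> 2 * (LINT x|m. \<bar>?f n x - f x\<bar>)" for n
  proof -
    have eq: "p (s + t) (?f n) x = p s (p t (?f n)) x" if "x \<in> space m" for x
      using assms that by (intro p_add_bounded[where c=n]) auto
    have "(LINT x|m. \<bar>p (s + t) f x - p s (p t f) x\<bar>) \<le>
       (LINT x|m. \<bar>p (s + t) f x - p (s + t) (?f n) x\<bar>) + (LINT x|m. \<bar>p (s + t) (?f n) x - p s (p t f) x\<bar>)"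
      using assms fi by (intro L1_triangle p_integrable) auto
    also have "(LINT x|m. \<bar>p (s + t) (?f n) x - p s (p t f) x\<bar>) = (LINT x|m. \<bar>p s (p t (?f n)) x - p s (p t f) x\<bar>)"
      using eq by (intro Bochner_Integration.integral_cong) auto
    also have "\<dots> \<le> (LINT x|m. \<bar>p t (?f n) x - p t f x\<bar>)"
      using assms fi by (intro p_L1_dist p_integrable) auto
    also have "\<dots> \<le> (LINT x|m. \<bar>?f n x - f x\<bar>)"
      using assms fi by (intro p_L1_dist p_integrable) auto
    also have "(LINT x|m. \<bar>p (s + t) f x - p (s + t) (?f n) x\<bar>) \<le> (LINT x|m. \<bar>f x - ?f n x\<bar>)"
      using assms fi by (intro p_L1_dist p_integrable) auto
    also have "\<dots> = (LINT x|m. \<bar>?f n x - f x\<bar>)" by (simp add: abs_minus_commute)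
    finally show ?thesis by simp
  qed
  then have "(LINT x|m. \<bar>p (s + t) f x - p s (p t f) x\<bar>) \<le> 0"
    by (intro tendsto_lowerbound[where F=sequentially, OF
        tendsto_mult_right_zero[OF truncate_L1_tendsto[OF assms(3)]] always_eventually]) auto
  then show "(LINT x|m. \<bar>p (s + t) f x - p s (p t f) x\<bar>) = 0"
    by (intro antisym) auto
qed (use assms p_integrable in auto)

lemma C0_semigroup_p:
  assumes cont: "\<And>f. integrable m f \<Longrightarrow> ((\<lambda>t. LINT x|m. \<bar>p t f x - f x\<bar>) \<longlongrightarrow> 0) (at_right 0)"
  shows "C0_semigroup 1 m p"
  unfolding C0_semigroup_def Lp_mem_1 Lp_norm_1 Lp_conv_1
proof (intro conjI)
  show "\<forall>t\<ge>0. \<exists>c. \<forall>f. integrable m f \<longrightarrow> (LINT x|m. \<bar>p t f x\<bar>) \<le> c * (LINT x|m. \<bar>f x\<bar>)"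
    using p_contraction by (intro allI impI exI[of _ 1]) simp
  show "\<forall>f. integrable m f \<longrightarrow> (AE x in m. p 0 f x = f x)"
    by (intro allI impI AE_I2 p_0) auto
  show "\<forall>f. integrable m f \<longrightarrow> integrable m f \<and> (\<forall>\<^sub>F t in at_right 0. integrable m (p t f)) \<and>
      ((\<lambda>t. LINT x|m. \<bar>p t f x - f x\<bar>) \<longlongrightarrow> 0) (at_right 0)"
    using p_integrable cont by (auto simp: eventually_at_filter)
qed (use p_integrable in simp, use p_cong_AE in simp, use p_linear_AE in simp, use p_semigroup_AE in simp)

end

section \<open>Integrals over time and Volterra equations\<close>

lemma set_integrable_Icc_bounded:
  fixes h :: "real \<Rightarrow> real"
  assumes "h \<in> borel_measurable borel" "\<And>s. s \<in> {a..b} \<Longrightarrow> \<bar>h s\<bar> \<le> c"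
  shows "set_integrable lborel {a..b} h"
  unfolding set_integrable_def
proof (rule Bochner_Integration.integrable_bound[of _ "\<lambda>s. indicator {a..b} s *\<^sub>R c"])
  show "integrable lborel (\<lambda>s. indicator {a..b} s *\<^sub>R c)" by (intro integrable_scaleR_left integrable_real_indicator) (auto simp: emeasure_lborel_Icc_eq)
  show "AE s in lborel. norm (indicator {a..b} s *\<^sub>R h s) \<le> norm (indicator {a..b} s *\<^sub>R c)"
    using assms(2) by (intro AE_I2) (force split: split_indicator)
qed (use assms(1) in simp_all)

lemma LINT_Icc_split:
  fixes h :: "real \<Rightarrow> real"
  assumes "set_integrable lborel {a..c} h" "a \<le> b" "b \<le> c"
  shows "(LINT s:{a..c}|lborel. h s) = (LINT s:{a..b}|lborel. h s) + (LINT s:{b..c}|lborel. h s)"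
proof -
  have 1: "set_integrable lborel {a..b} h" "set_integrable lborel {b..c} h"
    using assms by (auto intro: set_integrable_subset)
  show ?thesis
    using Henstock_Kurzweil_Integration.integral_combine[OF assms(2,3) set_borel_integral_eq_integral(1)[OF assms(1)]]
    by (simp add: set_borel_integral_eq_integral(2) assms(1) 1)
qed

lemma LINT_Icc_shift:
  fixes h :: "real \<Rightarrow> real"
  shows "(LINT s:{a+c..b+c}|lborel. h s) = (LINT s:{a..b}|lborel. h (s + c))"
  unfolding set_lebesgue_integral_def
  by (subst lborel_integral_real_affine[where c=1 and t=c])
    (auto intro!: Bochner_Integration.integral_cong split: split_indicator simp: add.commute)

lemma LINT_Icc_reflect:
  fixes h :: "real \<Rightarrow> real"
  shows "(LINT s:{0..t}|lborel. h (t - s)) = (LINT s:{0..t}|lborel. h s)"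
  unfolding set_lebesgue_integral_def
  by (subst (2) lborel_integral_real_affine[where c="-1" and t=t])
    (auto intro!: Bochner_Integration.integral_cong split: split_indicator)

lemma LINT_Icc_bound:
  fixes h :: "real \<Rightarrow> real"
  assumes "h \<in> borel_measurable borel" "\<And>s. s \<in> {a..b} \<Longrightarrow> \<bar>h s\<bar> \<le> c" "a \<le> b"
  shows "\<bar>LINT s:{a..b}|lborel. h s\<bar> \<le> c * (b - a)"
proof -
  have "\<bar>LINT s:{a..b}|lborel. h s\<bar> \<le> (LINT s:{a..b}|lborel. \<bar>h s\<bar>)"
    unfolding set_lebesgue_integral_def
    by (rule order_trans[OF integral_abs_bound]) (simp add: abs_mult)
  also have "\<dots> \<le> (LINT s:{a..b}|lborel. c)"
    using assms by (intro set_integral_mono set_integrable_Icc_bounded[where c="\<bar>c\<bar>"]) force+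
  also have "\<dots> = c * (b - a)" using assms(3) by (simp add: set_lebesgue_integral_def)
  finally show ?thesis .
qed

lemma LINT_Icc_point:
  fixes a :: real and h :: "real \<Rightarrow> real"
  shows "(LINT s:{a..a}|lborel. h s) = 0"
  unfolding set_lebesgue_integral_def
proof (rule integral_eq_zero_AE)
  show "AE s in lborel. indicator {a..a} s *\<^sub>R h s = 0"
    using AE_lborel_singleton[of a]
  proof eventually_elim
    case (elim s)
    then have "s \<notin> {a..a}" by simp
    then show ?case by (simp only: indicator_simps scaleR_zero_left not_False_eq_True)
  qed
qed

text \<open>The substitution s = t * \<theta> moves the integral to the fixed interval from 0 to 1,
  where continuity of parameter integrals applies. Clamping time by \<open>max 0\<close> extends the
  result continuously to the whole line.\<close>

lemma continuous_convolution:
  fixes k b :: "real \<Rightarrow> real"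
  assumes k: "continuous_on UNIV k" and b: "continuous_on UNIV b"
  shows "continuous_on UNIV (\<lambda>t. integral {0..max 0 t} (\<lambda>s. k (max 0 t - s) * b s))"
proof -
  have eq: "integral {0..max 0 t} (\<lambda>s. k (max 0 t - s) * b s) =
      max 0 t * integral (cbox 0 1) (\<lambda>\<theta>. k (max 0 t - max 0 t * \<theta>) * b (max 0 t * \<theta>))" for t
  proof (cases "t > 0")
    case True
    have "(\<lambda>x. x / t) ` {0..t} = {0..1}"
    proof (intro equalityI subsetI)
      fix x assume "x \<in> {0..1::real}"
      then have "t * x \<in> {0..t}" "x = t * x / t" using True by (auto simp: mult_left_le)
      then show "x \<in> (\<lambda>x. x / t) ` {0..t}" by blast
    qed (use True in auto)
    then show ?thesis
      using integral_stretch_real[of t 0 t "\<lambda>s. k (t - s) * b s"] True by (simp add: max_def)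
  qed (auto simp: max_def)
  have "continuous_on UNIV (\<lambda>t. integral (cbox 0 1) (\<lambda>\<theta>. k (max 0 t - max 0 t * \<theta>) * b (max 0 t * \<theta>)))"
    unfolding max_def[symmetric]
    by (intro integral_continuous_on_param)
      (auto simp: case_prod_unfold intro!: continuous_intros continuous_on_compose2[OF k] continuous_on_compose2[OF b])
  then show ?thesis unfolding eq by (intro continuous_intros)
qed

lemma exp_weight_integral:
  fixes l t :: real
  assumes "l > 0" "t \<ge> 0"
  shows "(\<lambda>s. exp (- l * (t - s))) integrable_on {0..t}"
    "integral {0..t} (\<lambda>s. exp (- l * (t - s))) \<le> 1 / l"
proof -
  have *: "((\<lambda>s. exp (- l * (t - s))) has_integral (exp (- l * (t - t)) / l - exp (- l * (t - 0)) / l)) {0..t}"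
    using assms by (intro fundamental_theorem_of_calculus)
      (auto intro!: derivative_eq_intros simp: has_real_derivative_iff_has_vector_derivative[symmetric])
  show "(\<lambda>s. exp (- l * (t - s))) integrable_on {0..t}" using * by blast
  show "integral {0..t} (\<lambda>s. exp (- l * (t - s))) \<le> 1 / l"
    unfolding integral_unique[OF *] using assms by (simp add: divide_simps)
qed

text \<open>The weight has integral at most 1 / l, so the weighted operator has norm at most M / l.
  The choice l = 2 * M + 1 makes this less than 1/2 and keeps l positive even if M = 0.\<close>

lemma weighted_convolution_bound:
  fixes k b :: "real \<Rightarrow> real"
  assumes k: "continuous_on UNIV k" "\<And>t. \<bar>k t\<bar> \<le> M" and b: "continuous_on {0..t} b"
    and l: "l = 2 * M + 1" and t: "0 \<le> t" and bb: "\<And>s. s \<in> {0..t} \<Longrightarrow> \<bar>b s\<bar> \<le> D"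
  shows "\<bar>integral {0..t} (\<lambda>s. exp (- l * (t - s)) * k (t - s) * b s)\<bar> \<le> D / 2"
proof -
  have M: "M \<ge> 0" and D: "D \<ge> 0" using k(2)[of 0] bb[of 0] t by auto
  have "norm (integral {0..t} (\<lambda>s. exp (- l * (t - s)) * k (t - s) * b s)) \<le>
      integral {0..t} (\<lambda>s. M * D * exp (- l * (t - s)))"
  proof (rule Henstock_Kurzweil_Integration.integral_norm_bound_integral)
    show "(\<lambda>s. exp (- l * (t - s)) * k (t - s) * b s) integrable_on {0..t}"
      by (intro integrable_continuous_real continuous_intros b continuous_on_compose2[OF k(1)]) auto
    show "(\<lambda>s. M * D * exp (- l * (t - s))) integrable_on {0..t}"
      by (intro integrable_continuous_real continuous_intros)
    fix s assume s: "s \<in> {0..t}"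
    have "\<bar>k (t - s)\<bar> * \<bar>b s\<bar> \<le> M * D" using k(2) bb[OF s] M by (intro mult_mono) auto
    then show "norm (exp (- l * (t - s)) * k (t - s) * b s) \<le> M * D * exp (- l * (t - s))"
      by (simp add: abs_mult mult.assoc mult.commute[of "M * D"])
  qed
  also have "\<dots> = M * D * integral {0..t} (\<lambda>s. exp (- l * (t - s)))" by simp
  also have "\<dots> \<le> M * D * (1 / l)"
    using M D l t exp_weight_integral(2)[of l t] by (intro mult_left_mono) auto
  also have "\<dots> \<le> D / 2"
    using M D l by (simp add: field_simps)
  finally show ?thesis by simp
qed

text \<open>Multiplication by \<open>exp (- l * t)\<close> with \<open>l > 2 * M\<close> turns the Volterra operator into a
  contraction.\<close>

lemma volterra_solution:
  fixes k a :: "real \<Rightarrow> real"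
  assumes k: "continuous_on UNIV k" "\<And>t. \<bar>k t\<bar> \<le> M"
    and a: "continuous_on UNIV a" "\<And>t. \<bar>a t\<bar> \<le> N"
  obtains \<mu> where "continuous_on UNIV \<mu>"
    "\<And>t. t \<ge> 0 \<Longrightarrow> \<mu> t = a t + (LINT s:{0..t}|lborel. \<mu> s * k (t - s))"
    "\<And>t. t \<ge> 0 \<Longrightarrow> \<bar>\<mu> t\<bar> \<le> 2 * N * exp ((2 * M + 1) * t)"
proof -
  define l where "l = 2 * M + 1"
  have M: "M \<ge> 0" using k(2)[of 0] by auto
  have l: "l > 0" using M l_def by simp
  \<comment> \<open>The unknown is now b t = exp (- l * t) * \<mu> t; the factor exp (- l * (t - s))
    is what remains of the weight inside the integral. Negative times are clamped so that \<Phi>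
    acts on bounded continuous functions on the whole line.\<close>
  define V where "V b t = integral {0..max 0 t} (\<lambda>s. exp (- l * (max 0 t - s)) * k (max 0 t - s) * b s)" for b t
  define \<Phi> where "\<Phi> b t = exp (- l * max 0 t) * a (max 0 t) + V b t" for b t
  have kk: "continuous_on UNIV (\<lambda>r. exp (- l * r) * k r)"
    by (intro continuous_intros k)
  have Vcont: "continuous_on UNIV (V b)" if "continuous_on UNIV b" for b
    unfolding V_def using continuous_convolution[OF kk that] by simp
  have Vbound: "\<bar>V b t\<bar> \<le> D / 2" if "continuous_on UNIV b" "\<And>s. \<bar>b s\<bar> \<le> D" for b t D
    unfolding V_def using that k l_def
    by (intro weighted_convolution_bound[where M=M]) (auto intro: continuous_on_subset)
  have N: "\<bar>exp (- l * max 0 t) * a (max 0 t)\<bar> \<le> N" for t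
  proof -
    have "exp (- l * max 0 t) \<le> 1" using l by simp
    then have "\<bar>exp (- l * max 0 t) * a (max 0 t)\<bar> \<le> 1 * N"
      unfolding abs_mult using a(2) by (intro mult_mono) auto
    then show ?thesis by simp
  qed
  have \<Phi>: "\<Phi> b \<in> bcontfun" if "continuous_on UNIV b" "\<And>s. \<bar>b s\<bar> \<le> D" for b D
  proof (rule bcontfun_normI[where b="N + D / 2"])
    have "continuous_on UNIV (\<lambda>t. a (max 0 t))"
      by (rule continuous_on_compose2[OF a(1)]) (auto intro!: continuous_intros)
    then show "continuous_on UNIV (\<Phi> b)" unfolding \<Phi>_def using Vcont[OF that(1)]
      by (intro continuous_intros) auto
    show "norm (\<Phi> b t) \<le> N + D / 2" for t
      using N[of t] Vbound[OF that, of t] unfolding \<Phi>_def by simp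
  qed
  have bb: "\<bar>apply_bcontfun b s\<bar> \<le> norm b" for b :: "real \<Rightarrow>\<^sub>C real" and s
    using norm_bounded[of b s] by simp
  have \<Phi>b: "apply_bcontfun (Bcontfun (\<Phi> (apply_bcontfun b))) = \<Phi> (apply_bcontfun b)" for b
    using bb by (intro Bcontfun_inverse \<Phi>[where D="norm b"]) auto
  have "\<exists>!b. Bcontfun (\<Phi> (apply_bcontfun b)) = b"
  proof (rule banach_fix_type[where c="1/2"]; (intro allI)?)
    fix b c :: "real \<Rightarrow>\<^sub>C real"
    show "dist (Bcontfun (\<Phi> (apply_bcontfun b))) (Bcontfun (\<Phi> (apply_bcontfun c))) \<le> 1 / 2 * dist b c"
    proof (rule dist_bound)
      fix t
      have diff: "V b t - V c t = V (\<lambda>s. b s - c s) t"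
      proof -
        have "(\<lambda>s. exp (- l * (max 0 t - s)) * k (max 0 t - s) * apply_bcontfun d s) integrable_on {0..max 0 t}" for d
          by (intro integrable_continuous_real continuous_intros continuous_on_compose2[OF k(1)]) auto
        then show ?thesis unfolding V_def
          by (subst Henstock_Kurzweil_Integration.integral_diff[symmetric]) (auto simp: algebra_simps)
      qed
      have "\<bar>V (\<lambda>s. b s - c s) t\<bar> \<le> dist b c / 2"
        using dist_bounded[of b _ c] by (intro Vbound continuous_intros) (auto simp: dist_real_def)
      then show "dist (apply_bcontfun (Bcontfun (\<Phi> (apply_bcontfun b))) t)
          (apply_bcontfun (Bcontfun (\<Phi> (apply_bcontfun c))) t) \<le> 1 / 2 * dist b c"
        unfolding \<Phi>b by (simp add: dist_real_def \<Phi>_def diff)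
    qed
  qed auto
  then obtain b where "Bcontfun (\<Phi> (apply_bcontfun b)) = b" by blast
  then have fixp: "apply_bcontfun b t = \<Phi> b t" for t using \<Phi>b[of b] by simp
  \<comment> \<open>The fixed point inherits a bound from its own equation: half of the norm is
    absorbed, which produces the constant 2 * N.\<close>
  have "norm b \<le> N + norm b / 2"
  proof (rule norm_bound)
    fix t
    show "norm (apply_bcontfun b t) \<le> N + norm b / 2"
      using N[of t] Vbound[of b "norm b" t, OF _ bb[of b]] unfolding fixp[of t] \<Phi>_def real_norm_def
      by (smt (verit) abs_triangle_ineq continuous_on_apply_bcontfun)
  qed
  then have nb: "norm b \<le> 2 * N" by simp
  define \<mu> where "\<mu> t = exp (l * t) * apply_bcontfun b t" for t
  have \<mu>c: "continuous_on UNIV \<mu>" unfolding \<mu>_def by (intro continuous_intros) auto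
  have "\<mu> t = a t + (LINT s:{0..t}|lborel. \<mu> s * k (t - s))" if "t \<ge> 0" for t
  proof -
    have int: "set_integrable lborel {0..t} (\<lambda>s. \<mu> s * k (t - s))"
      by (intro borel_integrable_atLeastAtMost' continuous_intros continuous_on_subset[OF \<mu>c]
          continuous_on_compose2[OF k(1)]) auto
    have "\<mu> t = exp (l * t) * (exp (- l * t) * a t + V b t)"
      unfolding \<mu>_def fixp[of t] \<Phi>_def using that by (simp add: max_def)
    also have "\<dots> = a t + exp (l * t) * V b t"
      by (simp add: distrib_left mult.assoc[symmetric] exp_add[symmetric])
    also have "exp (l * t) * V b t = integral {0..t} (\<lambda>s. exp (l * t) * (exp (- l * (t - s)) * k (t - s) * b s))"
      unfolding V_def using that by (simp add: max_def)
    also have "\<dots> = integral {0..t} (\<lambda>s. \<mu> s * k (t - s))"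
      unfolding \<mu>_def
      by (intro Henstock_Kurzweil_Integration.integral_cong)
        (simp add: exp_diff exp_minus right_diff_distrib field_simps)
    finally show ?thesis using set_borel_integral_eq_integral(2)[OF int] by simp
  qed
  moreover have "\<bar>\<mu> t\<bar> \<le> 2 * N * exp ((2 * M + 1) * t)" for t
    using order_trans[OF bb nb, of t] unfolding \<mu>_def l_def
    by (simp add: abs_mult mult.commute[of "2 * N"])
  ultimately show thesis using \<mu>c by (intro that) auto
qed

text \<open>Uniqueness of the Banach fixed point covers only solutions that are bounded after
  weighting. Here d is merely continuous; on a compact interval the weighted function attains its
  maximal modulus, which the contraction estimate forces to be at most half of itself.\<close>

lemma volterra_unique_0:
  fixes k d :: "real \<Rightarrow> real"
  assumes k: "continuous_on UNIV k" "\<And>t. \<bar>k t\<bar> \<le> M"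
    and d: "continuous_on UNIV d" "\<And>t. t \<ge> 0 \<Longrightarrow> d t = (LINT s:{0..t}|lborel. d s * k (t - s))"
    and t: "t \<ge> 0"
  shows "d t = 0"
proof -
  define l where "l = 2 * M + 1"
  define b where "b s = exp (- l * s) * d s" for s
  have bc: "continuous_on S b" for S
    unfolding b_def by (intro continuous_intros continuous_on_subset[OF d(1)]) auto
  have b: "b r = integral {0..r} (\<lambda>s. exp (- l * (r - s)) * k (r - s) * b s)" if "r \<ge> 0" for r
  proof -
    have int: "set_integrable lborel {0..r} (\<lambda>s. d s * k (r - s))"
      by (intro borel_integrable_atLeastAtMost' continuous_intros continuous_on_subset[OF d(1)]
          continuous_on_compose2[OF k(1)]) auto
    have "b r = exp (- l * r) * integral {0..r} (\<lambda>s. d s * k (r - s))"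
      unfolding b_def d(2)[OF that] set_borel_integral_eq_integral(2)[OF int] ..
    also have "\<dots> = integral {0..r} (\<lambda>s. exp (- l * r) * (d s * k (r - s)))" by simp
    also have "\<dots> = integral {0..r} (\<lambda>s. exp (- l * (r - s)) * k (r - s) * b s)"
      unfolding b_def
      by (intro Henstock_Kurzweil_Integration.integral_cong)
        (simp add: exp_diff exp_minus right_diff_distrib field_simps)
    finally show ?thesis .
  qed
  obtain r where r: "r \<in> {0..t}" "\<And>s. s \<in> {0..t} \<Longrightarrow> \<bar>b s\<bar> \<le> \<bar>b r\<bar>"
    using continuous_attains_sup[of "{0..t}" "\<lambda>s. \<bar>b s\<bar>"] t bc by (force intro!: continuous_intros)
  have "\<bar>b r\<bar> \<le> \<bar>b r\<bar> / 2"
    using weighted_convolution_bound[OF k bc l_def, of r "\<bar>b r\<bar>"] r b[of r] by auto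
  then have "b t = 0" using r(2)[of t] t by auto
  then show ?thesis unfolding b_def by simp
qed

text \<open>A bound on the L^1 norms that is uniform over the bounded time interval makes the
  integrand integrable on the product. The measure \<nu> is left general because the lemma is
  applied to \<open>m\<close>, to a single kernel and to a path measure.\<close>

lemma Fubini_time:
  fixes h :: "real \<Rightarrow> 'a \<Rightarrow> real"
  assumes "sigma_finite_measure \<nu>"
    and h: "(\<lambda>(s, y). h s y) \<in> borel_measurable (borel \<Otimes>\<^sub>M \<nu>)"
    and int: "\<And>s. s \<in> {0..t} \<Longrightarrow> integrable \<nu> (h s)"
    and bound: "\<And>s. s \<in> {0..t} \<Longrightarrow> (LINT y|\<nu>. \<bar>h s y\<bar>) \<le> B"
    and t: "0 \<le> t"
  shows Fubini_time_integrable: "integrable \<nu> (\<lambda>y. LINT s:{0..t}|lborel. h s y)"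
    and Fubini_time_integral: "(LINT y|\<nu>. (LINT s:{0..t}|lborel. h s y)) = (LINT s:{0..t}|lborel. (LINT y|\<nu>. h s y))"
    and Fubini_time_bound: "(LINT y|\<nu>. \<bar>LINT s:{0..t}|lborel. h s y\<bar>) \<le> B * t"
proof -
  interpret \<nu>: sigma_finite_measure \<nu> by fact
  interpret pair_sigma_finite lborel \<nu> ..
  let ?h = "\<lambda>(s, y). indicator {0..t} s *\<^sub>R h s y"
  have sets: "sets (lborel \<Otimes>\<^sub>M \<nu>) = sets (borel \<Otimes>\<^sub>M \<nu>)"
    by (intro sets_pair_measure_cong) auto
  have h': "(\<lambda>(s, y). h s y) \<in> borel_measurable (lborel \<Otimes>\<^sub>M \<nu>)"
    using h measurable_cong_sets[OF sets refl] by blast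
  then have meas: "?h \<in> borel_measurable (lborel \<Otimes>\<^sub>M \<nu>)"
    by (simp add: case_prod_unfold)
  have meas': "(\<lambda>(s, y). norm (?h (s, y))) \<in> borel_measurable (lborel \<Otimes>\<^sub>M \<nu>)"
    using meas by (simp add: case_prod_unfold)
  have B: "B \<ge> 0" using bound[of 0] t by (intro order_trans[OF _ bound[of 0]]) auto
  have bd: "(LINT y|\<nu>. norm (?h (s, y))) \<le> indicator {0..t} s * B" for s
    using bound[of s] by (cases "s \<in> {0..t}") auto
  have normint: "integrable lborel (\<lambda>s. LINT y|\<nu>. norm (?h (s, y)))"
  proof (rule Bochner_Integration.integrable_bound[of _ "\<lambda>s. indicator {0..t} s * B"])
    show "integrable lborel (\<lambda>s. indicator {0..t} s * B)"
      by (intro integrable_mult_left integrable_real_indicator) (auto simp: emeasure_lborel_Icc_eq)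
    show "(\<lambda>s. LINT y|\<nu>. norm (?h (s, y))) \<in> borel_measurable lborel"
      using \<nu>.borel_measurable_lebesgue_integral[OF meas'] by simp
    show "AE s in lborel. norm (LINT y|\<nu>. norm (?h (s, y))) \<le> norm (indicator {0..t} s * B)"
      using bd B by (intro AE_I2) simp
  qed
  have int2: "integrable (lborel \<Otimes>\<^sub>M \<nu>) ?h"
  proof (rule Fubini_integrable[OF meas normint])
    show "AE s in lborel. integrable \<nu> (\<lambda>y. ?h (s, y))"
    proof (rule AE_I2)
      fix s show "integrable \<nu> (\<lambda>y. ?h (s, y))"
        using int[of s] by (cases "s \<in> {0..t}") auto
    qed
  qed
  then have int2': "integrable (lborel \<Otimes>\<^sub>M \<nu>) (\<lambda>(s, y). indicator {0..t} s *\<^sub>R h s y)"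
    by (simp add: case_prod_unfold)
  show "integrable \<nu> (\<lambda>y. LINT s:{0..t}|lborel. h s y)"
    unfolding set_lebesgue_integral_def using integrable_snd[OF int2'] .
  show "(LINT y|\<nu>. (LINT s:{0..t}|lborel. h s y)) = (LINT s:{0..t}|lborel. (LINT y|\<nu>. h s y))"
    unfolding set_lebesgue_integral_def using Fubini_integral[OF int2'] by simp
  have int3: "integrable (lborel \<Otimes>\<^sub>M \<nu>) (\<lambda>(s, y). norm (indicator {0..t} s *\<^sub>R h s y))"
    using integrable_norm[OF int2'] by (simp add: case_prod_unfold)
  have "(LINT y|\<nu>. \<bar>LINT s:{0..t}|lborel. h s y\<bar>) \<le>
      (LINT y|\<nu>. (LINT s|lborel. norm (indicator {0..t} s *\<^sub>R h s y)))"
    unfolding set_lebesgue_integral_def using integrable_snd[OF int2'] integrable_snd[OF int3]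
    by (intro integral_mono) (auto intro: order_trans[OF _ integral_norm_bound])
  also have "\<dots> = (LINT s|lborel. (LINT y|\<nu>. norm (indicator {0..t} s *\<^sub>R h s y)))"
    using Fubini_integral[OF int3] by simp
  also have "\<dots> \<le> (LINT s|lborel. indicator {0..t} s * B)"
    using bd normint by (intro integral_mono)
      (auto intro!: integrable_mult_left integrable_real_indicator simp: emeasure_lborel_Icc_eq)
  also have "\<dots> = B * t" using t by simp
  finally show "(LINT y|\<nu>. \<bar>LINT s:{0..t}|lborel. h s y\<bar>) \<le> B * t" .
qed

text \<open>Nothing is prescribed at negative times beyond continuity. Selecting the solution by
  \<open>SOME\<close> makes it a function of the kernel and the forcing term, so that equal forcing
  terms have literally equal solutions.\<close>

definition volterra :: "(real \<Rightarrow> real) \<Rightarrow> (real \<Rightarrow> real) \<Rightarrow> real \<Rightarrow> real" where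
  "volterra k a = (SOME \<mu>. continuous_on UNIV \<mu> \<and>
     (\<forall>t\<ge>0. \<mu> t = a t + (LINT s:{0..t}|lborel. \<mu> s * k (t - s))))"

context
  fixes k :: "real \<Rightarrow> real" and M :: real
  assumes k: "continuous_on UNIV k" "\<And>t. \<bar>k t\<bar> \<le> M"
begin

lemma
  fixes a :: "real \<Rightarrow> real"
  assumes a: "continuous_on UNIV a" "\<And>t. \<bar>a t\<bar> \<le> N"
  shows continuous_volterra: "continuous_on UNIV (volterra k a)"
    and volterra_equation: "t \<ge> 0 \<Longrightarrow>
      volterra k a t = a t + (LINT s:{0..t}|lborel. volterra k a s * k (t - s))"
proof -
  obtain \<mu> where "continuous_on UNIV \<mu>" "\<forall>t\<ge>0. \<mu> t = a t + (LINT s:{0..t}|lborel. \<mu> s * k (t - s))"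
    using volterra_solution[OF k a] by metis
  then have "\<exists>\<mu>. continuous_on UNIV \<mu> \<and> (\<forall>t\<ge>0. \<mu> t = a t + (LINT s:{0..t}|lborel. \<mu> s * k (t - s)))"
    by blast
  from someI_ex[OF this]
  show "continuous_on UNIV (volterra k a)"
    "t \<ge> 0 \<Longrightarrow> volterra k a t = a t + (LINT s:{0..t}|lborel. volterra k a s * k (t - s))"
    unfolding volterra_def by blast+
qed

lemma set_integrable_convolution:
  assumes "continuous_on UNIV \<mu>"
  shows "set_integrable lborel {a..b} (\<lambda>s. \<mu> s * k (t - s))"
  by (intro borel_integrable_atLeastAtMost' continuous_intros continuous_on_subset[OF assms]
      continuous_on_compose2[OF k(1)]) auto

text \<open>The difference of two solutions solves the homogeneous equation.\<close>

lemma volterra_eqI: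
  assumes a: "continuous_on UNIV a" "\<And>t. \<bar>a t\<bar> \<le> N"
    and \<mu>: "continuous_on UNIV \<mu>" "\<And>t. t \<ge> 0 \<Longrightarrow> \<mu> t = a t + (LINT s:{0..t}|lborel. \<mu> s * k (t - s))"
    and t: "t \<ge> 0"
  shows "volterra k a t = \<mu> t"
proof -
  have "volterra k a t - \<mu> t = 0"
  proof (rule volterra_unique_0[OF k _ _ t])
    show "continuous_on UNIV (\<lambda>t. volterra k a t - \<mu> t)"
      using \<mu>(1) continuous_volterra[OF a] by (intro continuous_intros)
    fix t :: real assume t: "t \<ge> 0"
    show "volterra k a t - \<mu> t = (LINT s:{0..t}|lborel. (volterra k a s - \<mu> s) * k (t - s))"
      using volterra_equation[OF a t] \<mu>(2)[OF t]
        set_integral_diff(2)[OF set_integrable_convolution[OF continuous_volterra[OF a]]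
          set_integrable_convolution[OF \<mu>(1)], of 0 t t]
      by (simp add: left_diff_distrib)
  qed
  then show ?thesis by simp
qed

text \<open>The bound is known for the fixed point solution and passes to the selected one by
  uniqueness.\<close>

lemma volterra_bound:
  assumes a: "continuous_on UNIV a" "\<And>t. \<bar>a t\<bar> \<le> N" and t: "t \<ge> 0"
  shows "\<bar>volterra k a t\<bar> \<le> 2 * N * exp ((2 * M + 1) * t)"
proof (rule volterra_solution[OF k a])
  fix \<mu> assume \<mu>: "continuous_on UNIV \<mu>"
    "\<And>t. t \<ge> 0 \<Longrightarrow> \<mu> t = a t + (LINT s:{0..t}|lborel. \<mu> s * k (t - s))"
    "\<And>t. t \<ge> 0 \<Longrightarrow> \<bar>\<mu> t\<bar> \<le> 2 * N * exp ((2 * M + 1) * t)"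
  show ?thesis using volterra_eqI[OF a \<mu>(1,2) t] \<mu>(3)[OF t] by simp
qed

lemma volterra_linear:
  assumes a: "continuous_on UNIV a" "\<And>t. \<bar>a t\<bar> \<le> N"
    and b: "continuous_on UNIV b" "\<And>t. \<bar>b t\<bar> \<le> N'" and t: "t \<ge> 0"
  shows "volterra k (\<lambda>t. c * a t + d * b t) t = c * volterra k a t + d * volterra k b t"
proof (rule volterra_eqI[OF _ _ _ _ t])
  show "continuous_on UNIV (\<lambda>t. c * a t + d * b t)" using a b by (intro continuous_intros)
  show "\<bar>c * a t + d * b t\<bar> \<le> \<bar>c\<bar> * N + \<bar>d\<bar> * N'" for t
  proof -
    have "\<bar>c * a t\<bar> \<le> \<bar>c\<bar> * N" "\<bar>d * b t\<bar> \<le> \<bar>d\<bar> * N'"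
      unfolding abs_mult by (intro mult_left_mono a(2) b(2) abs_ge_zero)+
    then show ?thesis by linarith
  qed
  note v = continuous_volterra[OF a] continuous_volterra[OF b]
  show "continuous_on UNIV (\<lambda>t. c * volterra k a t + d * volterra k b t)"
    using v by (intro continuous_intros)
  fix t :: real assume t: "t \<ge> 0"
  have "(LINT s:{0..t}|lborel. (c * volterra k a s + d * volterra k b s) * k (t - s)) =
    (LINT s:{0..t}|lborel. c * (volterra k a s * k (t - s)) + d * (volterra k b s * k (t - s)))"
    by (simp add: algebra_simps)
  also have "\<dots> = c * (LINT s:{0..t}|lborel. volterra k a s * k (t - s)) +
      d * (LINT s:{0..t}|lborel. volterra k b s * k (t - s))"
    using set_integrable_convolution[OF v(1)] set_integrable_convolution[OF v(2)]
    by (subst set_integral_add(2)) auto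
  finally show "c * volterra k a t + d * volterra k b t = c * a t + d * b t +
      (LINT s:{0..t}|lborel. (c * volterra k a s + d * volterra k b s) * k (t - s))"
    using volterra_equation[OF a t] volterra_equation[OF b t] by (simp add: algebra_simps)
qed

end

section \<open>Orbits of a strongly continuous semigroup and their time integrals\<close>

locale continuous_kernels = subinvariant_kernels +
  assumes strongly_continuous:
    "integrable m f \<Longrightarrow> ((\<lambda>t. LINT x|m. \<bar>p t f x - f x\<bar>) \<longlongrightarrow> 0) (at_right 0)"
begin

lemma strongly_continuous_ex:
  assumes f: "integrable m f" and e: "\<epsilon> > 0"
  obtains \<delta> where "\<delta> > 0" "\<And>t. 0 \<le> t \<Longrightarrow> t < \<delta> \<Longrightarrow> (LINT x|m. \<bar>p t f x - f x\<bar>) < \<epsilon>"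
proof -
  have "\<forall>\<^sub>F t in at_right 0. (LINT x|m. \<bar>p t f x - f x\<bar>) < \<epsilon>"
    using strongly_continuous[OF f] e by (auto simp: order_tendsto_iff)
  then obtain \<delta> where d: "\<delta> > 0" "\<And>t. 0 < t \<Longrightarrow> t < \<delta> \<Longrightarrow> (LINT x|m. \<bar>p t f x - f x\<bar>) < \<epsilon>"
    by (auto simp: eventually_at_right_field)
  have "(LINT x|m. \<bar>p 0 f x - f x\<bar>) = (LINT x|m. 0)"
    using f by (intro Bochner_Integration.integral_cong) (auto simp: p_0)
  then have "(LINT x|m. \<bar>p t f x - f x\<bar>) < \<epsilon>" if "0 \<le> t" "t < \<delta>" for t
    using d(2)[of t] that e by (cases "t = 0") auto
  with d(1) show thesis by (rule that)
qed

text \<open>Factoring out \<open>p s\<close> by the semigroup law and contracting it away reduces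
  continuity of the mass at any time to strong continuity at time 0, uniformly in s.\<close>

lemma integral_p_diff:
  assumes f: "integrable m f" and "0 \<le> s" "s \<le> t"
  shows "\<bar>(LINT x|m. p t f x) - (LINT x|m. p s f x)\<bar> \<le> (LINT x|m. \<bar>p (t - s) f x - f x\<bar>)"
proof -
  have i: "integrable m (p r f)" if "0 \<le> r" for r using f that by (rule p_integrable[rotated])
  have "\<bar>(LINT x|m. p t f x) - (LINT x|m. p s f x)\<bar> \<le> (LINT x|m. \<bar>p t f x - p s f x\<bar>)"
    using integral_abs_bound[of m "\<lambda>x. p t f x - p s f x"] Bochner_Integration.integral_diff[OF i[of t] i[of s]] assms
    by simp
  also have "\<dots> = (LINT x|m. \<bar>p s (p (t - s) f) x - p s f x\<bar>)"
  proof (rule integral_cong_AE)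
    show "AE x in m. \<bar>p t f x - p s f x\<bar> = \<bar>p s (p (t - s) f) x - p s f x\<bar>"
      using p_semigroup_AE[of s "t - s" f] assms by auto
    show "(\<lambda>x. \<bar>p t f x - p s f x\<bar>) \<in> borel_measurable m"
      "(\<lambda>x. \<bar>p s (p (t - s) f) x - p s f x\<bar>) \<in> borel_measurable m"
      using i assms p_integrable[OF _ i] by auto
  qed
  also have "\<dots> \<le> (LINT x|m. \<bar>p (t - s) f x - f x\<bar>)"
    using assms i by (intro p_L1_dist) auto
  finally show ?thesis .
qed

lemma continuous_integral_p:
  assumes f: "integrable m f"
  shows "continuous_on UNIV (\<lambda>t. LINT x|m. p (max 0 t) f x)"
  unfolding continuous_on_iff
proof (intro ballI allI impI)
  fix s \<epsilon> :: real assume "\<epsilon> > 0"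
  then obtain \<delta> where d: "\<delta> > 0" "\<And>t. 0 \<le> t \<Longrightarrow> t < \<delta> \<Longrightarrow> (LINT x|m. \<bar>p t f x - f x\<bar>) < \<epsilon>"
    using strongly_continuous_ex[OF f] by metis
  have "dist (LINT x|m. p (max 0 t) f x) (LINT x|m. p (max 0 s) f x) < \<epsilon>" if "dist t s < \<delta>" for t
  proof (cases "s \<le> t")
    case True
    then have "0 \<le> max 0 t - max 0 s" "max 0 t - max 0 s < \<delta>"
      using that d(1) by (auto simp: dist_real_def max_def)
    then show ?thesis
      using integral_p_diff[OF f, of "max 0 s" "max 0 t"] d(2)[of "max 0 t - max 0 s"]
      unfolding dist_real_def by linarith
  next
    case False
    then have "0 \<le> max 0 s - max 0 t" "max 0 s - max 0 t < \<delta>"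
      using that d(1) by (auto simp: dist_real_def max_def)
    then show ?thesis
      using integral_p_diff[OF f, of "max 0 t" "max 0 s"] d(2)[of "max 0 s - max 0 t"]
      unfolding dist_real_def by linarith
  qed
  then show "\<exists>d>0. \<forall>t\<in>UNIV. dist t s < d \<longrightarrow> dist (LINT x|m. p (max 0 t) f x) (LINT x|m. p (max 0 s) f x) < \<epsilon>"
    using d(1) by blast
qed

lemma integral_p_le:
  assumes "integrable m f" "0 \<le> t"
  shows "\<bar>LINT x|m. p t f x\<bar> \<le> (LINT x|m. \<bar>f x\<bar>)"
  using p_contraction[OF assms(2,1)] integral_abs_bound[of m "p t f"] by linarith

definition J :: "real \<Rightarrow> ('a \<Rightarrow> real) \<Rightarrow> 'a \<Rightarrow> real" where
  "J t f x = (LINT s:{0..t}|lborel. p s f x)"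

text \<open>The Duhamel integral with scalar input \<mu>: what is injected at time s evolves for the
  remaining time t - s.\<close>

definition conv :: "(real \<Rightarrow> real) \<Rightarrow> real \<Rightarrow> ('a \<Rightarrow> real) \<Rightarrow> 'a \<Rightarrow> real" where
  "conv \<mu> t g x = (LINT s:{0..t}|lborel. \<mu> s * p (t - s) g x)"

text \<open>Time integrals are formed separately at each point x. Boundedness of g makes them exist
  at every x, which avoids a null set depending on the time.\<close>

context
  fixes g :: "'a \<Rightarrow> real" and c :: real
  assumes g: "integrable m g" and g_bounded: "\<And>y. y \<in> space m \<Longrightarrow> \<bar>g y\<bar> \<le> c"
begin

lemma g_meas: "g \<in> borel_measurable m" using g by auto

lemma p_set_integrable:
  assumes "x \<in> space m"
  shows "set_integrable lborel {a..b} (\<lambda>s. p s g x)"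
  using assms g_meas g_bounded
  by (intro set_integrable_Icc_bounded p_measurable_time p_bounded) auto

lemma conv_set_integrable:
  assumes \<mu>: "continuous_on UNIV \<mu>" and x: "x \<in> space m"
  shows "set_integrable lborel {a..b} (\<lambda>s. \<mu> s * p (t - s) g x)"
proof -
  have "compact (\<mu> ` {a..b})" using \<mu> by (intro compact_continuous_image) (auto intro: continuous_on_subset)
  then obtain D where D: "\<And>s. s \<in> {a..b} \<Longrightarrow> \<bar>\<mu> s\<bar> \<le> D"
    using compact_imp_bounded[of "\<mu> ` {a..b}"] unfolding bounded_iff by force
  have c: "c \<ge> 0" using g_bounded[OF x] by auto
  show ?thesis
  proof (rule set_integrable_Icc_bounded)
    have "(\<lambda>s. p (t - s) g x) \<in> borel_measurable borel"
      using p_measurable_time[OF g_meas x] by measurable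
    then show "(\<lambda>s. \<mu> s * p (t - s) g x) \<in> borel_measurable borel"
      using borel_measurable_continuous_onI[OF \<mu>] by measurable
    show "\<bar>\<mu> s * p (t - s) g x\<bar> \<le> D * c" if "s \<in> {a..b}" for s
      unfolding abs_mult using D[OF that] p_bounded[OF g_meas g_bounded x, of "t - s"] c
      by (intro mult_mono) auto
  qed
qed

lemma conv_measurable:
  assumes \<mu>: "continuous_on UNIV \<mu>"
  shows "(\<lambda>(s, y). \<mu> s * p (t - s) g y) \<in> borel_measurable (borel \<Otimes>\<^sub>M m)"
proof -
  have "(\<lambda>(s, y). (t - s, y)) \<in> borel \<Otimes>\<^sub>M m \<rightarrow>\<^sub>M borel \<Otimes>\<^sub>M m" by measurable
  from measurable_compose[OF this p_measurable2[OF g_meas]]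
  have "(\<lambda>(s, y). p (t - s) g y) \<in> borel_measurable (borel \<Otimes>\<^sub>M m)"
    by (simp add: case_prod_unfold)
  moreover have "(\<lambda>(s, y). \<mu> s) \<in> borel_measurable (borel \<Otimes>\<^sub>M m)"
    using borel_measurable_continuous_onI[OF \<mu>] by measurable
  ultimately show ?thesis by (simp add: case_prod_unfold)
qed

text \<open>The extra time r anticipates \<open>p_conv\<close>, by which the function in question is
  \<open>p r (conv \<mu> t g)\<close>; for r = 0 it is the Duhamel integral itself.\<close>

lemma conv_shift_L1:
  assumes \<mu>: "continuous_on UNIV \<mu>" and t: "0 \<le> t" and r: "0 \<le> r"
    and D: "\<And>s. s \<in> {0..t} \<Longrightarrow> \<bar>\<mu> s\<bar> \<le> D"
  shows "integrable m (\<lambda>y. LINT s:{0..t}|lborel. \<mu> s * p (t + r - s) g y)"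
    and "(LINT y|m. (LINT s:{0..t}|lborel. \<mu> s * p (t + r - s) g y)) =
        (LINT s:{0..t}|lborel. \<mu> s * (LINT y|m. p (t + r - s) g y))"
    and "(LINT y|m. \<bar>LINT s:{0..t}|lborel. \<mu> s * p (t + r - s) g y\<bar>) \<le> D * (LINT y|m. \<bar>g y\<bar>) * t"
proof -
  have D0: "D \<ge> 0" using D[of 0] t by auto
  have int: "integrable m (\<lambda>y. \<mu> s * p (t + r - s) g y)" if "s \<in> {0..t}" for s
    using that r g by (intro integrable_mult_right p_integrable) auto
  have bd: "(LINT y|m. \<bar>\<mu> s * p (t + r - s) g y\<bar>) \<le> D * (LINT y|m. \<bar>g y\<bar>)" if "s \<in> {0..t}" for s
  proof -
    have "(LINT y|m. \<bar>\<mu> s * p (t + r - s) g y\<bar>) = \<bar>\<mu> s\<bar> * (LINT y|m. \<bar>p (t + r - s) g y\<bar>)"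
      by (simp add: abs_mult)
    also have "\<dots> \<le> D * (LINT y|m. \<bar>g y\<bar>)"
      using D[OF that] D0 that r g by (intro mult_mono p_contraction) auto
    finally show ?thesis .
  qed
  note F = Fubini_time[OF sigma_finite_measure_axioms conv_measurable[OF \<mu>] int bd t]
  show "integrable m (\<lambda>y. LINT s:{0..t}|lborel. \<mu> s * p (t + r - s) g y)" using F(1) .
  show "(LINT y|m. (LINT s:{0..t}|lborel. \<mu> s * p (t + r - s) g y)) =
        (LINT s:{0..t}|lborel. \<mu> s * (LINT y|m. p (t + r - s) g y))" using F(2) by simp
  show "(LINT y|m. \<bar>LINT s:{0..t}|lborel. \<mu> s * p (t + r - s) g y\<bar>) \<le> D * (LINT y|m. \<bar>g y\<bar>) * t" using F(3) .
qed

text \<open>Fubini for the single finite measure \<open>k r x\<close> moves \<open>p r\<close> under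
  the time integral, where the pointwise semigroup law for bounded functions adds up the
  times.\<close>

lemma p_conv:
  assumes \<mu>: "continuous_on UNIV \<mu>" and t: "0 \<le> t" and r: "0 \<le> r"
    and D: "\<And>s. s \<in> {0..t} \<Longrightarrow> \<bar>\<mu> s\<bar> \<le> D" and x: "x \<in> space m"
  shows "p r (conv \<mu> t g) x = (LINT s:{0..t}|lborel. \<mu> s * p (t + r - s) g x)"
proof -
  interpret subprob_space "k r x" using subprob_kernel[OF x] .
  have D0: "D \<ge> 0" using D[of 0] t by auto
  have c0: "c \<ge> 0" using g_bounded[OF x] by auto
  have bd: "\<bar>\<mu> s * p (t - s) g y\<bar> \<le> D * c" if "s \<in> {0..t}" "y \<in> space m" for s y
    unfolding abs_mult using D[OF that(1)] D0 c0 p_bounded[OF g_meas g_bounded that(2), of "t - s"]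
    by (intro mult_mono) auto
  have meas: "(\<lambda>y. \<mu> s * p (t - s) g y) \<in> borel_measurable (k r x)" for s
    using g_meas x by (intro measurable_kernel) auto
  have int: "integrable (k r x) (\<lambda>y. \<mu> s * p (t - s) g y)" if "s \<in> {0..t}" for s
    using bd[OF that] meas space_kernel[OF x] by (intro integrable_const_bound[where B="D * c"]) auto
  have bd2: "(LINT y|k r x. \<bar>\<mu> s * p (t - s) g y\<bar>) \<le> D * c * measure (k r x) (space (k r x))" if "s \<in> {0..t}" for s
  proof -
    have "(LINT y|k r x. \<bar>\<mu> s * p (t - s) g y\<bar>) \<le> (LINT y|k r x. D * c)"
      using int[OF that] bd[OF that] space_kernel[OF x] by (intro integral_mono) auto
    then show ?thesis by (simp add: mult_ac)
  qed
  have "sets (borel \<Otimes>\<^sub>M k r x) = sets (borel \<Otimes>\<^sub>M m)"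
    using sets_kernel[OF x] by (intro sets_pair_measure_cong) auto
  then have m2: "(\<lambda>(s, y). \<mu> s * p (t - s) g y) \<in> borel_measurable (borel \<Otimes>\<^sub>M k r x)"
    using conv_measurable[OF \<mu>] measurable_cong_sets by blast
  have "p r (conv \<mu> t g) x = (LINT y|k r x. (LINT s:{0..t}|lborel. \<mu> s * p (t - s) g y))"
    unfolding p_def[of r] conv_def ..
  also have "\<dots> = (LINT s:{0..t}|lborel. (LINT y|k r x. \<mu> s * p (t - s) g y))"
    by (rule Fubini_time_integral[OF sigma_finite_measure_axioms m2 int bd2 t])
  also have "\<dots> = (LINT s:{0..t}|lborel. \<mu> s * p (t + r - s) g x)"
  proof (intro set_lebesgue_integral_cong ballI allI impI)
    fix s assume s: "s \<in> {0..t}"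
    have "p (r + (t - s)) g x = p r (p (t - s) g) x"
      using s r g_bounded x g_meas by (intro p_add_bounded) auto
    then show "(LINT y|k r x. \<mu> s * p (t - s) g y) = \<mu> s * p (t + r - s) g x"
      by (simp add: p_def[of r] algebra_simps)
  qed simp
  finally show ?thesis .
qed

text \<open>Reversing time turns the plain orbit integral into a Duhamel integral with constant
  input, so the facts on the latter can be reused.\<close>

lemma J_conv: "J t g x = conv (\<lambda>_. 1) t g x"
  unfolding J_def conv_def using LINT_Icc_reflect[of t "\<lambda>s. p s g x"] by simp

lemma J_integrable: "0 \<le> t \<Longrightarrow> integrable m (J t g)"
  using conv_shift_L1(1)[of "\<lambda>_. 1" t 0 1] by (simp add: J_conv[abs_def] conv_def[abs_def])

lemma integral_J: "0 \<le> t \<Longrightarrow> (LINT x|m. J t g x) = (LINT s:{0..t}|lborel. (LINT x|m. p s g x))"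
  using conv_shift_L1(2)[of "\<lambda>_. 1" t 0 1] LINT_Icc_reflect[of t "\<lambda>s. LINT x|m. p s g x"]
  by (simp add: J_conv conv_def)

lemma p_J:
  assumes t: "0 \<le> t" and r: "0 \<le> r" and x: "x \<in> space m"
  shows "p r (J t g) x = J (t + r) g x - J r g x"
proof -
  have "p r (J t g) x = p r (conv (\<lambda>_. 1) t g) x" by (simp add: J_conv[abs_def])
  also have "\<dots> = (LINT s:{0..t}|lborel. p (t + r - s) g x)"
    using p_conv[of "\<lambda>_. 1" t r 1 x] assms by simp
  also have "\<dots> = (LINT s:{0..t}|lborel. p (s + r) g x)"
    using LINT_Icc_reflect[of t "\<lambda>s. p (s + r) g x"] by (simp add: algebra_simps)
  also have "\<dots> = (LINT s:{r..t + r}|lborel. p s g x)"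
    using LINT_Icc_shift[of 0 r t "\<lambda>s. p s g x"] by simp
  also have "\<dots> = J (t + r) g x - J r g x"
    unfolding J_def using LINT_Icc_split[OF p_set_integrable[OF x], of 0 r "t + r"] assms by simp
  finally show ?thesis .
qed

text \<open>The deviation from g is the average of p s g - g over times s between 0 and t, and these
  functions are uniformly small in L^1 by strong continuity.\<close>

lemma J_derivative_0: "((\<lambda>t. LINT x|m. \<bar>J t g x / t - g x\<bar>) \<longlongrightarrow> 0) (at_right 0)"
proof (rule tendstoI)
  fix \<epsilon> :: real assume e: "\<epsilon> > 0"
  obtain \<delta> where d: "\<delta> > 0" "\<And>t. 0 \<le> t \<Longrightarrow> t < \<delta> \<Longrightarrow> (LINT x|m. \<bar>p t g x - g x\<bar>) < \<epsilon> / 2"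
    using strongly_continuous_ex[OF g, of "\<epsilon> / 2"] e by auto
  have "dist (LINT x|m. \<bar>J t g x / t - g x\<bar>) 0 < \<epsilon>" if t: "0 < t" "t < \<delta>" for t
  proof -
    have "(\<lambda>z. g (snd z)) \<in> borel_measurable (borel \<Otimes>\<^sub>M m)" using g_meas by measurable
    from borel_measurable_diff[OF p_measurable2[OF g_meas] this]
    have meas: "(\<lambda>(s, y). p s g y - g y) \<in> borel_measurable (borel \<Otimes>\<^sub>M m)"
      by (simp add: case_prod_unfold)
    have "(LINT x|m. \<bar>J t g x / t - g x\<bar>) = (LINT x|m. \<bar>LINT s:{0..t}|lborel. p s g x - g x\<bar> / t)"
    proof (intro Bochner_Integration.integral_cong refl)
      fix x assume x: "x \<in> space m"
      have "(LINT s:{0..t}|lborel. p s g x - g x) = J t g x - t * g x"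
        unfolding J_def using p_set_integrable[OF x] t
        by (subst set_integral_diff(2)) (auto simp: set_integrable_def set_lebesgue_integral_def emeasure_lborel_Icc_eq
            intro!: integrable_scaleR_left integrable_mult_left)
      then have "(LINT s:{0..t}|lborel. p s g x - g x) / t = J t g x / t - g x" using t by (simp add: field_simps)
      then show "\<bar>J t g x / t - g x\<bar> = \<bar>LINT s:{0..t}|lborel. p s g x - g x\<bar> / t"
        using t by (metis abs_divide abs_of_pos)
    qed
    also have "\<dots> \<le> (\<epsilon> / 2 * t) / t"
      using Fubini_time_bound[OF sigma_finite_measure_axioms meas, of t "\<epsilon> / 2"] t d(2) p_integrable g
      by (simp add: divide_simps less_imp_le)
    also have "\<dots> < \<epsilon>" using t e by simp
    finally show ?thesis by (simp add: dist_real_def)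
  qed
  then show "\<forall>\<^sub>F t in at_right 0. dist (LINT x|m. \<bar>J t g x / t - g x\<bar>) 0 < \<epsilon>"
    using d(1) by (auto simp: eventually_at_right_field)
qed

end

text \<open>By \<open>p_J\<close> the left side is the orbit integral over {t..t + r} minus the one
  over {0..r}; shifting the first interval by t leaves the integral of p (s + t) g - p s g over
  {0..r}.\<close>

lemma p_J_diff:
  assumes g: "integrable m g" and g_bounded: "\<And>y. y \<in> space m \<Longrightarrow> \<bar>g y\<bar> \<le> c" and t: "0 \<le> t"
    and r: "0 \<le> r" and x: "x \<in> space m"
  shows "p r (J t g) x - J t g x = J r (\<lambda>x. p t g x - g x) x"
proof -
  let ?g = "\<lambda>x. p t g x - g x"
  have gm: "g \<in> borel_measurable m" using g by auto
  have "J (t + r) g x = J t g x + (LINT s:{t..t + r}|lborel. p s g x)"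
    unfolding J_def using LINT_Icc_split[OF p_set_integrable[OF g g_bounded x], of 0 t "t + r"] r t by simp
  also have "(LINT s:{t..t + r}|lborel. p s g x) = (LINT s:{0..r}|lborel. p (s + t) g x)"
    using LINT_Icc_shift[of 0 t r "\<lambda>s. p s g x"] by (simp add: add.commute)
  finally have "p r (J t g) x - J t g x = (LINT s:{0..r}|lborel. p (s + t) g x) - J r g x"
    using p_J[OF g g_bounded t r x] by simp
  also have "\<dots> = (LINT s:{0..r}|lborel. p (s + t) g x - p s g x)"
  proof -
    have "set_integrable lborel {0..r} (\<lambda>s. p (s + t) g x)"
    proof (rule set_integrable_Icc_bounded)
      show "(\<lambda>s. p (s + t) g x) \<in> borel_measurable borel"
        using p_measurable_time[OF gm x] by measurable
      show "\<bar>p (s + t) g x\<bar> \<le> c" for s using p_bounded[OF gm g_bounded x] .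
    qed
    then show ?thesis unfolding J_def
      using p_set_integrable[OF g g_bounded x] by (simp add: set_integral_diff(2))
  qed
  also have "\<dots> = J r ?g x"
    unfolding J_def
  proof (intro set_lebesgue_integral_cong ballI allI impI)
    fix s assume s: "s \<in> {0..r}"
    interpret subprob_space "k s x" using subprob_kernel[OF x] .
    have "integrable (k s x) (p t g)" "integrable (k s x) g"
      using gm g_bounded p_bounded[OF gm g_bounded] x space_kernel[OF x]
      by (auto intro!: integrable_const_bound[where B=c] measurable_kernel)
    moreover have "p (s + t) g x = p s (p t g) x"
      using s t x gm g_bounded by (intro p_add_bounded) auto
    ultimately show "p (s + t) g x - p s g x = p s ?g x"
      unfolding p_def[of s] by simp
  qed simp
  finally show ?thesis .
qed

text \<open>By \<open>p_J_diff\<close> the difference quotient is J r w / r for w = p t g - g. As w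
  is again integrable and bounded, now by 2 * c, \<open>J_derivative_0\<close> applies to w in place
  of g.\<close>

lemma generator_J:
  assumes g: "integrable m g" and g_bounded: "\<And>y. y \<in> space m \<Longrightarrow> \<bar>g y\<bar> \<le> c" and t: "0 \<le> t"
  shows "generator 1 m p (J t g) (\<lambda>x. p t g x - g x)"
  unfolding generator_def Lp_mem_1 Lp_conv_1
proof (intro conjI)
  let ?g = "\<lambda>x. p t g x - g x"
  have gm: "g \<in> borel_measurable m" using g by auto
  have int: "integrable m ?g" using g t by (intro Bochner_Integration.integrable_diff p_integrable)
  have bd: "\<bar>?g y\<bar> \<le> 2 * c" if "y \<in> space m" for y
    using p_bounded[OF gm g_bounded that, of t] g_bounded[OF that] by linarith
  note eq = p_J_diff[OF g g_bounded t]
  show "integrable m (J t g)" using J_integrable[OF g g_bounded t] .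
  then show "\<forall>\<^sub>F r in at_right 0. integrable m (\<lambda>x. (p r (J t g) x - J t g x) / r)"
    using p_integrable by (auto simp: eventually_at_filter)
  show "integrable m ?g" by (rule int)
  have "\<forall>\<^sub>F r in at_right 0. (LINT x|m. \<bar>J r ?g x / r - ?g x\<bar>) =
      (LINT x|m. \<bar>(p r (J t g) x - J t g x) / r - ?g x\<bar>)"
    unfolding eventually_at_filter
    by (intro always_eventually allI impI Bochner_Integration.integral_cong) (auto simp: eq)
  then show "((\<lambda>r. LINT x|m. \<bar>(p r (J t g) x - J t g x) / r - ?g x\<bar>) \<longlongrightarrow> 0) (at_right 0)"
    using J_derivative_0[OF int bd] by (rule Lim_transform_eventually[rotated])
qed

end

section \<open>Reinjection of lost mass\<close>

text \<open>Mass lost by \<open>p\<close> is reinjected with profile \<open>e\<close>: \<open>loss f t\<close> is the total mass lost up to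
  time \<open>t\<close> from \<open>f\<close>, including what reinjected mass loses again. It solves a renewal equation.
  Since \<open>e = J \<tau> e0\<close> is in the domain of the generator, with \<open>g\<close> its image, integration by parts
  removes the derivative of \<open>loss\<close> from the formula for the new semigroup.\<close>

locale reinjection = continuous_kernels +
  fixes e0 :: "'a \<Rightarrow> real" and c \<tau> :: real
  assumes e0: "integrable m e0" and e0_bounded: "\<And>y. y \<in> space m \<Longrightarrow> \<bar>e0 y\<bar> \<le> c"
    and \<tau>: "0 < \<tau>"
begin

definition e :: "'a \<Rightarrow> real" where "e = J \<tau> e0"
definition g :: "'a \<Rightarrow> real" where "g x = p \<tau> e0 x - e0 x"
text \<open>The rate at which the evolving profile p t e loses mass: p t e has time derivative p t
  g. It is continuous because e lies in the domain of the generator.\<close>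

definition \<kappa> :: "real \<Rightarrow> real" where "\<kappa> t = - (LINT x|m. p (max 0 t) g x)"
definition direct_loss :: "('a \<Rightarrow> real) \<Rightarrow> real \<Rightarrow> real" where
  "direct_loss f t = (LINT x|m. f x) - (LINT x|m. p (max 0 t) f x)"
text \<open>Mass reinjected at time s with profile e has lost (int e) - (int p (t - s) e) per unit
  by time t. Integrating this against d(loss f)(s) and then by parts yields the integral of loss f s
  * \<kappa> (t - s); both boundary terms vanish, since nothing is lost at time 0.\<close>

definition loss :: "('a \<Rightarrow> real) \<Rightarrow> real \<Rightarrow> real" where "loss f = volterra \<kappa> (direct_loss f)"
text \<open>The intended object is p t f plus the integral of p (t - s) e against d(loss f)(s). In
  the integration by parts the boundary term is loss f t * e, and p (t - s) e has derivative - p (t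
  - s) g in s.\<close>

definition U :: "real \<Rightarrow> ('a \<Rightarrow> real) \<Rightarrow> 'a \<Rightarrow> real" where
  "U t f x = p t f x + loss f t * e x + conv (loss f) t g x"

lemma e_integrable: "integrable m e"
  unfolding e_def using \<tau> by (intro J_integrable[OF e0 e0_bounded]) auto

lemma g_integrable: "integrable m g"
  unfolding g_def using e0 \<tau> by (intro Bochner_Integration.integrable_diff p_integrable) auto

lemma g_bounded: "y \<in> space m \<Longrightarrow> \<bar>g y\<bar> \<le> 2 * c"
  using p_bounded[OF borel_measurable_integrable[OF e0] e0_bounded, where x=y and t=\<tau>] e0_bounded[of y]
  unfolding g_def by linarith

lemma p_e: 
  assumes r: "0 \<le> r" and x: "x \<in> space m"
  shows "p r e x = e x + J r g x"
  unfolding e_def g_def using p_J_diff[OF e0 e0_bounded less_imp_le[OF \<tau>] r x] by simp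

lemma \<kappa>_continuous: "continuous_on UNIV \<kappa>"
  unfolding \<kappa>_def by (intro continuous_intros continuous_integral_p g_integrable)

lemma \<kappa>_bounded: "\<bar>\<kappa> t\<bar> \<le> (LINT x|m. \<bar>g x\<bar>)"
  unfolding \<kappa>_def using integral_p_le[OF g_integrable, of "max 0 t"] by simp

lemma direct_loss_continuous: "integrable m f \<Longrightarrow> continuous_on UNIV (direct_loss f)"
  unfolding direct_loss_def by (intro continuous_intros continuous_integral_p)

lemma direct_loss_bounded: "integrable m f \<Longrightarrow> \<bar>direct_loss f t\<bar> \<le> 2 * (LINT x|m. \<bar>f x\<bar>)"
  unfolding direct_loss_def using integral_p_le[of f "max 0 t"] integral_abs_bound[of m f] max.cobounded1[of 0 t] by linarith

lemmas loss_equation = volterra_equation[OF \<kappa>_continuous \<kappa>_bounded direct_loss_continuous direct_loss_bounded, folded loss_def]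

lemma loss_continuous: "integrable m f \<Longrightarrow> continuous_on UNIV (loss f)"
  unfolding loss_def
  by (rule continuous_volterra[OF \<kappa>_continuous \<kappa>_bounded direct_loss_continuous direct_loss_bounded])

text \<open>The constant 4 is the product of the 2 in \<open>volterra_bound\<close> and the 2 in
  \<open>direct_loss_bounded\<close>.\<close>

lemma loss_bounded:
  assumes "integrable m f" "t \<ge> 0"
  shows "\<bar>loss f t\<bar> \<le> 4 * exp ((2 * (LINT x|m. \<bar>g x\<bar>) + 1) * t) * (LINT x|m. \<bar>f x\<bar>)"
  using volterra_bound[OF \<kappa>_continuous \<kappa>_bounded direct_loss_continuous direct_loss_bounded, OF assms(1) assms(1) assms(2)]
  unfolding loss_def by (simp add: mult_ac)

lemma loss_bounded_Icc:
  assumes "integrable m f" "s \<in> {0..t}"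
  shows "\<bar>loss f s\<bar> \<le> 4 * exp ((2 * (LINT x|m. \<bar>g x\<bar>) + 1) * t) * (LINT x|m. \<bar>f x\<bar>)"
proof -
  have "(2 * (LINT x|m. \<bar>g x\<bar>) + 1) * s \<le> (2 * (LINT x|m. \<bar>g x\<bar>) + 1) * t"
    using assms by (intro mult_left_mono) auto
  then have "4 * exp ((2 * (LINT x|m. \<bar>g x\<bar>) + 1) * s) * (LINT x|m. \<bar>f x\<bar>)
     \<le> 4 * exp ((2 * (LINT x|m. \<bar>g x\<bar>) + 1) * t) * (LINT x|m. \<bar>f x\<bar>)"
    by (intro mult_right_mono mult_left_mono) auto
  then show ?thesis using loss_bounded[OF assms(1), of s] assms(2) by simp
qed

lemma loss_0: "integrable m f \<Longrightarrow> loss f 0 = 0"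
proof -
  assume f: "integrable m f"
  have "(LINT x|m. p 0 f x) = (LINT x|m. f x)"
    using f by (intro Bochner_Integration.integral_cong) (auto simp: p_0)
  then have "direct_loss f 0 = 0" unfolding direct_loss_def by simp
  moreover have "(LINT s:{0..0}|lborel. loss f s * \<kappa> (0 - s)) = 0"
    by (rule LINT_Icc_point)
  ultimately show "loss f 0 = 0" using loss_equation[OF f f, of 0] by simp
qed

lemma loss_small:
  assumes f: "integrable m f" and "\<epsilon> > 0"
  obtains \<delta> where "\<delta> > 0" "\<And>s. 0 \<le> s \<Longrightarrow> s < \<delta> \<Longrightarrow> \<bar>loss f s\<bar> \<le> \<epsilon>"
proof -
  obtain \<delta> where "\<delta> > 0" "\<And>s. dist s 0 < \<delta> \<Longrightarrow> dist (loss f s) (loss f 0) < \<epsilon>"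
    using loss_continuous[OF f] \<open>\<epsilon> > 0\<close> unfolding continuous_on_iff by (metis UNIV_I)
  then show thesis by (intro that[of \<delta>]) (auto simp: loss_0[OF f] dist_real_def intro: less_imp_le)
qed

text \<open>Up to sign the total mass of the Duhamel term is the Volterra integral, which the
  renewal equation evaluates. As a consequence \<open>U t f\<close> has mass (int f) + loss f t *
  ((int e) - 1), as it should for a profile that is not normalised.\<close>

lemma conv_loss:
  assumes f: "integrable m f" and t: "0 \<le> t"
  shows conv_loss_integrable: "integrable m (conv (loss f) t g)"
    and conv_loss_integral: "(LINT x|m. conv (loss f) t g x) = direct_loss f t - loss f t"
    and conv_loss_bound: "(\<And>s. s \<in> {0..t} \<Longrightarrow> \<bar>loss f s\<bar> \<le> D) \<Longrightarrow>
        (LINT x|m. \<bar>conv (loss f) t g x\<bar>) \<le> D * (LINT y|m. \<bar>g y\<bar>) * t"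
proof -
  note C = conv_shift_L1[OF g_integrable g_bounded loss_continuous[OF f] t order_refl]
  show "integrable m (conv (loss f) t g)"
    using C(1)[OF _ loss_bounded_Icc[OF f, of _ t]] by (simp add: conv_def[abs_def])
  show "(LINT x|m. \<bar>conv (loss f) t g x\<bar>) \<le> D * (LINT y|m. \<bar>g y\<bar>) * t"
    if "\<And>s. s \<in> {0..t} \<Longrightarrow> \<bar>loss f s\<bar> \<le> D"
    using C(3)[OF _ that] by (simp add: conv_def)
  have "(LINT x|m. conv (loss f) t g x) = (LINT s:{0..t}|lborel. loss f s * (LINT y|m. p (t - s) g y))"
    using C(2)[OF _ loss_bounded_Icc[OF f, of _ t]] by (simp add: conv_def)
  also have "\<dots> = (LINT s:{0..t}|lborel. - (loss f s * \<kappa> (t - s)))"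
    by (intro set_lebesgue_integral_cong) (auto simp: \<kappa>_def max_def)
  also have "\<dots> = - (LINT s:{0..t}|lborel. loss f s * \<kappa> (t - s))"
    by (simp add: set_lebesgue_integral_def)
  finally show "(LINT x|m. conv (loss f) t g x) = direct_loss f t - loss f t"
    using loss_equation[OF f f t] by simp
qed

lemma U_integrable:
  assumes "integrable m f" "0 \<le> t"
  shows "integrable m (U t f)"
  unfolding U_def using assms e_integrable
  by (intro Bochner_Integration.integrable_add integrable_mult_right p_integrable conv_loss_integrable)

text \<open>The forcing terms coincide at every time, hence so do the selected solutions.\<close>

lemma loss_cong:
  assumes "integrable m f" "integrable m f'" "AE x in m. f x = f' x"
  shows "loss f = loss f'"
proof -
  have "direct_loss f t = direct_loss f' t" for t
    unfolding direct_loss_def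
    using p_cong_AE[OF _ assms, of "max 0 t"] assms p_integrable
    by (intro arg_cong2[where f="(-)"] integral_cong_AE) auto
  then have "direct_loss f = direct_loss f'" by auto
  then show ?thesis by (simp add: loss_def)
qed

lemma loss_linear:
  assumes f: "integrable m f" and h: "integrable m h" and t: "t \<ge> 0"
  shows "loss (\<lambda>x. a * f x + b * h x) t = a * loss f t + b * loss h t"
proof -
  have "direct_loss (\<lambda>x. a * f x + b * h x) t = a * direct_loss f t + b * direct_loss h t" for t
  proof -
    have "(LINT x|m. p (max 0 t) (\<lambda>x. a * f x + b * h x) x) = (LINT x|m. a * p (max 0 t) f x + b * p (max 0 t) h x)"
      using f h by (intro integral_cong_AE p_linear_AE borel_measurable_integrable p_integrable
          Bochner_Integration.integrable_add integrable_mult_right) auto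
    also have "\<dots> = a * (LINT x|m. p (max 0 t) f x) + b * (LINT x|m. p (max 0 t) h x)"
      using f h by (simp add: p_integrable Bochner_Integration.integral_add)
    finally show ?thesis unfolding direct_loss_def using f h by (simp add: algebra_simps)
  qed
  then have "direct_loss (\<lambda>x. a * f x + b * h x) = (\<lambda>t. a * direct_loss f t + b * direct_loss h t)"
    by auto
  then show ?thesis
    unfolding loss_def
    by (simp add: volterra_linear[OF \<kappa>_continuous \<kappa>_bounded direct_loss_continuous[OF f]
      direct_loss_bounded[OF f] direct_loss_continuous[OF h] direct_loss_bounded[OF h] t])
qed

text \<open>Each of the three summands of \<open>U\<close> has its own law under \<open>p r\<close>:
  the semigroup law, \<open>p_e\<close> and \<open>p_conv\<close>.\<close>

lemma p_U_AE:
  assumes f: "integrable m f" and t: "0 \<le> t" and r: "0 \<le> r"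
  shows "AE x in m. p r (U t f) x = p (t + r) f x + loss f t * (e x + J r g x) +
     (LINT s:{0..t}|lborel. loss f s * p (t + r - s) g x)"
proof -
  have i: "integrable m (p t f)" "integrable m (\<lambda>x. loss f t * e x)" "integrable m (conv (loss f) t g)"
    using f t e_integrable by (auto intro: p_integrable conv_loss_integrable)
  have "AE x in m. p r (U t f) x = p r (\<lambda>x. p t f x + loss f t * e x) x + p r (conv (loss f) t g) x"
    unfolding U_def using p_add_AE[OF r Bochner_Integration.integrable_add[OF i(1,2)] i(3)] .
  moreover have "AE x in m. p r (\<lambda>x. p t f x + loss f t * e x) x = p r (p t f) x + p r (\<lambda>x. loss f t * e x) x"
    using p_add_AE[OF r i(1,2)] .
  moreover have "AE x in m. p (t + r) f x = p r (p t f) x"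
    using p_semigroup_AE[OF r t f] by (simp add: add.commute)
  ultimately show ?thesis
    using AE_space
  proof eventually_elim
    case (elim x)
    then show ?case
      using p_e[OF r, of x] p_conv[OF g_integrable g_bounded loss_continuous[OF f] t r loss_bounded_Icc[OF f], of t x]
      by (simp add: p_cmult)
  qed
qed

text \<open>This computes \<open>direct_loss (U t f)\<close>, the forcing term of the renewal
  equation restarted at time t.\<close>

lemma integral_p_U:
  assumes f: "integrable m f" and t: "0 \<le> t" and r: "0 \<le> r"
  shows "(LINT x|m. p r (U t f) x) = (LINT x|m. p (t + r) f x) +
    loss f t * ((LINT x|m. e x) - (LINT s:{0..r}|lborel. \<kappa> s)) -
    (LINT s:{0..t}|lborel. loss f s * \<kappa> (t + r - s))"
proof -
  note C = conv_shift_L1[OF g_integrable g_bounded loss_continuous[OF f] t r loss_bounded_Icc[OF f, of _ t]]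
  have Ji: "integrable m (J r g)" using J_integrable[OF g_integrable g_bounded r] .
  have "(LINT x|m. p r (U t f) x) = (LINT x|m. p (t + r) f x + loss f t * (e x + J r g x) +
     (LINT s:{0..t}|lborel. loss f s * p (t + r - s) g x))"
    using p_U_AE[OF assms] f t r e_integrable Ji C(1)
    by (intro integral_cong_AE borel_measurable_integrable p_integrable U_integrable
        Bochner_Integration.integrable_add integrable_mult_right) auto
  also have "\<dots> = (LINT x|m. p (t + r) f x) + loss f t * ((LINT x|m. e x) + (LINT x|m. J r g x)) +
      (LINT s:{0..t}|lborel. loss f s * (LINT x|m. p (t + r - s) g x))"
    using f t r e_integrable Ji C(1,2)
    by (simp add: p_integrable Bochner_Integration.integral_add)
  also have "(LINT x|m. J r g x) = (LINT s:{0..r}|lborel. (LINT x|m. p s g x))"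
    using integral_J[OF g_integrable g_bounded r] .
  also have "\<dots> = (LINT s:{0..r}|lborel. - \<kappa> s)"
    by (intro set_lebesgue_integral_cong) (auto simp: \<kappa>_def max_def)
  also have "\<dots> = - (LINT s:{0..r}|lborel. \<kappa> s)" by (simp add: set_lebesgue_integral_def)
  also have "(LINT s:{0..t}|lborel. loss f s * (LINT x|m. p (t + r - s) g x)) =
     (LINT s:{0..t}|lborel. - (loss f s * \<kappa> (t + r - s)))"
    using r by (intro set_lebesgue_integral_cong) (auto simp: \<kappa>_def max_def)
  also have "\<dots> = - (LINT s:{0..t}|lborel. loss f s * \<kappa> (t + r - s))"
    by (simp add: set_lebesgue_integral_def)
  finally show ?thesis by simp
qed

text \<open>The increment on the right solves the renewal equation restarted at time t, whose
  solution is unique. To see this, the equation at time t + r is split at t: the earlier part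
  belongs to the forcing term by \<open>integral_p_U\<close>, the later part is shifted to
  {0..r}.\<close>

lemma loss_U:
  assumes f: "integrable m f" and t: "0 \<le> t" and r: "0 \<le> r"
  shows "loss (U t f) r = loss f (t + r) - loss f t"
proof -
  note Ui = U_integrable[OF f t]
  define \<nu> where "\<nu> r = loss f (t + r) - loss f t" for r
  have \<nu>: "continuous_on UNIV \<nu>"
    unfolding \<nu>_def by (intro continuous_intros continuous_on_compose2[OF loss_continuous[OF f]]) auto
  have int: "set_integrable lborel {a..b} (\<lambda>s. loss f s * \<kappa> (q - s))" for a b q
    by (rule set_integrable_convolution[OF \<kappa>_continuous \<kappa>_bounded loss_continuous[OF f]])
  have \<nu>_eq: "\<nu> r = direct_loss (U t f) r + (LINT s:{0..r}|lborel. \<nu> s * \<kappa> (r - s))" if r: "0 \<le> r" for r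
  proof -
    have 0: "(LINT x|m. U t f x) = (LINT x|m. p t f x) + loss f t * (LINT x|m. e x) + (direct_loss f t - loss f t)"
      unfolding U_def using f t e_integrable conv_loss_integral[OF f t]
      by (simp add: p_integrable conv_loss_integrable)
    have 1: "loss f (t + r) = direct_loss f (t + r) + (LINT s:{0..t}|lborel. loss f s * \<kappa> (t + r - s)) +
        (LINT s:{t..t+r}|lborel. loss f s * \<kappa> (t + r - s))"
      using loss_equation[OF f f, of "t + r"] LINT_Icc_split[OF int, of 0 t "t + r" "t + r"] t r by simp
    have "(LINT s:{t..t+r}|lborel. loss f s * \<kappa> (t + r - s)) = (LINT s:{0..r}|lborel. loss f (s + t) * \<kappa> (r - s))"
      using LINT_Icc_shift[of 0 t r "\<lambda>s. loss f s * \<kappa> (t + r - s)"] by (simp add: add.commute)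
    also have "\<dots> = (LINT s:{0..r}|lborel. \<nu> s * \<kappa> (r - s) + loss f t * \<kappa> (r - s))"
      unfolding \<nu>_def by (simp add: algebra_simps)
    also have "\<dots> = (LINT s:{0..r}|lborel. \<nu> s * \<kappa> (r - s)) + (LINT s:{0..r}|lborel. loss f t * \<kappa> (r - s))"
      by (intro set_integral_add set_integrable_convolution[OF \<kappa>_continuous \<kappa>_bounded] \<nu> continuous_intros)
    also have "(LINT s:{0..r}|lborel. loss f t * \<kappa> (r - s)) = loss f t * (LINT s:{0..r}|lborel. \<kappa> s)"
      using LINT_Icc_reflect[of r \<kappa>] by simp
    finally have 2: "(LINT s:{t..t+r}|lborel. loss f s * \<kappa> (t + r - s)) =
      (LINT s:{0..r}|lborel. \<nu> s * \<kappa> (r - s)) + loss f t * (LINT s:{0..r}|lborel. \<kappa> s)" .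
    show ?thesis
      using 0 1 2 integral_p_U[OF f t r] t r
      unfolding \<nu>_def[of r] direct_loss_def by (simp add: max_def algebra_simps)
  qed
  show ?thesis
    unfolding loss_def[of "U t f"] \<nu>_def[symmetric]
    by (rule volterra_eqI[OF \<kappa>_continuous \<kappa>_bounded direct_loss_continuous[OF Ui] direct_loss_bounded[OF Ui] \<nu> \<nu>_eq r])
qed

text \<open>The Duhamel integral up to t + r is split at t. By \<open>loss_U\<close> the later part
  carries a constant - loss f t, and the resulting - loss f t * J r g cancels the \<open>J\<close>
  term of \<open>p_U_AE\<close>.\<close>

lemma U_semigroup_AE:
  assumes f: "integrable m f" and t: "0 \<le> t" and r: "0 \<le> r"
  shows "AE x in m. U (r + t) f x = U r (U t f) x"
  using p_U_AE[OF assms] AE_space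
proof eventually_elim
  case (elim x)
  have int: "set_integrable lborel {a..b} (\<lambda>s. loss f s * p (q - s) g x)" for a b q
    by (rule conv_set_integrable[OF g_integrable g_bounded loss_continuous[OF f] elim(2)])
  have "conv (loss (U t f)) r g x = (LINT s:{0..r}|lborel. loss f (s + t) * p (r - s) g x - loss f t * p (r - s) g x)"
    unfolding conv_def by (intro set_lebesgue_integral_cong) (auto simp: loss_U[OF f t] algebra_simps)
  also have "\<dots> = (LINT s:{0..r}|lborel. loss f (s + t) * p (r - s) g x) - (LINT s:{0..r}|lborel. loss f t * p (r - s) g x)"
    by (intro set_integral_diff conv_set_integrable[OF g_integrable g_bounded _ elim(2)] continuous_intros
        continuous_on_compose2[OF loss_continuous[OF f]]) auto
  also have "(LINT s:{0..r}|lborel. loss f t * p (r - s) g x) = loss f t * J r g x"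
    unfolding J_def using LINT_Icc_reflect[of r "\<lambda>s. p s g x"] by simp
  also have "(LINT s:{0..r}|lborel. loss f (s + t) * p (r - s) g x) = (LINT s:{t..t+r}|lborel. loss f s * p (t + r - s) g x)"
    using LINT_Icc_shift[of 0 t r "\<lambda>s. loss f s * p (t + r - s) g x"] by (simp add: add.commute)
  finally have *: "conv (loss (U t f)) r g x =
    (LINT s:{t..t+r}|lborel. loss f s * p (t + r - s) g x) - loss f t * J r g x" .
  have "conv (loss f) (t + r) g x = (LINT s:{0..t}|lborel. loss f s * p (t + r - s) g x) +
     (LINT s:{t..t+r}|lborel. loss f s * p (t + r - s) g x)"
    unfolding conv_def using LINT_Icc_split[OF int, of 0 t "t + r" "t + r"] t r by simp
  then show ?case
    unfolding U_def[of r] U_def[of "r + t"] elim(1) * loss_U[OF f t r]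
    by (simp add: algebra_simps)
qed

text \<open>The perturbation is controlled by the loss alone. A small loss gives strong continuity,
  the exponential bound on the loss gives boundedness of each \<open>U t\<close>.\<close>

lemma U_bound:
  assumes f: "integrable m f" and t: "0 \<le> t"
    and D: "\<And>s. s \<in> {0..t} \<Longrightarrow> \<bar>loss f s\<bar> \<le> D"
  shows "(LINT x|m. \<bar>U t f x - p t f x\<bar>) \<le> D * ((LINT x|m. \<bar>e x\<bar>) + (LINT x|m. \<bar>g x\<bar>) * t)"
proof -
  have "(LINT x|m. \<bar>U t f x - p t f x\<bar>) = (LINT x|m. \<bar>loss f t * e x + conv (loss f) t g x\<bar>)"
    unfolding U_def by (simp add: algebra_simps)
  also have "\<dots> \<le> (LINT x|m. \<bar>loss f t * e x\<bar>) + (LINT x|m. \<bar>conv (loss f) t g x\<bar>)"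
    using e_integrable conv_loss_integrable[OF f t] by (intro L1_add_le) auto
  also have "(LINT x|m. \<bar>loss f t * e x\<bar>) = \<bar>loss f t\<bar> * (LINT x|m. \<bar>e x\<bar>)" by (simp add: abs_mult)
  also have "\<dots> \<le> D * (LINT x|m. \<bar>e x\<bar>)" using D[of t] t by (intro mult_right_mono) auto
  also have "(LINT x|m. \<bar>conv (loss f) t g x\<bar>) \<le> D * (LINT y|m. \<bar>g y\<bar>) * t"
    by (rule conv_loss_bound[OF f t D])
  finally show ?thesis by (simp add: algebra_simps)
qed

lemma U_tendsto:
  assumes f: "integrable m f"
  shows "((\<lambda>t. LINT x|m. \<bar>U t f x - p t f x\<bar>) \<longlongrightarrow> 0) (at_right 0)"
proof (rule tendstoI)
  fix \<epsilon> :: real assume e: "\<epsilon> > 0"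
  \<comment> \<open>The summand 1 keeps K positive if e and g vanish; restricting to t < 1 lets K
    also absorb the factor t.\<close>
  define K where "K = (LINT x|m. \<bar>e x\<bar>) + (LINT x|m. \<bar>g x\<bar>) + 1"
  have K: "K > 0" unfolding K_def by (intro add_nonneg_pos add_nonneg_nonneg) auto
  have "\<epsilon> / 2 / K > 0" using K e by simp
  from loss_small[OF f this] obtain \<delta> where d: "\<delta> > 0" "\<And>s. 0 \<le> s \<Longrightarrow> s < \<delta> \<Longrightarrow> \<bar>loss f s\<bar> \<le> \<epsilon> / 2 / K" by metis
  have "dist (LINT x|m. \<bar>U t f x - p t f x\<bar>) 0 < \<epsilon>" if t: "0 < t" "t < min \<delta> 1" for t
  proof -
    have "(LINT x|m. \<bar>U t f x - p t f x\<bar>) \<le> \<epsilon> / 2 / K * ((LINT x|m. \<bar>e x\<bar>) + (LINT x|m. \<bar>g x\<bar>) * t)"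
      using t d(2) by (intro U_bound[OF f]) auto
    also have "\<dots> \<le> \<epsilon> / 2 / K * K"
    proof (rule mult_left_mono)
      have "(LINT x|m. \<bar>g x\<bar>) * t \<le> (LINT x|m. \<bar>g x\<bar>) * 1" using t by (intro mult_left_mono) auto
      then show "(LINT x|m. \<bar>e x\<bar>) + (LINT x|m. \<bar>g x\<bar>) * t \<le> K" unfolding K_def by simp
    qed (use e K in simp)
    also have "\<dots> = \<epsilon> / 2" using K by simp
    finally show ?thesis using e by (simp add: dist_real_def)
  qed
  then show "\<forall>\<^sub>F t in at_right 0. dist (LINT x|m. \<bar>U t f x - p t f x\<bar>) 0 < \<epsilon>"
    using d(1) unfolding eventually_at_right_field by (intro exI[of _ "min \<delta> 1"]) auto
qed

text \<open>Only boundedness for each fixed time is required and proved; the constant may grow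
  exponentially with t.\<close>

lemma C0_semigroup_U: "C0_semigroup 1 m U"
  unfolding C0_semigroup_def Lp_mem_1 Lp_norm_1 Lp_conv_1
proof (intro conjI)
  show "\<forall>t\<ge>0. \<forall>f. integrable m f \<longrightarrow> integrable m (U t f)" using U_integrable by blast
  show "\<forall>t\<ge>0. \<forall>f f'. integrable m f \<and> integrable m f' \<and> (AE x in m. f x = f' x) \<longrightarrow>
     (AE x in m. U t f x = U t f' x)"
  proof (intro allI impI; elim conjE)
    fix t :: real and f f' :: "'a \<Rightarrow> real"
    assume *: "0 \<le> t" "integrable m f" "integrable m f'" "AE x in m. f x = f' x"
    show "AE x in m. U t f x = U t f' x"
      using p_cong_AE[OF *] loss_cong[OF *(2-4)] by (auto simp: U_def)
  qed
  show "\<forall>t\<ge>0. \<forall>f h a b. integrable m f \<and> integrable m h \<longrightarrow>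
     (AE x in m. U t (\<lambda>y. a * f y + b * h y) x = a * U t f x + b * U t h x)"
  proof (intro allI impI; elim conjE)
    fix t a b :: real and f h :: "'a \<Rightarrow> real"
    assume *: "0 \<le> t" "integrable m f" "integrable m h"
    show "AE x in m. U t (\<lambda>y. a * f y + b * h y) x = a * U t f x + b * U t h x"
      using p_linear_AE[OF *, of a b] AE_space
    proof eventually_elim
      case (elim x)
      have "conv (loss (\<lambda>y. a * f y + b * h y)) t g x =
         (LINT s:{0..t}|lborel. a * (loss f s * p (t - s) g x) + b * (loss h s * p (t - s) g x))"
        unfolding conv_def using * by (intro set_lebesgue_integral_cong) (auto simp: loss_linear algebra_simps)
      also have "\<dots> = a * conv (loss f) t g x + b * conv (loss h) t g x"
        unfolding conv_def
        using conv_set_integrable[OF g_integrable g_bounded loss_continuous[OF *(2)] elim(2)]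
          conv_set_integrable[OF g_integrable g_bounded loss_continuous[OF *(3)] elim(2)]
        by (subst set_integral_add(2)) auto
      finally show ?case unfolding U_def elim(1) loss_linear[OF *(2,3,1)] by (simp add: algebra_simps)
    qed
  qed
  show "\<forall>t\<ge>0. \<exists>C. \<forall>f. integrable m f \<longrightarrow> (LINT x|m. \<bar>U t f x\<bar>) \<le> C * (LINT x|m. \<bar>f x\<bar>)"
  proof (intro allI impI)
    fix t :: real assume t: "0 \<le> t"
    let ?E = "4 * exp ((2 * (LINT x|m. \<bar>g x\<bar>) + 1) * t)"
    let ?K = "(LINT x|m. \<bar>e x\<bar>) + (LINT x|m. \<bar>g x\<bar>) * t"
    have "(LINT x|m. \<bar>U t f x\<bar>) \<le> (1 + ?E * ?K) * (LINT x|m. \<bar>f x\<bar>)" if f: "integrable m f" for f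
    proof -
      have "(LINT x|m. \<bar>U t f x\<bar>) \<le> (LINT x|m. \<bar>U t f x - p t f x\<bar>) + (LINT x|m. \<bar>p t f x\<bar>)"
        using L1_add_le[of m "\<lambda>x. U t f x - p t f x" "p t f"] U_integrable[OF f t] p_integrable[OF t f] by simp
      also have "\<dots> \<le> ?E * (LINT x|m. \<bar>f x\<bar>) * ?K + (LINT x|m. \<bar>f x\<bar>)"
        using U_bound[OF f t loss_bounded_Icc[OF f]] p_contraction[OF t f] by (intro add_mono) auto
      finally show ?thesis by (simp add: algebra_simps)
    qed
    then show "\<exists>C. \<forall>f. integrable m f \<longrightarrow> (LINT x|m. \<bar>U t f x\<bar>) \<le> C * (LINT x|m. \<bar>f x\<bar>)" by blast
  qed
  show "\<forall>f. integrable m f \<longrightarrow> (AE x in m. U 0 f x = f x)"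
  proof (intro allI impI AE_I2)
    fix f :: "'a \<Rightarrow> real" and x assume f: "integrable m f" and x: "x \<in> space m"
    have "conv (loss f) 0 g x = 0"
      unfolding conv_def by (rule LINT_Icc_point)
    then show "U 0 f x = f x" unfolding U_def using f x by (simp add: loss_0 p_0)
  qed
  show "\<forall>s\<ge>0. \<forall>t\<ge>0. \<forall>f. integrable m f \<longrightarrow> (AE x in m. U (s + t) f x = U s (U t f) x)"
    using U_semigroup_AE by simp
  show "\<forall>f. integrable m f \<longrightarrow> integrable m f \<and> (\<forall>\<^sub>F t in at_right 0. integrable m (U t f)) \<and>
     ((\<lambda>t. LINT x|m. \<bar>U t f x - f x\<bar>) \<longlongrightarrow> 0) (at_right 0)"
  proof (intro allI impI conjI)
    fix f :: "'a \<Rightarrow> real" assume f: "integrable m f"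
    show "\<forall>\<^sub>F t in at_right 0. integrable m (U t f)"
      using U_integrable[OF f] by (auto simp: eventually_at_filter)
    have lim: "((\<lambda>t. (LINT x|m. \<bar>U t f x - p t f x\<bar>) + (LINT x|m. \<bar>p t f x - f x\<bar>)) \<longlongrightarrow> 0) (at_right 0)"
      using tendsto_add[OF U_tendsto[OF f] strongly_continuous[OF f]] by simp
    have "\<forall>\<^sub>F t in at_right 0. (LINT x|m. \<bar>U t f x - f x\<bar>) \<le>
        (LINT x|m. \<bar>U t f x - p t f x\<bar>) + (LINT x|m. \<bar>p t f x - f x\<bar>)"
      using L1_triangle[OF U_integrable[OF f] p_integrable[OF _ f] f] by (auto simp: eventually_at_filter)
    then show "((\<lambda>t. LINT x|m. \<bar>U t f x - f x\<bar>) \<longlongrightarrow> 0) (at_right 0)"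
      by (rule tendsto_sandwich[OF _ _ tendsto_const lim, rotated]) simp
  qed
qed

text \<open>Since the loss tends to 0, the Volterra integral over {0..t} is o(t): reinjected mass
  does not contribute to first order. The rate is that of the direct loss, which is minus the
  integral of the generator value.\<close>

lemma loss_derivative_0:
  assumes u: "generator 1 m p u w"
  shows "((\<lambda>t. loss u t / t) \<longlongrightarrow> - (LINT x|m. w x)) (at_right 0)"
proof -
  have ui: "integrable m u" and wi: "integrable m w"
    and lim: "((\<lambda>t. LINT x|m. \<bar>(p t u x - u x) / t - w x\<bar>) \<longlongrightarrow> 0) (at_right 0)"
    using u unfolding generator_def Lp_mem_1 Lp_conv_1 by auto
  let ?M = "LINT x|m. \<bar>g x\<bar>"
  have est: "\<bar>loss u t / t + (LINT x|m. w x)\<bar> \<le> (LINT x|m. \<bar>(p t u x - u x) / t - w x\<bar>) + B * ?M"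
    if t: "0 < t" and B: "\<And>s. s \<in> {0..t} \<Longrightarrow> \<bar>loss u s\<bar> \<le> B" for t B
  proof -
    let ?I = "LINT s:{0..t}|lborel. loss u s * \<kappa> (t - s)"
    have B0: "B \<ge> 0" using B[of 0] t by auto
    have cl: "continuous_on UNIV (\<lambda>s. loss u s * \<kappa> (t - s))"
      by (intro continuous_intros loss_continuous[OF ui] continuous_on_compose2[OF \<kappa>_continuous]) auto
    have "\<bar>?I\<bar> \<le> B * ?M * (t - 0)"
    proof (rule LINT_Icc_bound[OF borel_measurable_continuous_onI[OF cl]])
      show "\<bar>loss u s * \<kappa> (t - s)\<bar> \<le> B * ?M" if "s \<in> {0..t}" for s
        unfolding abs_mult using B[OF that] \<kappa>_bounded B0 by (intro mult_mono) auto
    qed (use t in auto)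
    then have 1: "\<bar>?I / t\<bar> \<le> B * ?M" using t by (simp add: field_simps)
    have pi: "integrable m (p t u)" using p_integrable[OF _ ui, of t] t by simp
    have "loss u t = - (LINT x|m. p t u x - u x) + ?I"
      using loss_equation[OF ui ui, of t] t pi ui unfolding direct_loss_def by (simp add: max_def)
    then have "loss u t / t + (LINT x|m. w x) = - (LINT x|m. (p t u x - u x) / t - w x) + ?I / t"
      using pi ui wi t by (simp add: field_simps)
    moreover have "\<bar>LINT x|m. (p t u x - u x) / t - w x\<bar> \<le> (LINT x|m. \<bar>(p t u x - u x) / t - w x\<bar>)"
      by (rule integral_abs_bound)
    ultimately show ?thesis using 1 by linarith
  qed
  have "((\<lambda>t. loss u t / t + (LINT x|m. w x)) \<longlongrightarrow> 0) (at_right 0)"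
  proof (rule tendstoI)
    fix \<epsilon> :: real assume e: "\<epsilon> > 0"
    have M: "?M + 1 > 0" by (intro add_nonneg_pos) auto
    \<comment> \<open>The denominator is increased by 1 because the norm of g may be 0.\<close>
    define B where "B = \<epsilon> / 2 / (?M + 1)"
    have B: "B > 0" unfolding B_def using e M by simp
    obtain \<delta> where d: "\<delta> > 0" "\<And>s. 0 \<le> s \<Longrightarrow> s < \<delta> \<Longrightarrow> \<bar>loss u s\<bar> \<le> B" using loss_small[OF ui B] by metis
    have "B * ?M \<le> B * (?M + 1)" using B by simp
    also have "\<dots> = \<epsilon> / 2" unfolding B_def using M by (metis nonzero_eq_divide_eq less_irrefl)
    finally have BM: "B * ?M \<le> \<epsilon> / 2" .
    have "\<forall>\<^sub>F t in at_right 0. (LINT x|m. \<bar>(p t u x - u x) / t - w x\<bar>) < \<epsilon> / 2"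
      using order_tendstoD(2)[OF lim, of "\<epsilon> / 2"] e by simp
    moreover have "\<forall>\<^sub>F t in at_right 0. 0 < t \<and> t < \<delta>"
      using d(1) unfolding eventually_at_right_field by auto
    ultimately show "\<forall>\<^sub>F t in at_right 0. dist (loss u t / t + (LINT x|m. w x)) 0 < \<epsilon>"
    proof eventually_elim
      case (elim t)
      have "\<bar>loss u t / t + (LINT x|m. w x)\<bar> \<le> (LINT x|m. \<bar>(p t u x - u x) / t - w x\<bar>) + B * ?M"
        using elim d(2) by (intro est) auto
      then show ?case using elim(1) BM unfolding dist_real_def by linarith
    qed
  qed
  from tendsto_diff[OF this tendsto_const[of "LINT x|m. w x"]] show ?thesis by simp
qed

text \<open>Divided by t, the three summands of \<open>U\<close> contribute w, the limit - (int w)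
  of loss u t / t times e, and a Duhamel term tending to 0 because the loss does.\<close>

lemma generator_U:
  assumes u: "generator 1 m p u w"
  shows "generator 1 m U u (\<lambda>x. w x - (LINT x|m. w x) * e x)"
  unfolding generator_def Lp_mem_1 Lp_conv_1
proof (intro conjI)
  have ui: "integrable m u" and wi: "integrable m w"
    and lim: "((\<lambda>t. LINT x|m. \<bar>(p t u x - u x) / t - w x\<bar>) \<longlongrightarrow> 0) (at_right 0)"
    using u unfolding generator_def Lp_mem_1 Lp_conv_1 by auto
  show "integrable m u" by fact
  show "integrable m (\<lambda>x. w x - (LINT x|m. w x) * e x)"
    using wi e_integrable by auto
  show "\<forall>\<^sub>F t in at_right 0. integrable m (\<lambda>x. (U t u x - u x) / t)"
    using U_integrable[OF ui] ui by (auto simp: eventually_at_filter)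
  let ?W = "LINT x|m. w x" and ?E = "LINT x|m. \<bar>e x\<bar>"
  let ?r = "\<lambda>t. LINT x|m. \<bar>(U t u x - u x) / t - (w x - ?W * e x)\<bar>"
  let ?c = "\<lambda>t. LINT x|m. \<bar>conv (loss u) t g x / t\<bar>"
  have est: "?r t \<le> (LINT x|m. \<bar>(p t u x - u x) / t - w x\<bar>) + (\<bar>loss u t / t - (- ?W)\<bar> * ?E + ?c t)"
    if t: "0 < t" for t
  proof -
    have i: "integrable m (\<lambda>x. (p t u x - u x) / t - w x)" "integrable m (\<lambda>x. (loss u t / t - (- ?W)) * e x)"
      "integrable m (\<lambda>x. conv (loss u) t g x / t)"
      using p_integrable[OF _ ui, of t] ui wi e_integrable conv_loss_integrable[OF ui, of t] t by auto
    have "?r t = (LINT x|m. \<bar>((p t u x - u x) / t - w x) + ((loss u t / t - (- ?W)) * e x + conv (loss u) t g x / t)\<bar>)"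
      unfolding U_def using t by (intro Bochner_Integration.integral_cong refl arg_cong[where f=abs]) (simp add: field_simps)
    also have "\<dots> \<le> (LINT x|m. \<bar>(p t u x - u x) / t - w x\<bar>) +
        (LINT x|m. \<bar>(loss u t / t - (- ?W)) * e x + conv (loss u) t g x / t\<bar>)"
      by (rule L1_add_le[OF i(1) Bochner_Integration.integrable_add[OF i(2,3)]])
    also have "(LINT x|m. \<bar>(loss u t / t - (- ?W)) * e x + conv (loss u) t g x / t\<bar>) \<le>
        (LINT x|m. \<bar>(loss u t / t - (- ?W)) * e x\<bar>) + ?c t"
      by (rule L1_add_le[OF i(2,3)])
    also have "(LINT x|m. \<bar>(loss u t / t - (- ?W)) * e x\<bar>) = \<bar>loss u t / t - (- ?W)\<bar> * ?E"
      unfolding abs_mult by simp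
    finally show ?thesis by simp
  qed
  have c_lim: "(?c \<longlongrightarrow> 0) (at_right 0)"
  proof (rule tendstoI)
    fix \<epsilon> :: real assume e: "\<epsilon> > 0"
    let ?M = "LINT x|m. \<bar>g x\<bar>"
    have M: "?M + 1 > 0" by (intro add_nonneg_pos) auto
    define B where "B = \<epsilon> / 2 / (?M + 1)"
    have B: "B > 0" unfolding B_def using e M by simp
    obtain \<delta> where d: "\<delta> > 0" "\<And>s. 0 \<le> s \<Longrightarrow> s < \<delta> \<Longrightarrow> \<bar>loss u s\<bar> \<le> B" using loss_small[OF ui B] by metis
    have "B * ?M \<le> B * (?M + 1)" using B by simp
    also have "\<dots> = \<epsilon> / 2" unfolding B_def using M by (metis nonzero_eq_divide_eq less_irrefl)
    finally have BM: "B * ?M \<le> \<epsilon> / 2" .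
    have "dist (?c t) 0 < \<epsilon>" if t: "0 < t" "t < \<delta>" for t
    proof -
      have "?c t = (LINT x|m. \<bar>conv (loss u) t g x\<bar>) / t" using t by simp
      also have "\<dots> \<le> (B * ?M * t) / t"
        using t d(2) by (intro divide_right_mono conv_loss_bound[OF ui]) auto
      also have "\<dots> \<le> \<epsilon> / 2" using BM t by simp
      finally have "?c t < \<epsilon>" using e by linarith
      then show ?thesis unfolding dist_real_def
        by (subst abs_of_nonneg) auto
    qed
    then show "\<forall>\<^sub>F t in at_right 0. dist (?c t) 0 < \<epsilon>"
      using d(1) unfolding eventually_at_right_field by auto
  qed
  have "((\<lambda>t. \<bar>loss u t / t - (- ?W)\<bar>) \<longlongrightarrow> 0) (at_right 0)"
    using loss_derivative_0[OF u] by (intro tendsto_rabs_zero) (subst (asm) LIM_zero_iff[symmetric])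
  from tendsto_add[OF lim tendsto_add[OF tendsto_mult_right[OF this, of ?E] c_lim]]
  have lim2: "((\<lambda>t. (LINT x|m. \<bar>(p t u x - u x) / t - w x\<bar>) + (\<bar>loss u t / t - (- ?W)\<bar> * ?E + ?c t)) \<longlongrightarrow> 0) (at_right 0)"
    by simp
  have "\<forall>\<^sub>F t in at_right 0. ?r t \<le> (LINT x|m. \<bar>(p t u x - u x) / t - w x\<bar>) + (\<bar>loss u t / t - (- ?W)\<bar> * ?E + ?c t)"
    using est by (auto simp: eventually_at_filter)
  then show "(?r \<longlongrightarrow> 0) (at_right 0)"
    by (rule tendsto_sandwich[OF _ _ tendsto_const lim2, rotated]) simp
qed

end

section \<open>Conservation of mass as a consequence of uniqueness\<close>

lemma generator_unique:
  assumes S: "generator 1 M S u w" and S': "generator 1 M S' u w'"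
    and eq: "\<And>t. 0 \<le> t \<Longrightarrow> AE x in M. S t u x = S' t u x"
  shows "AE x in M. w x = w' x"
proof -
  have i: "integrable M w" "integrable M w'"
    and ev: "\<forall>\<^sub>F t in at_right 0. integrable M (\<lambda>x. (S t u x - u x) / t)"
      "\<forall>\<^sub>F t in at_right 0. integrable M (\<lambda>x. (S' t u x - u x) / t)"
    and lim: "((\<lambda>t. LINT x|M. \<bar>(S t u x - u x) / t - w x\<bar>) \<longlongrightarrow> 0) (at_right 0)"
      "((\<lambda>t. LINT x|M. \<bar>(S' t u x - u x) / t - w' x\<bar>) \<longlongrightarrow> 0) (at_right 0)"
    using S S' unfolding generator_def Lp_conv_1 by auto
  have "\<forall>\<^sub>F t in at_right 0. (LINT x|M. \<bar>w x - w' x\<bar>) \<le>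
     (LINT x|M. \<bar>(S t u x - u x) / t - w x\<bar>) + (LINT x|M. \<bar>(S' t u x - u x) / t - w' x\<bar>)"
    using ev eventually_at_right_less[of 0]
  proof eventually_elim
    case (elim t)
    have "(LINT x|M. \<bar>w x - w' x\<bar>) \<le>
      (LINT x|M. \<bar>w x - (S t u x - u x) / t\<bar>) + (LINT x|M. \<bar>(S t u x - u x) / t - w' x\<bar>)"
      using i elim by (intro L1_triangle)
    also have "(LINT x|M. \<bar>(S t u x - u x) / t - w' x\<bar>) = (LINT x|M. \<bar>(S' t u x - u x) / t - w' x\<bar>)"
    proof (rule integral_cong_AE)
      show "AE x in M. \<bar>(S t u x - u x) / t - w' x\<bar> = \<bar>(S' t u x - u x) / t - w' x\<bar>"
        using eq[OF less_imp_le[OF elim(3)]] by eventually_elim simp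
    qed (use i elim in \<open>auto intro!: borel_measurable_integrable\<close>)
    finally show ?case by (simp add: abs_minus_commute)
  qed
  moreover have "((\<lambda>t. (LINT x|M. \<bar>(S t u x - u x) / t - w x\<bar>) + (LINT x|M. \<bar>(S' t u x - u x) / t - w' x\<bar>)) \<longlongrightarrow> 0) (at_right 0)"
    using tendsto_add[OF lim] by simp
  ultimately have "(LINT x|M. \<bar>w x - w' x\<bar>) \<le> 0"
    by (intro tendsto_lowerbound) auto
  then show ?thesis using i by (intro L1_eq_0_AE) (auto intro: antisym)
qed

context continuous_kernels
begin

text \<open>\<open>D\<close> is the graph of the operator that determines the semigroup. The profile
  is manufactured from f itself as J \<tau> f, which divided by \<tau> is close to f in L^1; a
  nonzero integral of f is thus inherited by the profile.\<close>

lemma mass_conserved_if_unique: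
  assumes D: "\<And>u w. (u, w) \<in> D \<Longrightarrow> generator 1 m p u w" "\<And>u w. (u, w) \<in> D \<Longrightarrow> (LINT x|m. w x) = 0"
    and uniq: "\<And>S t f. C0_semigroup 1 m S \<Longrightarrow> (\<And>u w. (u, w) \<in> D \<Longrightarrow> generator 1 m S u w) \<Longrightarrow>
      0 \<le> t \<Longrightarrow> integrable m f \<Longrightarrow> AE x in m. S t f x = p t f x"
    and f: "integrable m f" "\<And>x. x \<in> space m \<Longrightarrow> \<bar>f x\<bar> \<le> c" "(LINT x|m. f x) \<noteq> 0"
    and t: "0 \<le> t"
  shows "(LINT x|m. p t f x) = (LINT x|m. f x)"
proof -
  have "((\<lambda>t. LINT x|m. J t f x / t - f x) \<longlongrightarrow> 0) (at_right 0)"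
    by (rule Lim_null_comparison[OF _ J_derivative_0[OF f(1,2)]])
      (auto intro!: always_eventually integral_abs_bound)
  then have "\<forall>\<^sub>F t in at_right 0. dist (LINT x|m. J t f x / t - f x) 0 < \<bar>LINT x|m. f x\<bar>"
    using f(3) by (intro tendstoD) auto
  then obtain b where "b > 0" "\<And>t. 0 < t \<Longrightarrow> t < b \<Longrightarrow> \<bar>LINT x|m. J t f x / t - f x\<bar> < \<bar>LINT x|m. f x\<bar>"
    by (auto simp: eventually_at_right_field dist_real_def)
  then obtain \<tau> where tau: "\<tau> > 0" "\<bar>LINT x|m. J \<tau> f x / \<tau> - f x\<bar> < \<bar>LINT x|m. f x\<bar>"
    using field_lbound_gt_zero[of b b] by auto
  interpret reinjection m k f c \<tau>
    by unfold_locales (rule f(1), erule f(2), rule tau(1))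
  have "(LINT x|m. e x / \<tau> - f x) = (LINT x|m. e x) / \<tau> - (LINT x|m. f x)"
    using e_integrable f(1) by simp
  \<comment> \<open>Otherwise the integral of e / \<tau> - f would have modulus |int f|, against the
    choice of \<tau>.\<close>
  then have e: "(LINT x|m. e x) \<noteq> 0"
    using tau(2) unfolding e_def by auto
  have U: "AE x in m. U t h x = p t h x" if "0 \<le> t" "integrable m h" for t h
  proof (rule uniq[OF C0_semigroup_U _ that])
    fix u w assume "(u, w) \<in> D"
    \<comment> \<open>On \<open>D\<close> generator values have integral 0, so the reinjection term
      disappears.\<close>
    then show "generator 1 m U u w" using generator_U[OF D(1)] D(2) by fastforce
  qed
  let ?w = "\<lambda>x. p t f x - f x"
  have gen: "generator 1 m p (J t f) ?w" by (rule generator_J[OF f(1,2) t])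
  have i: "integrable m (J t f)" "integrable m (p t f)"
    using J_integrable[OF f(1,2) t] p_integrable[OF t f(1)] by simp_all
  have "AE x in m. ?w x - (LINT x|m. ?w x) * e x = ?w x"
    by (rule generator_unique[OF generator_U[OF gen] gen]) (rule U[OF _ i(1)])
  then have "AE x in m. (LINT x|m. ?w x) * e x = 0" by eventually_elim linarith
  then have "(LINT x|m. (LINT x|m. ?w x) * e x) = 0" by (rule integral_eq_zero_AE)
  then have "(LINT x|m. ?w x) = 0" using e by simp
  then show ?thesis using i f(1) by simp
qed

end

section \<open>Right processes\<close>

lemma space_Delta_borel [simp]: "space Delta_borel = UNIV"
  unfolding Delta_borel_def by (simp add: space_measure_of_conv)

lemma sets_Delta_borel_sigma: "sets Delta_borel = sigma_sets UNIV {U. openin Delta_top U}"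
  unfolding Delta_borel_def by (simp add: sets_measure_of_conv)

lemma openin_Delta_top:
  "openin Delta_top V \<longleftrightarrow> (\<exists>U. open U \<and> V = Some ` U) \<or> (\<exists>C. compact C \<and> V = insert None (Some ` (- C)))"
  unfolding openin_Alexandroff_compactification
  by (auto simp: Compl_eq_Diff_UNIV compact_imp_closed)

lemma open_Delta_borel: "openin Delta_top V \<Longrightarrow> V \<in> sets Delta_borel"
  unfolding sets_Delta_borel_sigma by (auto intro: sigma_sets.Basic)

lemma Some_image_Delta_borel:
  assumes "B \<in> sets borel"
  shows "Some ` B \<in> sets Delta_borel"
proof -
  have "B \<in> sigma_sets UNIV {S. open S}" using assms by (simp add: borel_def sets_measure_of_conv)
  then show ?thesis
  proof induction
    case (Basic a)
    then show ?case by (intro open_Delta_borel) (auto simp: openin_Delta_top)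
  next
    case (Compl a)
    have "Some ` (UNIV - a) = Some ` UNIV - Some ` a" by auto
    moreover have "Some ` UNIV \<in> sets Delta_borel" by (intro open_Delta_borel) (auto simp: openin_Delta_top)
    ultimately show ?case using Compl by auto
  next
    case (Union a)
    then show ?case by (auto simp: image_UN)
  qed auto
qed

lemma None_Delta_borel: "{None} \<in> sets Delta_borel"
proof -
  have "{None} = UNIV - range Some" by (auto simp: UNIV_option_conv)
  also have "\<dots> \<in> sets Delta_borel" using Some_image_Delta_borel[of UNIV] sets.compl_sets by fastforce
  finally show ?thesis .
qed

lemma sets_Delta_borel: "A \<in> sets Delta_borel \<longleftrightarrow> Some -` A \<in> sets borel"
proof
  assume "A \<in> sets Delta_borel"
  then have "A \<in> sigma_sets UNIV {U. openin Delta_top U}" unfolding sets_Delta_borel_sigma .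
  then show "Some -` A \<in> sets borel"
  proof induction
    case (Basic a)
    then consider U where "open U" "a = Some ` U" | C where "compact C" "a = insert None (Some ` (- C))"
      by (auto simp: openin_Delta_top)
    then show ?case
    proof cases
      case 1
      then have "Some -` a = U" by auto
      then show ?thesis using 1 by simp
    next
      case 2
      then have "Some -` a = - C" by auto
      then show ?thesis using 2 by (simp add: borel_compact borel_comp)
    qed
  next
    case (Compl a)
    then show ?case by (simp add: vimage_Diff sets.compl_sets[of _ borel, simplified])
  next
    case (Union a)
    then show ?case by (auto simp: vimage_Union)
  qed auto
next
  assume "Some -` A \<in> sets borel"
  then have 1: "Some ` (Some -` A) \<in> sets Delta_borel" by (rule Some_image_Delta_borel)
  have "Some ` (Some -` A) = A - {None}"
  proof (intro set_eqI)
    fix x show "x \<in> Some ` (Some -` A) \<longleftrightarrow> x \<in> A - {None}" by (cases x) auto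
  qed
  then have "A = Some ` (Some -` A) \<or> A = insert None (Some ` (Some -` A))" by auto
  moreover have "insert None (Some ` (Some -` A)) \<in> sets Delta_borel"
    using sets.Un[OF None_Delta_borel 1] by simp
  ultimately show "A \<in> sets Delta_borel" using 1 by metis
qed

lemma measurable_Some: "Some \<in> borel \<rightarrow>\<^sub>M Delta_borel"
  by (rule measurableI) (auto simp: sets_Delta_borel)

lemma measurable_Delta_borel_iff:
  "f \<in> Delta_borel \<rightarrow>\<^sub>M N \<longleftrightarrow> (f \<circ> Some) \<in> borel \<rightarrow>\<^sub>M N \<and> f None \<in> space N"
proof
  assume "f \<in> Delta_borel \<rightarrow>\<^sub>M N"
  then show "(f \<circ> Some) \<in> borel \<rightarrow>\<^sub>M N \<and> f None \<in> space N"
    using measurable_comp[OF measurable_Some] measurable_space[of f Delta_borel N None] by auto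
next
  assume *: "(f \<circ> Some) \<in> borel \<rightarrow>\<^sub>M N \<and> f None \<in> space N"
  show "f \<in> Delta_borel \<rightarrow>\<^sub>M N"
  proof (rule measurableI)
    fix z :: "(real^'a) option" show "f z \<in> space N"
      using * measurable_space[of "f \<circ> Some" borel N] by (cases z) auto
  next
    fix A assume "A \<in> sets N"
    then show "f -` A \<inter> space Delta_borel \<in> sets Delta_borel"
      using measurable_sets[of "f \<circ> Some" borel N A] * by (simp add: sets_Delta_borel vimage_comp)
  qed
qed

lemma ext0_measurable: "f \<in> borel_measurable borel \<Longrightarrow> ext0 f \<in> borel_measurable Delta_borel"
  unfolding measurable_Delta_borel_iff by (auto simp: ext0_def comp_def)

locale right_proc =
  fixes F :: "'w measure" and Ft :: "real \<Rightarrow> 'w measure"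
    and X :: "real \<Rightarrow> 'w \<Rightarrow> (real^'n::finite) option"
    and Pr :: "(real^'n) option \<Rightarrow> 'w measure"
  assumes right: "right_process F Ft X Pr"
begin

lemmas right_conjuncts = right[unfolded right_process_def]
lemmas markov = right_conjuncts[THEN conjunct1]
lemmas markov_conjuncts = markov[unfolded markov_process_def]

lemma normal: "AE \<omega> in Pr z. X 0 \<omega> = z"
  by (rule right_conjuncts[THEN conjunct2, THEN conjunct1, rule_format])

lemma right_continuous:
  "\<omega> \<in> space F \<Longrightarrow> 0 \<le> t \<Longrightarrow> limitin Delta_top (\<lambda>s. X s \<omega>) (X t \<omega>) (at_right t)"
  by (rule right_conjuncts[THEN conjunct2, THEN conjunct2, THEN conjunct1, rule_format])

lemma space_Ft: "0 \<le> t \<Longrightarrow> space (Ft t) = space F"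
  and sets_Ft: "0 \<le> t \<Longrightarrow> sets (Ft t) \<subseteq> sets F"
  using markov_conjuncts[THEN conjunct1] by simp_all

lemma adapted: "0 \<le> t \<Longrightarrow> X t \<in> Ft t \<rightarrow>\<^sub>M Delta_borel"
  by (rule markov_conjuncts[THEN conjunct2, THEN conjunct2, THEN conjunct1, rule_format])

lemma mono_Ft: "0 \<le> s \<Longrightarrow> s \<le> t \<Longrightarrow> sets (Ft s) \<subseteq> sets (Ft t)"
  by (rule markov_conjuncts[THEN conjunct2, THEN conjunct1, rule_format]) simp

lemma lifetime: "\<exists>\<zeta>. \<forall>\<omega>\<in>space F. \<forall>t\<ge>0. X t \<omega> = None \<longleftrightarrow> \<zeta> \<omega> \<le> ennreal t"
  using markov_conjuncts[THEN conjunct2, THEN conjunct2, THEN conjunct2, THEN conjunct1] by (rule bexE) (rule exI)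

lemmas markov_conjuncts' =
  markov_conjuncts[THEN conjunct2, THEN conjunct2, THEN conjunct2, THEN conjunct2, THEN conjunct2]

lemma prob_Pr: "prob_space (Pr z)"
  and space_Pr: "space (Pr z) = space F"
  and sets_Pr: "sets (Pr z) = sets F"
  using markov_conjuncts'[THEN conjunct1] by simp_all

lemma universally_measurable:
  "\<Gamma> \<in> sets F \<Longrightarrow> (\<lambda>z. emeasure (Pr z) \<Gamma>) \<in> borel_measurable (universal_completion Delta_borel)"
  by (rule markov_conjuncts'[THEN conjunct2, THEN conjunct1, rule_format])

lemma Borel_measurable:
  "\<Gamma> \<in> sets (past F X {0..}) \<Longrightarrow> (\<lambda>z. emeasure (Pr z) \<Gamma>) \<in> borel_measurable Delta_borel"
  by (rule markov_conjuncts'[THEN conjunct2, THEN conjunct2, THEN conjunct1, rule_format])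

lemma markov_property:
  "A \<in> sets Delta_borel \<Longrightarrow> 0 \<le> s \<Longrightarrow> 0 \<le> t \<Longrightarrow> AE \<omega> in Pr z.
     real_cond_exp (Pr z) (Ft s) (indicator {\<omega>'\<in>space F. X (s + t) \<omega>' \<in> A}) \<omega> =
     measure (Pr (X s \<omega>)) {\<omega>'\<in>space F. X t \<omega>' \<in> A}"
  by (rule markov_conjuncts'[THEN conjunct2, THEN conjunct2, THEN conjunct2, rule_format])

lemma X_measurable: "0 \<le> t \<Longrightarrow> X t \<in> F \<rightarrow>\<^sub>M Delta_borel"
  using measurable_sets[OF adapted[of t]] space_Ft[of t] sets_Ft[of t]
  by (intro measurableI) auto

lemma measurable_Pr: "measurable (Pr z) N = measurable F N"
  by (rule measurable_cong_sets) (auto simp: sets_Pr)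

lemma space_past: "space (past F X J) = space F"
  unfolding past_def by (simp add: space_measure_of_conv)

lemma sets_past: "sets (past F X J) =
    sigma_sets (space F) {X s -` A \<inter> space F |s A. s \<in> J \<and> A \<in> sets Delta_borel}"
  unfolding past_def by (intro sets_measure_of) blast

lemma X_past_measurable: "s \<in> J \<Longrightarrow> X s \<in> past F X J \<rightarrow>\<^sub>M Delta_borel"
  by (rule measurableI) (auto simp: space_past sets_past intro!: sigma_sets.Basic)

lemma sets_past_subset: "J \<subseteq> {0..} \<Longrightarrow> sets (past F X J) \<subseteq> sets F"
  unfolding sets_past using X_measurable
  by (intro sets.sigma_sets_subset) (auto intro: measurable_sets)

lemma subalgebra_past: "subalgebra (Pr z) (past F X {0..})"
  unfolding subalgebra_def space_past space_Pr sets_Pr using sets_past_subset by auto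

lemma subalgebra_Ft: "0 \<le> t \<Longrightarrow> subalgebra (Pr z) (Ft t)"
  unfolding subalgebra_def space_Pr sets_Pr using space_Ft sets_Ft by auto

text \<open>Right-continuity makes \<open>(s, \<omega>) \<mapsto> X s \<omega>\<close> the limit of its discretizations from the right;
  membership of the limit in an open set is expressed through a compact exhaustion.\<close>

lemma jointly_measurable: "(\<lambda>(s, \<omega>). X (max 0 s) \<omega>) \<in> borel \<Otimes>\<^sub>M past F X {0..} \<rightarrow>\<^sub>M Delta_borel"
proof -
  let ?P = "past F X {0..}"
  \<comment> \<open>The first multiple of 1 / (n + 1) strictly to the right of
    \<open>max 0 s\<close>. Adding 1 to the floor makes it strictly larger even at grid points, as
    convergence along \<open>at_right\<close> demands.\<close>
  define q where "q n s = (of_int (\<lfloor>real (Suc n) * max 0 s\<rfloor> + 1) / real (Suc n) :: real)" for n s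
  have dyadic: "x < of_int (\<lfloor>N * x\<rfloor> + 1) / N" "of_int (\<lfloor>N * x\<rfloor> + 1) / N \<le> x + 1 / N"
    if "N > 0" for N x :: real
  proof -
    have "x * N < of_int (\<lfloor>N * x\<rfloor> + 1)" "of_int (\<lfloor>N * x\<rfloor> + 1) \<le> x * N + 1"
      using floor_correct[of "N * x"] by (simp_all add: mult.commute)
    then show "x < of_int (\<lfloor>N * x\<rfloor> + 1) / N" "of_int (\<lfloor>N * x\<rfloor> + 1) / N \<le> x + 1 / N"
      using that by (simp_all add: pos_less_divide_eq pos_divide_le_eq distrib_right)
  qed
  have q: "max 0 s < q n s" "q n s \<le> max 0 s + 1 / real (Suc n)" for n s
    unfolding q_def using dyadic[of "real (Suc n)" "max 0 s"] by (simp_all only: of_nat_0_less_iff zero_less_Suc)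
  have q_lim: "filterlim (\<lambda>n. q n s) (at_right (max 0 s)) sequentially" for s
  proof -
    have "(\<lambda>n. max 0 s + 1 / real (Suc n)) \<longlonglongrightarrow> max 0 s + 0"
      unfolding inverse_eq_divide[symmetric] by (rule tendsto_add[OF tendsto_const LIMSEQ_inverse_real_of_nat])
    then have "(\<lambda>n. q n s) \<longlonglongrightarrow> max 0 s"
      unfolding add_0_right
      by (rule tendsto_sandwich[OF always_eventually always_eventually tendsto_const, rotated 2])
        (use q in \<open>auto intro: less_imp_le\<close>)
    then show ?thesis
      unfolding filterlim_at using q(1) by (simp add: less_imp_neq[symmetric])
  qed
  have Xq: "(\<lambda>(s, \<omega>). X (q n s) \<omega>) \<in> borel \<Otimes>\<^sub>M ?P \<rightarrow>\<^sub>M Delta_borel" for n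
  proof -
    \<comment> \<open>The outer clamp makes the piece belonging to a negative integer a coordinate
      at a nonnegative time; it changes nothing, since q is positive.\<close>
    have "(\<lambda>z. X (max 0 (of_int (\<lfloor>real (Suc n) * max 0 (fst z)\<rfloor> + 1) / real (Suc n))) (snd z)) \<in> borel \<Otimes>\<^sub>M ?P \<rightarrow>\<^sub>M Delta_borel"
    proof (rule measurable_compose_countable[where g="\<lambda>z. \<lfloor>real (Suc n) * max 0 (fst z)\<rfloor>"
          and f="\<lambda>i z. X (max 0 (of_int (i + 1) / real (Suc n))) (snd z)"])
      fix i :: int
      have "X (max 0 (of_int (i + 1) / real (Suc n))) \<in> ?P \<rightarrow>\<^sub>M Delta_borel" by (intro X_past_measurable) auto
      then show "(\<lambda>z. X (max 0 (of_int (i + 1) / real (Suc n))) (snd z)) \<in> borel \<Otimes>\<^sub>M ?P \<rightarrow>\<^sub>M Delta_borel"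
        by (rule measurable_compose[OF measurable_snd])
    next
      have "(\<lambda>s. \<lfloor>real (Suc n) * max 0 s\<rfloor>) \<in> borel \<rightarrow>\<^sub>M count_space UNIV" by measurable
      then show "(\<lambda>z. \<lfloor>real (Suc n) * max 0 (fst z)\<rfloor>) \<in> borel \<Otimes>\<^sub>M ?P \<rightarrow>\<^sub>M count_space UNIV"
        by (rule measurable_compose[OF measurable_fst])
    qed
    then have "(\<lambda>z. X (max 0 (q n (fst z))) (snd z)) \<in> borel \<Otimes>\<^sub>M ?P \<rightarrow>\<^sub>M Delta_borel"
      unfolding q_def .
    moreover have "max 0 (q n s) = q n s" for s using q(1)[of s n] by linarith
    ultimately show ?thesis by (simp add: case_prod_unfold)
  qed
  \<comment> \<open>Forward, the limit lies in the interior of a later compact set, which is open.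
    Backward, the complement of a compact set, together with \<open>None\<close>, is open in the
    compactification, so a limit outside the compact set would pull the approximations out of
    it.\<close>
  have open_iff: "X (max 0 s) \<omega> \<in> Some ` V \<longleftrightarrow> (\<exists>j N. \<forall>n\<ge>N. X (q n s) \<omega> \<in> Some ` C j)"
    if \<omega>: "\<omega> \<in> space F" and C: "\<And>n. compact (C n)" "\<And>n. C n \<subseteq> V"
      "\<And>n. C n \<subseteq> interior (C (Suc n))" "(\<Union>n. C n) = V" for V :: "(real^'n) set" and C :: "nat \<Rightarrow> (real^'n) set" and s \<omega>
  proof -
    have "limitin Delta_top (\<lambda>s. X s \<omega>) (X (max 0 s) \<omega>) (at_right (max 0 s))"
      using right_continuous[OF \<omega>, of "max 0 s"] by simp
    then have lim: "\<forall>\<^sub>F n in sequentially. X (q n s) \<omega> \<in> W" if "openin Delta_top W" "X (max 0 s) \<omega> \<in> W" for W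
      using that q_lim[of s] unfolding limitin_def filterlim_iff by blast
    show ?thesis
    proof
      assume "X (max 0 s) \<omega> \<in> Some ` V"
      then obtain j where "X (max 0 s) \<omega> \<in> Some ` C j" using C(4) by auto
      then have "X (max 0 s) \<omega> \<in> Some ` interior (C (Suc j))" using C(3) by blast
      then have "\<forall>\<^sub>F n in sequentially. X (q n s) \<omega> \<in> Some ` interior (C (Suc j))"
        by (intro lim) (auto simp: openin_Delta_top)
      then have "\<forall>\<^sub>F n in sequentially. X (q n s) \<omega> \<in> Some ` C (Suc j)"
        by eventually_elim (use interior_subset in blast)
      then show "\<exists>j N. \<forall>n\<ge>N. X (q n s) \<omega> \<in> Some ` C j" by (auto simp: eventually_sequentially)
    next
      assume "\<exists>j N. \<forall>n\<ge>N. X (q n s) \<omega> \<in> Some ` C j"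
      then obtain j N where j: "\<And>n. n \<ge> N \<Longrightarrow> X (q n s) \<omega> \<in> Some ` C j" by blast
      have "X (max 0 s) \<omega> \<in> Some ` C j"
      proof (rule ccontr)
        assume "X (max 0 s) \<omega> \<notin> Some ` C j"
        then have "X (max 0 s) \<omega> \<in> insert None (Some ` (- C j))" by (cases "X (max 0 s) \<omega>") auto
        then have "\<forall>\<^sub>F n in sequentially. X (q n s) \<omega> \<in> insert None (Some ` (- C j))"
          using C(1) by (intro lim) (auto simp: openin_Delta_top)
        then obtain n where "n \<ge> N" "X (q n s) \<omega> \<in> insert None (Some ` (- C j))"
          unfolding eventually_sequentially by (meson nle_le)
        then show False using j[of n] by auto
      qed
      then show "X (max 0 s) \<omega> \<in> Some ` V" using C(2) by blast
    qed
  qed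
  have open_sets: "(\<lambda>(s, \<omega>). X (max 0 s) \<omega>) -` (Some ` V) \<inter> space (borel \<Otimes>\<^sub>M ?P) \<in> sets (borel \<Otimes>\<^sub>M ?P)" if "open V" for V
  proof (rule open_Union_compact_subsets[OF that])
    fix C assume C: "\<And>n. compact (C n)" "\<And>n. C n \<subseteq> V" "\<And>n. C n \<subseteq> interior (C (Suc n))" "\<Union>(range C) = V"
    have oi: "X (max 0 s) \<omega> \<in> Some ` V \<longleftrightarrow> (\<exists>j N. \<forall>n\<ge>N. X (q n s) \<omega> \<in> Some ` C j)" if "\<omega> \<in> space F" for s \<omega>
      by (intro open_iff that C)
    have "(\<lambda>(s, \<omega>). X (max 0 s) \<omega>) -` (Some ` V) \<inter> space (borel \<Otimes>\<^sub>M ?P) =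
      {z \<in> space (borel \<Otimes>\<^sub>M ?P). \<exists>j N. \<forall>n. N \<le> n \<longrightarrow> X (q n (fst z)) (snd z) \<in> Some ` C j}"
    proof (intro set_eqI)
      fix z :: "real \<times> 'w"
      obtain s \<omega> where z: "z = (s, \<omega>)" by (cases z)
      show "z \<in> (\<lambda>(s, \<omega>). X (max 0 s) \<omega>) -` (Some ` V) \<inter> space (borel \<Otimes>\<^sub>M ?P) \<longleftrightarrow>
        z \<in> {z \<in> space (borel \<Otimes>\<^sub>M ?P). \<exists>j N. \<forall>n. N \<le> n \<longrightarrow> X (q n (fst z)) (snd z) \<in> Some ` C j}"
        unfolding z by (cases "\<omega> \<in> space F") (use oi[of \<omega> s] in \<open>simp_all add: space_pair_measure space_past\<close>)
    qed
    also have "\<dots> \<in> sets (borel \<Otimes>\<^sub>M ?P)"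
    proof -
      have "{z \<in> space (borel \<Otimes>\<^sub>M ?P). X (q n (fst z)) (snd z) \<in> Some ` C j} \<in> sets (borel \<Otimes>\<^sub>M ?P)" for n j
      proof -
        have "{z \<in> space (borel \<Otimes>\<^sub>M ?P). X (q n (fst z)) (snd z) \<in> Some ` C j} =
            (\<lambda>(s, \<omega>). X (q n s) \<omega>) -` (Some ` C j) \<inter> space (borel \<Otimes>\<^sub>M ?P)"
          unfolding case_prod_unfold by blast
        then show ?thesis
          using measurable_sets[OF Xq[of n] Some_image_Delta_borel[OF borel_compact[OF C(1)[of j]]]] by simp
      qed
      then show ?thesis
        by (intro sets.sets_Collect_countable_Ex sets.sets_Collect_countable_All sets.sets_Collect_imp
            sets.sets_Collect_const)
    qed
    finally show "(\<lambda>(s, \<omega>). X (max 0 s) \<omega>) -` (Some ` V) \<inter> space (borel \<Otimes>\<^sub>M ?P) \<in> sets (borel \<Otimes>\<^sub>M ?P)" .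
  qed
  show ?thesis
    unfolding Delta_borel_def
  proof (rule measurable_measure_of)
    fix W :: "(real^'n) option set" assume "W \<in> {U. openin Delta_top U}"
    then consider U where "open U" "W = Some ` U" | C where "compact C" "W = insert None (Some ` (- C))"
      by (auto simp: openin_Delta_top)
    then show "(\<lambda>(s, \<omega>). X (max 0 s) \<omega>) -` W \<inter> space (borel \<Otimes>\<^sub>M ?P) \<in> sets (borel \<Otimes>\<^sub>M ?P)"
    proof cases
      case 1
      then show ?thesis using open_sets by simp
    next
      case 2
      \<comment> \<open>A neighbourhood of \<open>None\<close> is expressed by open subsets of the
        space only, for which measurability is already known.\<close>
      have "W = UNIV - (Some ` UNIV - Some ` (- C))"
        unfolding 2 by (auto simp: UNIV_option_conv)
      then have "(\<lambda>(s, \<omega>). X (max 0 s) \<omega>) -` W \<inter> space (borel \<Otimes>\<^sub>M ?P) = space (borel \<Otimes>\<^sub>M ?P) -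
        (((\<lambda>(s, \<omega>). X (max 0 s) \<omega>) -` (Some ` UNIV) \<inter> space (borel \<Otimes>\<^sub>M ?P)) -
         ((\<lambda>(s, \<omega>). X (max 0 s) \<omega>) -` (Some ` (- C)) \<inter> space (borel \<Otimes>\<^sub>M ?P)))"
        by blast
      also have "\<dots> \<in> sets (borel \<Otimes>\<^sub>M ?P)"
        using open_sets[of UNIV] open_sets[of "- C"] 2(1)
        by (intro sets.Diff sets.top) (auto simp: compact_imp_closed open_Compl)
      finally show ?thesis .
    qed
  qed auto
qed

end

text \<open>As densities, h and h' define the same measure on the smaller sigma-algebra. This passes
  from events to all nonnegative Z without an approximation by simple functions.\<close>

lemma nn_integral_subalgebra_cong:
  assumes sub: "subalgebra M N" and h: "h \<in> borel_measurable M" "h' \<in> borel_measurable M"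
    and eq: "\<And>\<Gamma>. \<Gamma> \<in> sets N \<Longrightarrow> (\<integral>\<^sup>+x. indicator \<Gamma> x * h x \<partial>M) = (\<integral>\<^sup>+x. indicator \<Gamma> x * h' x \<partial>M)"
    and Z: "Z \<in> borel_measurable N"
  shows "(\<integral>\<^sup>+x. Z x * h x \<partial>M) = (\<integral>\<^sup>+x. Z x * h' x \<partial>M)"
proof -
  have sub': "subalgebra (density M f) N" for f using sub unfolding subalgebra_def by simp
  have Z': "Z \<in> borel_measurable M" by (rule measurable_from_subalg[OF sub Z])
  have "restr_to_subalg (density M h) N = restr_to_subalg (density M h') N"
  proof (rule measure_eqI)
    fix A assume "A \<in> sets (restr_to_subalg (density M h) N)"
    then have A: "A \<in> sets N" by (simp add: sets_restr_to_subalg[OF sub'])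
    then have "A \<in> sets M" using sub unfolding subalgebra_def by auto
    then show "emeasure (restr_to_subalg (density M h) N) A = emeasure (restr_to_subalg (density M h') N) A"
      using eq[OF A] h by (simp add: emeasure_restr_to_subalg[OF sub' A] emeasure_density mult.commute)
  qed (simp add: sets_restr_to_subalg[OF sub'])
  then have "(\<integral>\<^sup>+x. Z x \<partial>density M h) = (\<integral>\<^sup>+x. Z x \<partial>density M h')"
    using nn_integral_subalgebra2[OF sub'[of h] Z] nn_integral_subalgebra2[OF sub'[of h'] Z] by simp
  then show ?thesis
    using nn_integral_density[OF h(1) Z'] nn_integral_density[OF h(2) Z'] by (simp add: mult.commute)
qed

section \<open>Transition kernels and the Markov property for functions\<close>

context right_proc
begin

definition K :: "real \<Rightarrow> (real^'n) option \<Rightarrow> (real^'n) option measure" where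
  "K t z = distr (Pr z) Delta_borel (X t)"

text \<open>On all of \<open>F\<close> the laws depend on the starting point in a universally
  measurable way only; restricted to the events generated by the coordinates they form a Borel
  kernel.\<close>

definition path_kernel :: "(real^'n) option \<Rightarrow> 'w measure" where
  "path_kernel z = restr_to_subalg (Pr z) (past F X {0..})"

lemma sets_K [simp]: "sets (K t z) = sets Delta_borel"
  and space_K [simp]: "space (K t z) = UNIV"
  unfolding K_def by simp_all

lemma X_measurable_Pr: "0 \<le> t \<Longrightarrow> X t \<in> Pr z \<rightarrow>\<^sub>M Delta_borel"
  unfolding measurable_Pr by (rule X_measurable)

lemma prob_K: "0 \<le> t \<Longrightarrow> prob_space (K t z)"
  unfolding K_def by (intro prob_space.prob_space_distr prob_Pr X_measurable_Pr)

lemma X_event: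
  assumes "0 \<le> t" "A \<in> sets Delta_borel"
  shows "{\<omega>\<in>space F. X t \<omega> \<in> A} \<in> sets (past F X {0..})"
proof -
  have "{\<omega>\<in>space F. X t \<omega> \<in> A} = X t -` A \<inter> space (past F X {0..})"
    unfolding space_past by blast
  then show ?thesis using measurable_sets[OF X_past_measurable[of t "{0..}"] assms(2)] assms(1) by simp
qed

lemma X_event_F: "0 \<le> t \<Longrightarrow> A \<in> sets Delta_borel \<Longrightarrow> {\<omega>\<in>space F. X t \<omega> \<in> A} \<in> sets F"
  using X_event sets_past_subset[of "{0..}"] by blast

lemma emeasure_K:
  assumes "0 \<le> t" "A \<in> sets Delta_borel"
  shows "emeasure (K t z) A = emeasure (Pr z) {\<omega>\<in>space F. X t \<omega> \<in> A}"
proof -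
  have "X t -` A \<inter> space (Pr z) = {\<omega>\<in>space F. X t \<omega> \<in> A}" unfolding space_Pr by blast
  then show ?thesis unfolding K_def using assms by (simp add: emeasure_distr X_measurable_Pr)
qed

lemma K_measurable: "0 \<le> t \<Longrightarrow> K t \<in> Delta_borel \<rightarrow>\<^sub>M subprob_algebra Delta_borel"
proof (rule measurable_subprob_algebra)
  fix A assume "0 \<le> t" "A \<in> sets (Delta_borel :: (real^'n) option measure)"
  then show "(\<lambda>z. emeasure (K t z) A) \<in> borel_measurable Delta_borel"
    using Borel_measurable[OF X_event] by (simp add: emeasure_K)
qed (auto intro: prob_space_imp_subprob_space prob_K)

lemma nn_integral_K_measurable:
  "0 \<le> t \<Longrightarrow> f \<in> borel_measurable Delta_borel \<Longrightarrow> (\<lambda>z. \<integral>\<^sup>+y. f y \<partial>K t z) \<in> borel_measurable Delta_borel"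
  by (rule measurable_compose[OF K_measurable nn_integral_measurable_subprob_algebra])

lemma nn_integral_K:
  "0 \<le> t \<Longrightarrow> f \<in> borel_measurable Delta_borel \<Longrightarrow> (\<integral>\<^sup>+y. f y \<partial>K t z) = (\<integral>\<^sup>+\<omega>. f (X t \<omega>) \<partial>Pr z)"
  unfolding K_def by (subst nn_integral_distr) (simp_all add: X_measurable_Pr)

lemma sets_path_kernel [simp]: "sets (path_kernel z) = sets (past F X {0..})"
  unfolding path_kernel_def by (rule sets_restr_to_subalg[OF subalgebra_past])

lemma path_kernel_measurable: "path_kernel \<in> Delta_borel \<rightarrow>\<^sub>M subprob_algebra (past F X {0..})"
proof (rule measurable_subprob_algebra)
  fix z
  have "emeasure (path_kernel z) (space (path_kernel z)) = emeasure (Pr z) (space (Pr z))"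
    unfolding path_kernel_def
    using emeasure_restr_to_subalg[OF subalgebra_past sets.top, of z]
    by (simp add: space_restr_to_subalg space_past space_Pr)
  then show "subprob_space (path_kernel z)"
    using prob_space.emeasure_space_1[OF prob_Pr] by (intro prob_space_imp_subprob_space prob_spaceI) simp
next
  fix A assume A: "A \<in> sets (past F X {0..})"
  show "(\<lambda>z. emeasure (path_kernel z) A) \<in> borel_measurable Delta_borel"
    unfolding path_kernel_def emeasure_restr_to_subalg[OF subalgebra_past A] by (rule Borel_measurable[OF A])
qed simp

text \<open>The indicator of X s \<in> A is jointly measurable in time and path, and integrating it
  against the Borel kernel \<open>path_kernel\<close> preserves joint measurability.\<close>

lemma K_jointly_measurable:
  assumes A: "A \<in> sets Delta_borel"
  shows "(\<lambda>(t, z). emeasure (K (max 0 t) z) A) \<in> borel_measurable (borel \<Otimes>\<^sub>M Delta_borel)"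
proof -
  let ?P = "past F X {0..}"
  have "(\<lambda>(s, \<omega>). indicator A (X (max 0 s) \<omega>) :: ennreal) \<in> borel_measurable (borel \<Otimes>\<^sub>M ?P)"
    using measurable_compose[OF jointly_measurable borel_measurable_indicator[OF A]]
    by (simp add: case_prod_unfold)
  note ind = this
  have "(\<lambda>tz. (fst (fst tz), snd tz)) \<in> (borel \<Otimes>\<^sub>M Delta_borel) \<Otimes>\<^sub>M ?P \<rightarrow>\<^sub>M borel \<Otimes>\<^sub>M ?P"
    by measurable
  from measurable_compose[OF this ind]
  have "(\<lambda>(tz, \<omega>). indicator A (X (max 0 (fst tz)) \<omega>) :: ennreal)
      \<in> borel_measurable ((borel \<Otimes>\<^sub>M (Delta_borel :: (real^'n) option measure)) \<Otimes>\<^sub>M ?P)"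
    by (simp add: case_prod_unfold)
  from nn_integral_measurable_subprob_algebra2[OF this measurable_compose[OF measurable_snd path_kernel_measurable]]
  have "(\<lambda>tz. \<integral>\<^sup>+\<omega>. indicator A (X (max 0 (fst tz)) \<omega>) \<partial>path_kernel (snd tz))
      \<in> borel_measurable (borel \<Otimes>\<^sub>M Delta_borel)" .
  also have "(\<lambda>tz. \<integral>\<^sup>+\<omega>. indicator A (X (max 0 (fst tz)) \<omega>) \<partial>path_kernel (snd tz)) =
      (\<lambda>(t, z). emeasure (K (max 0 t) z) A)"
  proof (rule ext)
    fix tz :: "real \<times> (real^'n) option"
    have "(\<integral>\<^sup>+\<omega>. indicator A (X (max 0 (fst tz)) \<omega>) \<partial>path_kernel (snd tz)) =
        (\<integral>\<^sup>+\<omega>. indicator A (X (max 0 (fst tz)) \<omega>) \<partial>Pr (snd tz))"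
      unfolding path_kernel_def
      by (intro nn_integral_subalgebra2[OF subalgebra_past]
          measurable_compose[OF X_past_measurable borel_measurable_indicator[OF A]]) simp
    also have "\<dots> = (\<integral>\<^sup>+y. indicator A y \<partial>K (max 0 (fst tz)) (snd tz))"
      by (intro nn_integral_K[symmetric] borel_measurable_indicator A) simp
    finally show "(\<integral>\<^sup>+\<omega>. indicator A (X (max 0 (fst tz)) \<omega>) \<partial>path_kernel (snd tz)) =
      (\<lambda>(t, z). emeasure (K (max 0 t) z) A) tz" using A by (simp add: case_prod_unfold)
  qed
  finally show ?thesis .
qed

text \<open>The Markov property is given through real conditional expectations. Integrated over an
  event of \<open>Ft s\<close>, it becomes an identity of nonnegative integrals, which extends to
  functions without integrability conditions.\<close>

lemma markov_event:
  assumes s: "0 \<le> s" and t: "0 \<le> t" and A: "A \<in> sets Delta_borel" and \<Gamma>: "\<Gamma> \<in> sets (Ft s)"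
  shows "(\<integral>\<^sup>+\<omega>. indicator \<Gamma> \<omega> * indicator A (X (s + t) \<omega>) \<partial>Pr z) =
    (\<integral>\<^sup>+\<omega>. indicator \<Gamma> \<omega> * emeasure (K t (X s \<omega>)) A \<partial>Pr z)"
proof -
  interpret prob_space "Pr z" by (rule prob_Pr)
  interpret finite_measure_subalgebra "Pr z" "Ft s"
    by unfold_locales (rule subalgebra_Ft[OF s])
  let ?E = "{\<omega>\<in>space F. X (s + t) \<omega> \<in> A}"
  let ?h = "\<lambda>\<omega>. measure (Pr (X s \<omega>)) {\<omega>'\<in>space F. X t \<omega>' \<in> A}"
  have E: "?E \<in> sets (Pr z)" using X_event_F[of "s + t" A] s t A by (simp add: sets_Pr)
  have \<Gamma>': "\<Gamma> \<in> sets (Pr z)" using \<Gamma> sets_Ft[OF s] by (auto simp: sets_Pr)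
  have h: "?h \<omega> = measure (K t (X s \<omega>)) A" for \<omega>
    unfolding measure_def using t A by (simp add: emeasure_K)
  have emK: "emeasure (K t y) A = ennreal (measure (K t y) A)" for y
    using prob_space.finite_measure[OF prob_K[OF t]] by (simp add: finite_measure.emeasure_eq_measure)
  have meas: "(\<lambda>\<omega>. measure (K t (X s \<omega>)) A) \<in> borel_measurable (Pr z)"
    by (intro measurable_compose[OF X_measurable_Pr[OF s]] measurable_compose[OF K_measurable[OF t]]
       measurable_measure_subprob_algebra A)
  have int: "integrable (Pr z) (indicator ?E :: _ \<Rightarrow> real)"
    using E by (intro integrable_real_indicator) (auto simp: emeasure_eq_measure)
  have bd: "measure (K t y) A \<le> 1" for y using prob_space.prob_le_1[OF prob_K[OF t]] .
  have "(LINT \<omega>:\<Gamma>|Pr z. indicator ?E \<omega>) = (LINT \<omega>:\<Gamma>|Pr z. real_cond_exp (Pr z) (Ft s) (indicator ?E) \<omega>)"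
    by (rule real_cond_exp_intA[OF int \<Gamma>])
  also have "\<dots> = (LINT \<omega>:\<Gamma>|Pr z. measure (K t (X s \<omega>)) A)"
    unfolding set_lebesgue_integral_def
  proof (rule integral_cong_AE)
    show "AE \<omega> in Pr z. indicator \<Gamma> \<omega> *\<^sub>R real_cond_exp (Pr z) (Ft s) (indicator ?E) \<omega> =
        indicator \<Gamma> \<omega> *\<^sub>R measure (K t (X s \<omega>)) A"
      using markov_property[OF A s t] unfolding h by eventually_elim simp
    show "(\<lambda>\<omega>. indicator \<Gamma> \<omega> *\<^sub>R measure (K t (X s \<omega>)) A) \<in> borel_measurable (Pr z)"
      using meas \<Gamma>' by simp
  qed (use \<Gamma>' in simp)
  finally have eq: "(LINT \<omega>|Pr z. indicator \<Gamma> \<omega> * indicator ?E \<omega>) = (LINT \<omega>|Pr z. indicator \<Gamma> \<omega> * measure (K t (X s \<omega>)) A)"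
    by (simp add: set_lebesgue_integral_def)
  have "(\<integral>\<^sup>+\<omega>. indicator \<Gamma> \<omega> * indicator A (X (s + t) \<omega>) \<partial>Pr z) = (\<integral>\<^sup>+\<omega>. ennreal (indicator \<Gamma> \<omega> * indicator ?E \<omega>) \<partial>Pr z)"
    by (intro nn_integral_cong) (auto simp: space_Pr split: split_indicator)
  also have "\<dots> = ennreal (LINT \<omega>|Pr z. indicator \<Gamma> \<omega> * indicator ?E \<omega>)"
    using \<Gamma>' E by (intro nn_integral_eq_integral integrable_const_bound[where B=1]) (auto split: split_indicator)
  also have "\<dots> = (\<integral>\<^sup>+\<omega>. ennreal (indicator \<Gamma> \<omega> * measure (K t (X s \<omega>)) A) \<partial>Pr z)"
    unfolding eq using \<Gamma>' meas bd
    by (intro nn_integral_eq_integral[symmetric] integrable_const_bound[where B=1]) (auto split: split_indicator)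
  also have "\<dots> = (\<integral>\<^sup>+\<omega>. indicator \<Gamma> \<omega> * emeasure (K t (X s \<omega>)) A \<partial>Pr z)"
    unfolding emK by (intro nn_integral_cong) (auto split: split_indicator)
  finally show ?thesis .
qed

text \<open>With Z absorbed into the measure as a density, the claim is that two laws on the
  compactified space coincide. On sets this is \<open>markov_event\<close>, carried from events to Z
  by \<open>nn_integral_subalgebra_cong\<close>.\<close>

lemma markov_function:
  assumes s: "0 \<le> s" and t: "0 \<le> t" and f: "f \<in> borel_measurable Delta_borel"
    and Z: "Z \<in> borel_measurable (Ft s)"
  shows "(\<integral>\<^sup>+\<omega>. Z \<omega> * f (X (s + t) \<omega>) \<partial>Pr z) = (\<integral>\<^sup>+\<omega>. Z \<omega> * (\<integral>\<^sup>+y. f y \<partial>K t (X s \<omega>)) \<partial>Pr z)"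
proof -
  let ?Q = "density (Pr z) Z"
  have Z': "Z \<in> borel_measurable (Pr z)" by (rule measurable_from_subalg[OF subalgebra_Ft[OF s] Z])
  have ne: "space ?Q \<noteq> {}" using prob_space.not_empty[OF prob_Pr] by simp
  have Xm: "X (s + t) \<in> Pr z \<rightarrow>\<^sub>M Delta_borel" using s t by (intro X_measurable_Pr) simp
  have KX: "(\<lambda>\<omega>. K t (X s \<omega>)) \<in> Pr z \<rightarrow>\<^sub>M subprob_algebra Delta_borel"
    by (rule measurable_compose[OF X_measurable_Pr[OF s] K_measurable[OF t]])
  then have KX': "(\<lambda>\<omega>. K t (X s \<omega>)) \<in> ?Q \<rightarrow>\<^sub>M subprob_algebra Delta_borel" by simp
  have "distr ?Q Delta_borel (X (s + t)) = ?Q \<bind> (\<lambda>\<omega>. K t (X s \<omega>))"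
  proof (rule measure_eqI)
    show "sets (distr ?Q Delta_borel (X (s + t))) = sets (?Q \<bind> (\<lambda>\<omega>. K t (X s \<omega>)))"
      using sets_bind[OF _ ne, of "\<lambda>\<omega>. K t (X s \<omega>)" Delta_borel] by simp
    fix A assume "A \<in> sets (distr ?Q Delta_borel (X (s + t)))"
    then have A: "A \<in> sets Delta_borel" by simp
    have iA: "(\<lambda>\<omega>. indicator A (X (s + t) \<omega>) :: ennreal) \<in> borel_measurable (Pr z)"
      by (rule measurable_compose[OF Xm borel_measurable_indicator[OF A]])
    have eA: "(\<lambda>\<omega>. emeasure (K t (X s \<omega>)) A) \<in> borel_measurable (Pr z)"
      by (rule measurable_compose[OF KX measurable_emeasure_subprob_algebra[OF A]])
    have "emeasure (distr ?Q Delta_borel (X (s + t))) A = (\<integral>\<^sup>+\<omega>. indicator A (X (s + t) \<omega>) \<partial>?Q)"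
      using A Xm nn_integral_distr[of "X (s + t)" ?Q Delta_borel "indicator A"] by simp
    also have "\<dots> = (\<integral>\<^sup>+\<omega>. Z \<omega> * indicator A (X (s + t) \<omega>) \<partial>Pr z)"
      by (rule nn_integral_density[OF Z' iA])
    also have "\<dots> = (\<integral>\<^sup>+\<omega>. Z \<omega> * emeasure (K t (X s \<omega>)) A \<partial>Pr z)"
      by (rule nn_integral_subalgebra_cong[OF subalgebra_Ft[OF s] iA eA markov_event[OF s t A] Z])
    also have "\<dots> = (\<integral>\<^sup>+\<omega>. emeasure (K t (X s \<omega>)) A \<partial>?Q)"
      by (rule nn_integral_density[OF Z' eA, symmetric])
    also have "\<dots> = emeasure (?Q \<bind> (\<lambda>\<omega>. K t (X s \<omega>))) A"
      by (rule emeasure_bind[OF ne KX' A, symmetric])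
    finally show "emeasure (distr ?Q Delta_borel (X (s + t))) A = emeasure (?Q \<bind> (\<lambda>\<omega>. K t (X s \<omega>))) A" .
  qed
  moreover have "(\<integral>\<^sup>+y. f y \<partial>distr ?Q Delta_borel (X (s + t))) = (\<integral>\<^sup>+\<omega>. f (X (s + t) \<omega>) \<partial>?Q)"
    using Xm f by (intro nn_integral_distr) simp_all
  ultimately have "(\<integral>\<^sup>+\<omega>. f (X (s + t) \<omega>) \<partial>?Q) = (\<integral>\<^sup>+\<omega>. (\<integral>\<^sup>+y. f y \<partial>K t (X s \<omega>)) \<partial>?Q)"
    using nn_integral_bind[OF f KX'] by simp
  then show ?thesis
    using nn_integral_density[OF Z' measurable_compose[OF Xm f]]
      nn_integral_density[OF Z' measurable_compose[OF X_measurable_Pr[OF s] nn_integral_K_measurable[OF t f]]]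
    by simp
qed

lemma K_add:
  assumes "0 \<le> s" "0 \<le> t" "f \<in> borel_measurable Delta_borel"
  shows "(\<integral>\<^sup>+y. f y \<partial>K (s + t) z) = (\<integral>\<^sup>+y. \<integral>\<^sup>+y'. f y' \<partial>K t y \<partial>K s z)"
proof -
  have "(\<integral>\<^sup>+y. f y \<partial>K (s + t) z) = (\<integral>\<^sup>+\<omega>. 1 * f (X (s + t) \<omega>) \<partial>Pr z)"
    using assms by (simp add: nn_integral_K)
  also have "\<dots> = (\<integral>\<^sup>+\<omega>. 1 * (\<integral>\<^sup>+y. f y \<partial>K t (X s \<omega>)) \<partial>Pr z)"
    using assms by (intro markov_function) auto
  also have "\<dots> = (\<integral>\<^sup>+y. \<integral>\<^sup>+y'. f y' \<partial>K t y \<partial>K s z)"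
    using assms nn_integral_K_measurable[OF assms(2,3)] by (simp add: nn_integral_K[of s])
  finally show ?thesis .
qed

lemma K_0: "K 0 z = return Delta_borel z"
proof (rule measure_eqI)
  fix A assume "A \<in> sets (K 0 z)"
  then have A: "A \<in> sets Delta_borel" by simp
  have "emeasure (K 0 z) A = (\<integral>\<^sup>+\<omega>. indicator A (X 0 \<omega>) \<partial>Pr z)"
    using nn_integral_K[of 0 "indicator A" z] A by simp
  also have "\<dots> = (\<integral>\<^sup>+\<omega>. indicator A z \<partial>Pr z)"
    using normal[of z] by (intro nn_integral_cong_AE, eventually_elim) simp
  also have "\<dots> = indicator A z" using prob_space.emeasure_space_1[OF prob_Pr] by simp
  finally show "emeasure (K 0 z) A = emeasure (return Delta_borel z) A" using A by simp
qed simp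

text \<open>A path that is dead at time 0 has lifetime 0 and hence is dead at all later times; by
  normality almost every path started at \<open>None\<close> is of this kind.\<close>

lemma K_None:
  assumes t: "0 \<le> t"
  shows "K t None = return Delta_borel None"
proof (rule measure_eqI)
  fix A assume "A \<in> sets (K t None)"
  then have A: "A \<in> sets Delta_borel" by simp
  obtain \<zeta> where z: "\<And>\<omega> t. \<omega> \<in> space F \<Longrightarrow> 0 \<le> t \<Longrightarrow> X t \<omega> = None \<longleftrightarrow> \<zeta> \<omega> \<le> ennreal t"
    using lifetime by blast
  have dead: "X t \<omega> = None" if "\<omega> \<in> space F" "X 0 \<omega> = None" for \<omega>
  proof -
    have "\<zeta> \<omega> \<le> ennreal 0" using z[OF that(1) order_refl] that(2) by blast
    then have "\<zeta> \<omega> \<le> ennreal t" using t by simp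
    then show ?thesis using z[OF that(1) t] by blast
  qed
  have "emeasure (K t None) A = (\<integral>\<^sup>+\<omega>. indicator A (X t \<omega>) \<partial>Pr None)"
    using nn_integral_K[of t "indicator A" None] A t by simp
  also have "\<dots> = (\<integral>\<^sup>+\<omega>. indicator A None \<partial>Pr None)"
    using normal[of None] AE_space[of "Pr None"]
    by (intro nn_integral_cong_AE, eventually_elim) (simp add: space_Pr dead)
  also have "\<dots> = indicator A None" using prob_space.emeasure_space_1[OF prob_Pr] by simp
  finally show "emeasure (K t None) A = emeasure (return Delta_borel None) A" using A by simp
qed simp

end

section \<open>Strong continuity\<close>

context subinvariant_kernels
begin

definition strongly_continuous_at :: "('a \<Rightarrow> real) \<Rightarrow> bool" where
  "strongly_continuous_at f \<longleftrightarrow> integrable m f \<and> ((\<lambda>t. LINT x|m. \<bar>p t f x - f x\<bar>) \<longlongrightarrow> 0) (at_right 0)"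

lemma strongly_continuous_at_linear:
  assumes f: "strongly_continuous_at f" and g: "strongly_continuous_at g"
  shows "strongly_continuous_at (\<lambda>x. a * f x + b * g x)"
proof -
  have i: "integrable m f" "integrable m g"
    and l: "((\<lambda>t. LINT x|m. \<bar>p t f x - f x\<bar>) \<longlongrightarrow> 0) (at_right 0)"
      "((\<lambda>t. LINT x|m. \<bar>p t g x - g x\<bar>) \<longlongrightarrow> 0) (at_right 0)"
    using f g unfolding strongly_continuous_at_def by auto
  have lim: "((\<lambda>t. \<bar>a\<bar> * (LINT x|m. \<bar>p t f x - f x\<bar>) + \<bar>b\<bar> * (LINT x|m. \<bar>p t g x - g x\<bar>)) \<longlongrightarrow> 0) (at_right 0)"
    using tendsto_add[OF tendsto_mult_left[OF l(1), of "\<bar>a\<bar>"] tendsto_mult_left[OF l(2), of "\<bar>b\<bar>"]] by simp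
  have bound: "(LINT x|m. \<bar>p t (\<lambda>x. a * f x + b * g x) x - (a * f x + b * g x)\<bar>) \<le>
      \<bar>a\<bar> * (LINT x|m. \<bar>p t f x - f x\<bar>) + \<bar>b\<bar> * (LINT x|m. \<bar>p t g x - g x\<bar>)" if t: "0 < t" for t
  proof -
    have d: "integrable m (\<lambda>x. p t f x - f x)" "integrable m (\<lambda>x. p t g x - g x)"
      using i t p_integrable by auto
    have "(LINT x|m. \<bar>p t (\<lambda>x. a * f x + b * g x) x - (a * f x + b * g x)\<bar>) =
       (LINT x|m. \<bar>a * (p t f x - f x) + b * (p t g x - g x)\<bar>)"
    proof (rule integral_cong_AE)
      show "AE x in m. \<bar>p t (\<lambda>x. a * f x + b * g x) x - (a * f x + b * g x)\<bar> =
          \<bar>a * (p t f x - f x) + b * (p t g x - g x)\<bar>"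
        using p_linear_AE[OF less_imp_le[OF t] i, of a b]
        by eventually_elim (simp add: algebra_simps)
      show "(\<lambda>x. \<bar>p t (\<lambda>x. a * f x + b * g x) x - (a * f x + b * g x)\<bar>) \<in> borel_measurable m"
        "(\<lambda>x. \<bar>a * (p t f x - f x) + b * (p t g x - g x)\<bar>) \<in> borel_measurable m"
        using i p_measurable by auto
    qed
    also have "\<dots> \<le> (LINT x|m. \<bar>a * (p t f x - f x)\<bar>) + (LINT x|m. \<bar>b * (p t g x - g x)\<bar>)"
      using d by (intro L1_add_le) auto
    finally show ?thesis by (simp add: abs_mult)
  qed
  have ev: "\<forall>\<^sub>F t in at_right 0. (LINT x|m. \<bar>p t (\<lambda>x. a * f x + b * g x) x - (a * f x + b * g x)\<bar>) \<le>
      \<bar>a\<bar> * (LINT x|m. \<bar>p t f x - f x\<bar>) + \<bar>b\<bar> * (LINT x|m. \<bar>p t g x - g x\<bar>)"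
    using eventually_at_right_less[of 0] by eventually_elim (rule bound)
  have "((\<lambda>t. LINT x|m. \<bar>p t (\<lambda>x. a * f x + b * g x) x - (a * f x + b * g x)\<bar>) \<longlongrightarrow> 0) (at_right 0)"
    by (rule tendsto_sandwich[OF always_eventually ev tendsto_const lim]) simp
  then show ?thesis unfolding strongly_continuous_at_def using i by auto
qed

text \<open>Contractivity bounds the approximation error at time t by the one at time 0. So the
  error enters twice, uniformly in t, and one third of \<epsilon> remains for the approximating
  function.\<close>

lemma strongly_continuous_at_limit:
  assumes f: "integrable m f" and s: "\<And>n. strongly_continuous_at (s n)"
    and lim: "(\<lambda>n. LINT x|m. \<bar>s n x - f x\<bar>) \<longlonglongrightarrow> 0"
  shows "strongly_continuous_at f"
  unfolding strongly_continuous_at_def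
proof (intro conjI f tendstoI)
  fix \<epsilon> :: real assume e: "\<epsilon> > 0"
  have "\<forall>\<^sub>F n in sequentially. (LINT x|m. \<bar>s n x - f x\<bar>) < \<epsilon> / 3"
    using order_tendstoD(2)[OF lim, of "\<epsilon> / 3"] e by simp
  then obtain n where n: "(LINT x|m. \<bar>s n x - f x\<bar>) < \<epsilon> / 3"
    by (auto simp: eventually_sequentially)
  have si: "integrable m (s n)" and sl: "((\<lambda>t. LINT x|m. \<bar>p t (s n) x - s n x\<bar>) \<longlongrightarrow> 0) (at_right 0)"
    using s unfolding strongly_continuous_at_def by auto
  have "\<forall>\<^sub>F t in at_right 0. (LINT x|m. \<bar>p t (s n) x - s n x\<bar>) < \<epsilon> / 3"
    using order_tendstoD(2)[OF sl, of "\<epsilon> / 3"] e by simp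
  then show "\<forall>\<^sub>F t in at_right 0. dist (LINT x|m. \<bar>p t f x - f x\<bar>) 0 < \<epsilon>"
    using eventually_at_right_less[of 0]
  proof eventually_elim
    case (elim t)
    have pi: "integrable m (p t f)" "integrable m (p t (s n))" using elim(2) f si by (auto intro: p_integrable)
    have "(LINT x|m. \<bar>p t f x - f x\<bar>) \<le> (LINT x|m. \<bar>p t f x - p t (s n) x\<bar>) + (LINT x|m. \<bar>p t (s n) x - f x\<bar>)"
      by (rule L1_triangle[OF pi f])
    also have "(LINT x|m. \<bar>p t (s n) x - f x\<bar>) \<le> (LINT x|m. \<bar>p t (s n) x - s n x\<bar>) + (LINT x|m. \<bar>s n x - f x\<bar>)"
      by (rule L1_triangle[OF pi(2) si f])
    also have "(LINT x|m. \<bar>p t f x - p t (s n) x\<bar>) \<le> (LINT x|m. \<bar>f x - s n x\<bar>)"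
      using elim(2) by (intro p_L1_dist f si) simp
    also have "\<dots> = (LINT x|m. \<bar>s n x - f x\<bar>)" by (simp add: abs_minus_commute)
    finally have "(LINT x|m. \<bar>p t f x - f x\<bar>) < \<epsilon>" using n elim(1) by linarith
    then show ?case unfolding dist_real_def by (subst abs_of_nonneg) auto
  qed
qed

text \<open>The limits met below are pointwise and dominated: increasing unions of sets and
  approximation by simple functions.\<close>

lemma strongly_continuous_at_dominated:
  assumes f: "f \<in> borel_measurable m" and s: "\<And>n. strongly_continuous_at (s n)"
    and lim: "\<And>x. x \<in> space m \<Longrightarrow> (\<lambda>n. s n x) \<longlonglongrightarrow> f x"
    and h: "integrable m h" "\<And>n x. x \<in> space m \<Longrightarrow> \<bar>s n x\<bar> \<le> h x"
  shows "strongly_continuous_at f"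
proof -
  have si: "integrable m (s n)" for n using s unfolding strongly_continuous_at_def by auto
  have fh: "\<bar>f x\<bar> \<le> h x" if "x \<in> space m" for x
    by (rule LIMSEQ_le_const2[OF tendsto_rabs[OF lim[OF that]]]) (use h(2)[OF that] in auto)
  have fi: "integrable m f"
    by (rule Bochner_Integration.integrable_bound[OF h(1) f]) (use fh in \<open>auto intro!: AE_I2 order_trans[OF _ abs_ge_self]\<close>)
  have "(\<lambda>n. LINT x|m. \<bar>s n x - f x\<bar>) \<longlonglongrightarrow> (LINT x|m. 0)"
  proof (rule integral_dominated_convergence[where w="\<lambda>x. 2 * h x"])
    show "AE x in m. (\<lambda>n. \<bar>s n x - f x\<bar>) \<longlonglongrightarrow> 0"
      using lim by (intro AE_I2 tendsto_rabs_zero) (auto simp: LIM_zero_iff)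
    show "AE x in m. norm \<bar>s n x - f x\<bar> \<le> 2 * h x" for n
    proof (rule AE_I2)
      fix x assume x: "x \<in> space m"
      show "norm \<bar>s n x - f x\<bar> \<le> 2 * h x" using h(2)[OF x, of n] fh[OF x] by simp
    qed
  qed (use si fi h(1) in auto)
  then show ?thesis by (intro strongly_continuous_at_limit[OF fi s]) simp
qed

text \<open>A Dynkin argument over the intersection-stable generator \<open>G\<close>. It runs
  inside a set B n of finite measure, where indicators are integrable and complements become
  differences; the cut-off is removed afterwards.\<close>

lemma strongly_continuousI:
  assumes G: "sets m = sigma_sets (space m) G" "G \<subseteq> Pow (space m)" "Int_stable G"
    and B: "\<And>n. B n \<in> sets m" "\<And>n. emeasure m (B n) < \<infinity>" "incseq B" "(\<Union>n. B n) = space m"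
    and sc: "\<And>A n. A \<in> G \<Longrightarrow> strongly_continuous_at (indicator (A \<inter> B n))"
    and scB: "\<And>n. strongly_continuous_at (indicator (B n))"
    and f: "integrable m f"
  shows "strongly_continuous_at f"
proof -
  have B': "integrable m (indicator (B n) :: _ \<Rightarrow> real)" for n
    using B(1,2) by (intro integrable_real_indicator)
  have AB: "strongly_continuous_at (indicator (A \<inter> B n))" if "A \<in> sets m" for A n
  proof -
    have "A \<in> sigma_sets (space m) G" using that G(1) by simp
    with G(3) G(2) show ?thesis
    proof (induction rule: sigma_sets_induct_disjoint)
      case (basic A)
      then show ?case by (rule sc)
    next
      case empty
      show ?case using strongly_continuous_at_linear[OF scB[of n] scB[of n], of 0 0]
        by (simp add: indicator_def[abs_def])
    next
      case (compl A)
      have "indicator ((space m - A) \<inter> B n) = (\<lambda>x. 1 * indicator (B n) x + (-1) * indicator (A \<inter> B n) x :: real)"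
        using sets.sets_into_space[OF B(1)[of n]] by (auto simp: fun_eq_iff split: split_indicator)
      then show ?case using strongly_continuous_at_linear[OF scB[of n] compl(2), of 1 "-1"] by simp
    next
      case (union A)
      let ?s = "\<lambda>j x. indicator ((\<Union>i<j. A i) \<inter> B n) x :: real"
      have "A i \<in> sets m" for i using union(2) G(1) by auto
      then have um: "(\<Union>i. A i) \<in> sets m" by auto
      show ?case
      proof (rule strongly_continuous_at_dominated[where s="?s" and h="indicator (B n)"])
        show "indicator ((\<Union>i. A i) \<inter> B n) \<in> borel_measurable m" using um B(1) by simp
        show "integrable m (indicator (B n) :: _ \<Rightarrow> real)" by (rule B')
        show "\<bar>?s j x\<bar> \<le> indicator (B n) x" for j x by (auto split: split_indicator)
        show "(\<lambda>j. ?s j x) \<longlonglongrightarrow> indicator ((\<Union>i. A i) \<inter> B n) x" for x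
        proof (cases "x \<in> (\<Union>i. A i) \<inter> B n")
          case True
          then obtain i where i: "x \<in> A i" "x \<in> B n" by auto
          have "\<forall>\<^sub>F j in sequentially. ?s j x = indicator ((\<Union>i. A i) \<inter> B n) x"
            using eventually_gt_at_top[of i]
            by eventually_elim (use i in \<open>auto split: split_indicator\<close>)
          then show ?thesis by (rule tendsto_eventually)
        next
          case False
          then have "?s j x = indicator ((\<Union>i. A i) \<inter> B n) x" for j by (auto split: split_indicator)
          then show ?thesis by simp
        qed
        show "strongly_continuous_at (?s j)" for j
        proof (induction j)
          case 0
          show ?case using strongly_continuous_at_linear[OF scB[of n] scB[of n], of 0 0]
            by (simp add: indicator_def[abs_def])
        next
          case (Suc j)
          have disj: "(\<Union>i<j. A i) \<inter> A j = {}"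
            using disjoint_family_onD[OF union(1)] by (metis (no_types, lifting) Int_commute UNIV_I
              disjoint_iff UN_E lessThan_iff less_irrefl)
          have "?s (Suc j) x = 1 * ?s j x + 1 * indicator (A j \<inter> B n) x" for x
          proof -
            have "(\<Union>i<Suc j. A i) \<inter> B n = ((\<Union>i<j. A i) \<inter> B n) \<union> (A j \<inter> B n)"
              by (simp add: lessThan_Suc Int_Un_distrib2 Un_commute)
            moreover have "((\<Union>i<j. A i) \<inter> B n) \<inter> (A j \<inter> B n) = {}" using disj by blast
            ultimately show ?thesis by (simp only: indicator_add mult_1)
          qed
          then have "?s (Suc j) = (\<lambda>x. 1 * ?s j x + 1 * indicator (A j \<inter> B n) x)" by blast
          then show ?case using strongly_continuous_at_linear[OF Suc union(3)[of j], of 1 1] by simp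
        qed
      qed
    qed
  qed
  have fin: "strongly_continuous_at (indicator A)" if A: "A \<in> sets m" "emeasure m A < \<infinity>" for A
  proof (rule strongly_continuous_at_dominated[where s="\<lambda>n. indicator (A \<inter> B n)" and h="indicator A"])
    show "integrable m (indicator A :: _ \<Rightarrow> real)" using A by (intro integrable_real_indicator)
    show "(\<lambda>n. indicator (A \<inter> B n) x :: real) \<longlonglongrightarrow> indicator A x" if x: "x \<in> space m" for x
    proof -
      obtain i where i: "x \<in> B i" using x B(4) by auto
      have "\<forall>\<^sub>F n in sequentially. indicator (A \<inter> B n) x = (indicator A x :: real)"
        using eventually_ge_at_top[of i]
        by eventually_elim (use i B(3) in \<open>auto simp: incseq_def split: split_indicator\<close>)
      then show ?thesis by (rule tendsto_eventually)
    qed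
  qed (use A AB in \<open>auto split: split_indicator\<close>)
  show ?thesis
    using f
  proof (induction rule: integrable_induct)
    case (base A c)
    then show ?case
      using strongly_continuous_at_linear[OF fin[OF base(1,2)] fin[OF base(1,2)], of c 0] by (simp add: mult.commute)
  next
    case (add f g)
    then show ?case using strongly_continuous_at_linear[of f g 1 1] by simp
  next
    case (lim f s)
    show ?case
    proof (rule strongly_continuous_at_dominated[where s=s and h="\<lambda>x. 2 * norm (f x)"])
      show "f \<in> borel_measurable m" using lim(4) by (rule borel_measurable_integrable)
      show "integrable m (\<lambda>x. 2 * norm (f x))" using lim(4) by simp
      show "strongly_continuous_at (s n)" for n by (rule lim(5))
      show "(\<lambda>n. s n x) \<longlonglongrightarrow> f x" if "x \<in> space m" for x using that by (rule lim(2))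
      show "\<bar>s n x\<bar> \<le> 2 * norm (f x)" if "x \<in> space m" for n x using lim(3)[OF that, of n] by simp
    qed
  qed
qed

end

section \<open>The transition function of a sub-invariant right process as a kernel
  semigroup\<close>

locale subinvariant_right_proc = right_proc F Ft X Pr
  for F :: "'w measure" and Ft :: "real \<Rightarrow> 'w measure"
    and X :: "real \<Rightarrow> 'w \<Rightarrow> (real^'n::finite) option"
    and Pr :: "(real^'n) option \<Rightarrow> 'w measure" +
  fixes m :: "(real^'n) measure"
  assumes sets_m: "sets m = sets borel"
    and finite_ball: "\<And>r. emeasure m (ball 0 r) < \<infinity>"
    and sub_inv: "sub_invariant m X Pr"
begin

text \<open>Negative times are clamped to 0, so that measurability in time holds on the whole line.\<close>

definition k :: "real \<Rightarrow> real^'n \<Rightarrow> (real^'n) measure" where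
  "k t x = distr (restrict_space (K (max 0 t) (Some x)) (range Some)) borel the"

lemma space_m: "space m = UNIV"
  using sets_eq_imp_space_eq[OF sets_m] by simp

lemma range_Some: "range Some \<in> sets (K t z)" for z :: "(real^'n) option"
  using Some_image_Delta_borel[of UNIV] by simp

lemma the_measurable: "the \<in> restrict_space (K t z) (range Some) \<rightarrow>\<^sub>M borel"
proof (rule measurableI)
  fix A :: "(real^'n) set" assume "A \<in> sets borel"
  moreover have "the -` A \<inter> space (restrict_space (K t z) (range Some)) = Some ` A"
    by (force simp: space_restrict_space)
  ultimately show "the -` A \<inter> space (restrict_space (K t z) (range Some)) \<in> sets (restrict_space (K t z) (range Some))"
    using Some_image_Delta_borel[of A] range_Some by (simp add: sets_restrict_space_iff image_mono[OF subset_UNIV])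
qed simp

lemma sets_k [simp]: "sets (k t x) = sets borel"
  and space_k [simp]: "space (k t x) = UNIV"
  unfolding k_def by simp_all

lemma emeasure_k:
  assumes "A \<in> sets borel"
  shows "emeasure (k t x) A = emeasure (K (max 0 t) (Some x)) (Some ` A)"
proof -
  have "the -` A \<inter> space (restrict_space (K (max 0 t) (Some x)) (range Some)) = Some ` A"
    by (force simp: space_restrict_space)
  then show ?thesis
    unfolding k_def using assms range_Some by (simp add: emeasure_distr the_measurable emeasure_restrict_space image_mono)
qed

lemma nn_integral_k:
  assumes "f \<in> borel_measurable borel"
  shows "(\<integral>\<^sup>+y. f y \<partial>k t x) = (\<integral>\<^sup>+z. (case z of None \<Rightarrow> 0 | Some y \<Rightarrow> f y) \<partial>K (max 0 t) (Some x))"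
proof -
  have "(\<integral>\<^sup>+y. f y \<partial>k t x) = (\<integral>\<^sup>+z. f (the z) \<partial>restrict_space (K (max 0 t) (Some x)) (range Some))"
    unfolding k_def using assms by (intro nn_integral_distr the_measurable) simp
  also have "\<dots> = (\<integral>\<^sup>+z. f (the z) * indicator (range Some) z \<partial>K (max 0 t) (Some x))"
    using range_Some by (intro nn_integral_restrict_space) simp
  also have "\<dots> = (\<integral>\<^sup>+z. (case z of None \<Rightarrow> 0 | Some y \<Rightarrow> f y) \<partial>K (max 0 t) (Some x))"
    by (intro nn_integral_cong) (auto split: option.split split_indicator)
  finally show ?thesis .
qed

lemma integral_k:
  assumes f: "f \<in> borel_measurable borel" and t: "0 \<le> t"
  shows "(\<integral>y. f y \<partial>k t x) = transition X Pr t f x"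
proof -
  have "(\<integral>y. f y \<partial>k t x) = (\<integral>z. f (the z) \<partial>restrict_space (K t (Some x)) (range Some))"
    unfolding k_def using f t by (simp add: integral_distr the_measurable max_def)
  also have "\<dots> = (\<integral>z. indicator (range Some) z *\<^sub>R f (the z) \<partial>K t (Some x))"
    using range_Some by (intro integral_restrict_space) simp
  also have "\<dots> = (\<integral>z. ext0 f z \<partial>K t (Some x))"
    by (intro Bochner_Integration.integral_cong) (auto simp: ext0_def split: option.split split_indicator)
  also have "\<dots> = transition X Pr t f x"
    unfolding K_def transition_def using t ext0_measurable[OF f] by (intro integral_distr X_measurable_Pr)
  finally show ?thesis .
qed

lemma subprob_k: "subprob_space (k t x)"
  unfolding subprob_space_def subprob_space_axioms_def
proof (intro conjI finite_measureI)
  have "emeasure (k t x) (space (k t x)) = emeasure (K (max 0 t) (Some x)) (range Some)"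
    by (simp add: emeasure_k)
  also have "\<dots> \<le> emeasure (K (max 0 t) (Some x)) (space (K (max 0 t) (Some x)))"
    by (rule emeasure_space)
  also have "\<dots> = 1" by (intro prob_space.emeasure_space_1 prob_K) simp
  finally show le: "emeasure (k t x) (space (k t x)) \<le> 1" .
  then show "emeasure (k t x) (space (k t x)) \<noteq> \<infinity>" by (auto simp: top_unique)
qed simp

lemma sigma_finite_m: "sigma_finite_measure m"
proof
  show "\<exists>A. countable A \<and> A \<subseteq> sets m \<and> \<Union> A = space m \<and> (\<forall>a\<in>A. emeasure m a \<noteq> \<infinity>)"
    using finite_ball
    by (intro exI[of _ "range (\<lambda>n::nat. ball 0 (real n))"])
      (auto simp: sets_m space_m less_top intro: reals_Archimedean2)
qed

lemma Lp_mem_indicator: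
  assumes "A \<in> sets borel"
  shows "Lp_mem 1 m (indicator (A \<inter> ball 0 r))" "indicator (A \<inter> ball 0 r) \<in> bounded_Borel"
proof -
  have "emeasure m (A \<inter> ball 0 r) \<le> emeasure m (ball 0 r)"
    using assms by (intro emeasure_mono) (auto simp: sets_m)
  then have "emeasure m (A \<inter> ball 0 r) < \<infinity>" using finite_ball[of r] by (rule order_le_less_trans)
  then show "Lp_mem 1 m (indicator (A \<inter> ball 0 r))"
    unfolding Lp_mem_1 using assms by (intro integrable_real_indicator) (auto simp: sets_m)
  show "indicator (A \<inter> ball 0 r) \<in> bounded_Borel"
    unfolding bounded_Borel_def using sets.Int[OF assms, of "ball 0 r"]
    by (auto intro!: boundedI[where B=1] split: split_indicator)
qed

text \<open>The hypothesis concerns bounded integrable functions, so A is first cut down to balls,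
  which have finite measure; monotone convergence does the rest.\<close>

lemma k_subinvariant:
  assumes t: "0 \<le> t" and A: "A \<in> sets m"
  shows "(\<integral>\<^sup>+x. emeasure (k t x) A \<partial>m) \<le> emeasure m A"
proof -
  let ?A = "\<lambda>n::nat. A \<inter> ball 0 (real n)"
  have A': "A \<in> sets borel" using A by (simp add: sets_m)
  have UA: "(\<Union>n. ?A n) = A" by (auto intro: reals_Archimedean2)
  have inc: "incseq ?A" by (auto simp: incseq_def)
  have An: "?A n \<in> sets borel" for n using A' by auto
  have le: "(\<integral>\<^sup>+x. emeasure (k t x) (?A n) \<partial>m) \<le> emeasure m A" for n
  proof -
    have "emeasure (k t x) (?A n) = ennreal (transition X Pr t (indicator (?A n)) x)" for x
    proof -
      interpret subprob_space "k t x" by (rule subprob_k)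
      have "(\<integral>y. indicator (?A n) y \<partial>k t x) = measure (k t x) (?A n)"
        using An by simp
      then show ?thesis using integral_k[OF borel_measurable_indicator[OF An] t] by (simp add: emeasure_eq_measure)
    qed
    then have "(\<integral>\<^sup>+x. emeasure (k t x) (?A n) \<partial>m) = (\<integral>\<^sup>+x. ennreal (transition X Pr t (indicator (?A n)) x) \<partial>m)"
      by simp
    also have "\<dots> \<le> (\<integral>\<^sup>+x. ennreal (indicator (?A n) x) \<partial>m)"
      using sub_inv Lp_mem_indicator[OF A', of "real n"] t unfolding sub_invariant_def by simp
    also have "\<dots> = emeasure m (?A n)"
      unfolding ennreal_indicator using An[of n] by (intro nn_integral_indicator) (simp add: sets_m)
    also have "\<dots> \<le> emeasure m A" using A by (intro emeasure_mono) auto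
    finally show ?thesis .
  qed
  have "k t \<in> borel \<rightarrow>\<^sub>M subprob_algebra borel"
  proof (rule measurable_subprob_algebra)
    fix B :: "(real^'n) set" assume B: "B \<in> sets borel"
    have "(\<lambda>z. emeasure (K (max 0 t) z) (Some ` B)) \<in> borel_measurable Delta_borel"
      by (intro measurable_compose[OF K_measurable measurable_emeasure_subprob_algebra] Some_image_Delta_borel B) simp
    from measurable_compose[OF measurable_Some this]
    show "(\<lambda>x. emeasure (k t x) B) \<in> borel_measurable borel" by (simp add: emeasure_k B)
  qed (simp_all add: subprob_k)
  then have meas: "(\<lambda>x. emeasure (k t x) (?A n)) \<in> borel_measurable m" for n
    unfolding measurable_cong_sets[OF sets_m refl]
    by (rule measurable_compose[OF _ measurable_emeasure_subprob_algebra[OF An]])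
  have "(\<integral>\<^sup>+x. emeasure (k t x) A \<partial>m) = (\<integral>\<^sup>+x. (SUP n. emeasure (k t x) (?A n)) \<partial>m)"
    using An inc UA by (intro nn_integral_cong) (simp add: SUP_emeasure_incseq image_subset_iff)
  also have "\<dots> = (SUP n. \<integral>\<^sup>+x. emeasure (k t x) (?A n) \<partial>m)"
    using meas An inc
    by (intro nn_integral_monotone_convergence_SUP) (auto simp: incseq_def le_fun_def intro!: emeasure_mono)
  also have "\<dots> \<le> emeasure m A" using le by (intro SUP_least)
  finally show ?thesis .
qed

sublocale subinvariant_kernels m k
proof -
  interpret sigma_finite_measure m by (rule sigma_finite_m)
  show "subinvariant_kernels m k"
  proof
    have bm: "sets (borel \<Otimes>\<^sub>M m) = sets (borel \<Otimes>\<^sub>M borel)" using sets_m by (intro sets_pair_measure_cong) auto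
    have "(\<lambda>(t, x). k t x) \<in> borel \<Otimes>\<^sub>M borel \<rightarrow>\<^sub>M subprob_algebra borel"
    proof (rule measurable_subprob_algebra)
      fix B :: "(real^'n) set" assume B: "B \<in> sets borel"
      have "(\<lambda>tx. (fst tx, Some (snd tx))) \<in> borel \<Otimes>\<^sub>M borel \<rightarrow>\<^sub>M borel \<Otimes>\<^sub>M Delta_borel"
        by (intro measurable_Pair measurable_fst measurable_compose[OF measurable_snd measurable_Some])
      from measurable_compose[OF this K_jointly_measurable[OF Some_image_Delta_borel[OF B]]]
      show "(\<lambda>tx. emeasure (case tx of (t, x) \<Rightarrow> k t x) B) \<in> borel_measurable (borel \<Otimes>\<^sub>M borel)"
        by (simp add: case_prod_unfold emeasure_k B)
    qed (simp_all add: case_prod_unfold subprob_k)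
    then show "(\<lambda>(t, x). k t x) \<in> borel \<Otimes>\<^sub>M m \<rightarrow>\<^sub>M subprob_algebra m"
      unfolding subprob_algebra_cong[OF sets_m] measurable_cong_sets[OF bm refl] .
    show "k 0 x = return m x" for x
    proof (rule measure_eqI)
      fix A assume "A \<in> sets (k 0 x)"
      then have A: "A \<in> sets borel" by simp
      show "emeasure (k 0 x) A = emeasure (return m x) A"
        using A by (simp add: emeasure_k K_0 Some_image_Delta_borel sets_m split: split_indicator) auto
    qed (simp add: sets_m)
    show "emeasure (k (s + t) x) A = (\<integral>\<^sup>+y. emeasure (k t y) A \<partial>k s x)"
      if s: "0 \<le> s" and t: "0 \<le> t" and A: "A \<in> sets m" for s t x A
    proof -
      have A': "A \<in> sets borel" "Some ` A \<in> sets Delta_borel" using A Some_image_Delta_borel[of A] by (auto simp: sets_m)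
      have "(\<lambda>z. emeasure (K t z) (Some ` A)) \<in> borel_measurable Delta_borel"
        by (rule measurable_compose[OF K_measurable[OF t] measurable_emeasure_subprob_algebra[OF A'(2)]])
      from measurable_compose[OF measurable_Some this]
      have "(\<lambda>y. emeasure (k t y) A) \<in> borel_measurable borel" using t by (simp add: emeasure_k A' max_def)
      then have "(\<integral>\<^sup>+y. emeasure (k t y) A \<partial>k s x) =
          (\<integral>\<^sup>+z. (case z of None \<Rightarrow> 0 | Some y \<Rightarrow> emeasure (k t y) A) \<partial>K s (Some x))"
        using nn_integral_k[of "\<lambda>y. emeasure (k t y) A" s x] s by (simp add: max_def)
      \<comment> \<open>Nothing returns from \<open>None\<close>: by \<open>K_None\<close> the value
        at the cemetery is 0 on this side as well.\<close>
      also have "\<dots> = (\<integral>\<^sup>+z. emeasure (K t z) (Some ` A) \<partial>K s (Some x))"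
        using t A' by (intro nn_integral_cong)
          (auto simp: emeasure_k max_def K_None split: option.split split_indicator)
      also have "\<dots> = (\<integral>\<^sup>+z. \<integral>\<^sup>+y. indicator (Some ` A) y \<partial>K t z \<partial>K s (Some x))"
        using A' by simp
      also have "\<dots> = emeasure (K (s + t) (Some x)) (Some ` A)"
        using K_add[OF s t borel_measurable_indicator[OF A'(2)], of "Some x"] A' by simp
      finally show ?thesis using s t A' by (simp add: emeasure_k max_def)
    qed
    show "(\<integral>\<^sup>+x. emeasure (k t x) A \<partial>m) \<le> emeasure m A" if "0 \<le> t" "A \<in> sets m" for t A
      by (rule k_subinvariant[OF that])
  qed
qed

lemma p_eq_transition: "f \<in> borel_measurable borel \<Longrightarrow> 0 \<le> t \<Longrightarrow> p t f x = transition X Pr t f x"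
  unfolding p_def by (rule integral_k)

text \<open>A path starting in the open set U is still in U at all sufficiently small times, by
  right-continuity. Time runs through sequences because dominated convergence is sequential.\<close>

lemma p_indicator_open_tendsto:
  assumes U: "open U" and x: "x \<in> U" and S: "\<And>n. 0 < S n" "S \<longlonglongrightarrow> 0"
  shows "(\<lambda>n. p (S n) (indicator U) x) \<longlonglongrightarrow> 1"
proof -
  interpret prob_space "Pr (Some x)" by (rule prob_Pr)
  have U': "indicator U \<in> borel_measurable borel" using U by simp
  have at: "filterlim S (at_right 0) sequentially"
    unfolding filterlim_at using S by (auto intro!: always_eventually simp: less_imp_neq[symmetric])
  have "(\<lambda>n. LINT \<omega>|Pr (Some x). ext0 (indicator U) (X (S n) \<omega>)) \<longlonglongrightarrow> (LINT \<omega>|Pr (Some x). 1)"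
  proof (rule integral_dominated_convergence[where w="\<lambda>_. 1"])
    show "(\<lambda>\<omega>. ext0 (indicator U) (X (S n) \<omega>)) \<in> borel_measurable (Pr (Some x))" for n
      using S(1)[of n] by (intro measurable_compose[OF X_measurable_Pr ext0_measurable[OF U']]) simp
    show "AE \<omega> in Pr (Some x). (\<lambda>n. ext0 (indicator U) (X (S n) \<omega>)) \<longlonglongrightarrow> (1 :: real)"
      using normal[of "Some x"] AE_space
    proof eventually_elim
      case (elim \<omega>)
      have "limitin Delta_top (\<lambda>s. X s \<omega>) (X 0 \<omega>) (at_right 0)"
        using elim(2) by (intro right_continuous) (simp_all add: space_Pr)
      moreover have "openin Delta_top (Some ` U)" using U by (auto simp: openin_Delta_top)
      ultimately have "\<forall>\<^sub>F s in at_right 0. X s \<omega> \<in> Some ` U"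
        using x elim(1) unfolding limitin_def by simp
      then have "\<forall>\<^sub>F n in sequentially. X (S n) \<omega> \<in> Some ` U"
        using at unfolding filterlim_iff by blast
      then have "\<forall>\<^sub>F n in sequentially. ext0 (indicator U) (X (S n) \<omega>) = (1 :: real)"
        by eventually_elim (auto simp: ext0_def)
      then show ?case by (rule tendsto_eventually)
    qed
    show "AE \<omega> in Pr (Some x). norm (ext0 (indicator U) (X (S n) \<omega>) :: real) \<le> 1" for n
      by (intro AE_I2) (auto simp: ext0_def split: option.split split_indicator)
  qed auto
  then show ?thesis
    using S(1) p_eq_transition[OF U'] by (simp add: transition_def prob_space less_imp_le)
qed

text \<open>Paths control only the deficit of p t 1_U on U, which is dominated by 1_U and tends to
  0. The excess needs no pointwise control: since the total mass does not increase, it is at most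
  the deficit, hence the factor 2 below.\<close>

lemma strongly_continuous_open:
  assumes U: "open U" "U \<subseteq> ball 0 r"
  shows "strongly_continuous_at (indicator U)"
proof -
  have "U \<inter> ball 0 r = U" using U by auto
  then have i: "integrable m (indicator U :: _ \<Rightarrow> real)"
    using Lp_mem_indicator(1)[of U r] U by (simp add: Lp_mem_1)
  have "((\<lambda>t. LINT x|m. \<bar>p t (indicator U) x - indicator U x\<bar>) \<longlongrightarrow> 0) (at_right 0)"
  proof (rule tendsto_at_right_sequentially[of 0 1])
    fix S :: "nat \<Rightarrow> real" assume S: "\<And>n. 0 < S n" "S \<longlonglongrightarrow> 0"
    let ?d = "\<lambda>n x. max 0 (indicator U x - p (S n) (indicator U) x)"
    have pi: "integrable m (p (S n) (indicator U))" for n using S(1)[of n] i by (intro p_integrable) auto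
    have p0: "0 \<le> p t (indicator U) x" for t x unfolding p_def by (intro integral_nonneg_AE AE_I2) simp
    have "(\<lambda>n. LINT x|m. ?d n x) \<longlonglongrightarrow> (LINT x|m. 0)"
    proof (rule integral_dominated_convergence[where w="indicator U"])
      show "AE x in m. (\<lambda>n. ?d n x) \<longlonglongrightarrow> 0"
      proof (rule AE_I2)
        fix x
        show "(\<lambda>n. ?d n x) \<longlonglongrightarrow> 0"
        proof (cases "x \<in> U")
          case True
          have "(\<lambda>n. max 0 (1 - p (S n) (indicator U) x)) \<longlonglongrightarrow> max 0 (1 - 1)"
            by (intro tendsto_intros p_indicator_open_tendsto U(1) True S)
          then show ?thesis using True by simp
        next
          case False
          then have "?d n x = 0" for n using p0[of "S n" x] by simp
          then show ?thesis by simp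
        qed
      qed
      show "AE x in m. norm (?d n x) \<le> indicator U x" for n
        using p0[of "S n"] by (intro AE_I2) (auto split: split_indicator simp: max_def)
    qed (use pi i in auto)
    then have lim: "(\<lambda>n. 2 * (LINT x|m. ?d n x)) \<longlonglongrightarrow> 0"
      using tendsto_mult_right_zero[of "\<lambda>n. LINT x|m. ?d n x" sequentially 2] by simp
    have "(LINT x|m. \<bar>p (S n) (indicator U) x - indicator U x\<bar>) \<le> 2 * (LINT x|m. ?d n x)" for n
    proof -
      \<comment> \<open>This is |a| = a + 2 * max 0 (- a) for the difference a, whose integral is at
        most 0 by contraction.\<close>
      have "(LINT x|m. \<bar>p (S n) (indicator U) x - indicator U x\<bar>) =
          (LINT x|m. (p (S n) (indicator U) x - indicator U x) + 2 * ?d n x)"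
        by (intro Bochner_Integration.integral_cong) (auto simp: max_def)
      also have "\<dots> = (LINT x|m. p (S n) (indicator U) x) - (LINT x|m. indicator U x) + 2 * (LINT x|m. ?d n x)"
        using pi[of n] i by simp
      also have "(LINT x|m. p (S n) (indicator U) x) \<le> (LINT x|m. indicator U x)"
      proof -
        have "(LINT x|m. p (S n) (indicator U) x) \<le> (LINT x|m. \<bar>p (S n) (indicator U) x\<bar>)"
          using pi[of n] by (intro integral_mono) auto
        also have "\<dots> \<le> (LINT x|m. \<bar>indicator U x\<bar>)" using S(1)[of n] i by (intro p_contraction) auto
        finally show ?thesis by simp
      qed
      finally show ?thesis by simp
    qed
    then show "(\<lambda>n. LINT x|m. \<bar>p (S n) (indicator U) x - indicator U x\<bar>) \<longlonglongrightarrow> 0"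
      by (intro tendsto_sandwich[OF always_eventually always_eventually tendsto_const lim]) simp_all
  qed simp
  then show ?thesis unfolding strongly_continuous_at_def using i by simp
qed

sublocale continuous_kernels m k
proof
  fix f :: "real^'n \<Rightarrow> real" assume f: "integrable m f"
  have "strongly_continuous_at f"
  proof (rule strongly_continuousI[where G="{U. open U}" and B="\<lambda>n::nat. ball 0 (real n)", OF _ _ _ _ _ _ _ _ _ f])
    show "sets m = sigma_sets (space m) {U. open U}" unfolding sets_m space_m by (simp add: borel_def sets_measure_of_conv)
    show "Int_stable {U. open U}" by (auto simp: Int_stable_def)
    show "(\<Union>n. ball 0 (real n)) = space m" by (auto simp: space_m intro: reals_Archimedean2)
    show "strongly_continuous_at (indicator (A \<inter> ball 0 (real n)))" if "A \<in> {U. open U}" for A n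
      using that by (intro strongly_continuous_open[where r="real n"]) auto
    show "strongly_continuous_at (indicator (ball 0 (real n)))" for n
      by (intro strongly_continuous_open[where r="real n"]) auto
  qed (use finite_ball in \<open>auto simp: sets_m space_m incseq_def\<close>)
  then show "((\<lambda>t. LINT x|m. \<bar>p t f x - f x\<bar>) \<longlongrightarrow> 0) (at_right 0)"
    unfolding strongly_continuous_at_def by simp
qed

end

section \<open>The martingale problem and the generator\<close>

text \<open>The extremal sets are those where f is positive and those where it is negative, cut down
  to finite measure; each contributes c. This recovers an L^1 norm from tests with
  indicators.\<close>

lemma L1_le_set_integrals:
  fixes f :: "'a \<Rightarrow> real"
  assumes "sigma_finite_measure M" and f: "integrable M f"
    and le: "\<And>A. A \<in> sets M \<Longrightarrow> emeasure M A < \<infinity> \<Longrightarrow> \<bar>LINT x|M. indicator A x * f x\<bar> \<le> c"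
  shows "(LINT x|M. \<bar>f x\<bar>) \<le> 2 * c"
proof -
  interpret sigma_finite_measure M by fact
  obtain B where B: "range B \<subseteq> sets M" "(\<Union>n. B n) = space M" "\<And>n. emeasure M (B n) \<noteq> \<infinity>" "incseq B"
    using sigma_finite_incseq by metis
  have part: "(LINT x|M. max 0 (g x)) \<le> c" if g: "integrable M g"
    and le: "\<And>A. A \<in> sets M \<Longrightarrow> emeasure M A < \<infinity> \<Longrightarrow> (LINT x|M. indicator A x * g x) \<le> c" for g :: "'a \<Rightarrow> real"
  proof -
    define A where "A n = {x \<in> space M. 0 < g x} \<inter> B n" for n
    have A: "A n \<in> sets M" for n unfolding A_def using g B(1) by auto
    have fin: "emeasure M (A n) < \<infinity>" for n
      using emeasure_mono[of "A n" "B n" M] B(1,3) unfolding A_def by (auto simp: less_top[symmetric] top_unique)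
    have "(\<lambda>n. LINT x|M. indicator (A n) x * g x) \<longlonglongrightarrow> (LINT x|M. max 0 (g x))"
    proof (rule integral_dominated_convergence[where w="\<lambda>x. \<bar>g x\<bar>"])
      show "AE x in M. (\<lambda>n. indicator (A n) x * g x) \<longlonglongrightarrow> max 0 (g x)"
      proof (rule AE_I2)
        fix x assume x: "x \<in> space M"
        then obtain i where i: "x \<in> B i" using B(2) by auto
        have "\<forall>\<^sub>F n in sequentially. indicator (A n) x * g x = max 0 (g x)"
          using eventually_ge_at_top[of i]
        proof eventually_elim
          case (elim n)
          then have "x \<in> B n" using i B(4) by (auto simp: incseq_def)
          then show ?case using x unfolding A_def by (auto split: split_indicator)
        qed
        then show "(\<lambda>n. indicator (A n) x * g x) \<longlonglongrightarrow> max 0 (g x)" by (rule tendsto_eventually)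
      qed
      show "AE x in M. norm (indicator (A n) x * g x) \<le> \<bar>g x\<bar>" for n
        by (intro AE_I2) (auto split: split_indicator)
    qed (use g A in auto)
    then show ?thesis by (rule LIMSEQ_le_const2) (use le A fin in auto)
  qed
  have "(LINT x|M. \<bar>f x\<bar>) = (LINT x|M. max 0 (f x) + max 0 (- f x))"
    by (intro Bochner_Integration.integral_cong) auto
  also have "\<dots> = (LINT x|M. max 0 (f x)) + (LINT x|M. max 0 (- f x))"
    using f by (intro Bochner_Integration.integral_add) auto
  also have "(LINT x|M. max 0 (f x)) \<le> c" using f le by (intro part) (auto dest: abs_le_D1)
  also have "(LINT x|M. max 0 (- f x)) \<le> c" using f le by (intro part) (auto dest: abs_le_D2)
  finally show ?thesis by simp
qed

context right_proc
begin

lemma sets_universal_completion: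
  assumes \<mu>: "prob_space \<mu>" "sets \<mu> = sets Delta_borel"
  shows "sets (universal_completion (Delta_borel :: (real^'n) option measure)) \<subseteq> sets (completion \<mu>)"
proof -
  let ?S = "{A. A \<subseteq> UNIV \<and> (\<forall>\<mu>. prob_space \<mu> \<and> sets \<mu> = sets (Delta_borel :: (real^'n) option measure) \<longrightarrow> A \<in> sets (completion \<mu>))}"
  have "space (completion \<mu>) = UNIV" using sets_eq_imp_space_eq[OF \<mu>(2)] by simp
  then have "sigma_sets UNIV ?S \<subseteq> sets (completion \<mu>)"
    using \<mu> sets.sigma_sets_subset[of ?S "completion \<mu>"] by auto
  then show ?thesis unfolding universal_completion_def by simp
qed

lemma sets_mix [simp]: "sets (mix F Pr \<mu>) = sets F"
  and space_mix [simp]: "space (mix F Pr \<mu>) = space F"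
  unfolding mix_def by (simp_all add: space_measure_of_conv)

text \<open>\<open>mix\<close> is built by \<open>measure_of\<close>, which returns the intended
  values only for a countably additive set function. Additivity holds because universally measurable
  functions are measurable for the completion of \<mu>.\<close>

lemma emeasure_mix:
  assumes \<mu>: "prob_space \<mu>" "sets \<mu> = sets Delta_borel" and \<Gamma>: "\<Gamma> \<in> sets F"
  shows "emeasure (mix F Pr \<mu>) \<Gamma> = (\<integral>\<^sup>+z. emeasure (Pr z) \<Gamma> \<partial>\<mu>)"
proof -
  have sp: "space (completion \<mu>) = UNIV" using sets_eq_imp_space_eq[OF \<mu>(2)] by simp
  have spU: "space (universal_completion (Delta_borel :: (real^'n) option measure)) = UNIV"
    unfolding universal_completion_def by (simp add: space_measure_of_conv)
  have meas: "(\<lambda>z. emeasure (Pr z) \<Gamma>) \<in> borel_measurable (completion \<mu>)" if "\<Gamma> \<in> sets F" for \<Gamma>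
  proof (rule measurableI)
    fix S :: "ennreal set" assume "S \<in> sets borel"
    from measurable_sets[OF universally_measurable[OF that] this]
    show "(\<lambda>z. emeasure (Pr z) \<Gamma>) -` S \<inter> space (completion \<mu>) \<in> sets (completion \<mu>)"
      using sets_universal_completion[OF \<mu>] by (auto simp: sp spU)
  qed simp
  have "emeasure (mix F Pr \<mu>) \<Gamma> = (\<integral>\<^sup>+z. emeasure (Pr z) \<Gamma> \<partial>completion \<mu>)"
  proof (rule emeasure_measure_of[OF mix_def sets.space_closed])
    show "positive (sets (mix F Pr \<mu>)) (\<lambda>\<Gamma>. \<integral>\<^sup>+z. emeasure (Pr z) \<Gamma> \<partial>completion \<mu>)"
      by (simp add: positive_def)
    show "countably_additive (sets (mix F Pr \<mu>)) (\<lambda>\<Gamma>. \<integral>\<^sup>+z. emeasure (Pr z) \<Gamma> \<partial>completion \<mu>)"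
    proof (rule countably_additiveI)
      fix S :: "nat \<Rightarrow> 'w set" assume S: "range S \<subseteq> sets (mix F Pr \<mu>)" "disjoint_family S"
      then have SF: "S i \<in> sets F" for i by auto
      have "(\<Sum>i. \<integral>\<^sup>+z. emeasure (Pr z) (S i) \<partial>completion \<mu>) = (\<integral>\<^sup>+z. (\<Sum>i. emeasure (Pr z) (S i)) \<partial>completion \<mu>)"
        using meas[OF SF] by (intro nn_integral_suminf[symmetric])
      also have "\<dots> = (\<integral>\<^sup>+z. emeasure (Pr z) (\<Union>i. S i) \<partial>completion \<mu>)"
        using S SF by (intro nn_integral_cong suminf_emeasure) (auto simp: sets_Pr)
      finally show "(\<Sum>i. \<integral>\<^sup>+z. emeasure (Pr z) (S i) \<partial>completion \<mu>) =
        (\<integral>\<^sup>+z. emeasure (Pr z) (\<Union>i. S i) \<partial>completion \<mu>)" .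
    qed
  qed (use \<Gamma> in simp)
  then show ?thesis by (simp add: nn_integral_completion)
qed

lemma prob_space_mix:
  assumes \<mu>: "prob_space \<mu>" "sets \<mu> = sets Delta_borel"
  shows "prob_space (mix F Pr \<mu>)"
proof (rule prob_spaceI)
  have "emeasure (Pr z) (space F) = 1" for z
    using prob_space.emeasure_space_1[OF prob_Pr, of z] by (simp only: space_Pr)
  then show "emeasure (mix F Pr \<mu>) (space (mix F Pr \<mu>)) = 1"
    using prob_space.emeasure_space_1[OF \<mu>(1)] by (simp add: emeasure_mix[OF \<mu>])
qed

lemma nn_integral_mix:
  assumes \<mu>: "prob_space \<mu>" "sets \<mu> = sets Delta_borel" and t: "0 \<le> t" and h: "h \<in> borel_measurable Delta_borel"
  shows "(\<integral>\<^sup>+\<omega>. h (X t \<omega>) \<partial>mix F Pr \<mu>) = (\<integral>\<^sup>+z. \<integral>\<^sup>+y. h y \<partial>K t z \<partial>\<mu>)"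
proof -
  let ?Q = "mix F Pr \<mu>"
  have Xm: "X t \<in> ?Q \<rightarrow>\<^sub>M Delta_borel"
    using X_measurable[OF t] measurable_cong_sets[OF sets_mix refl] by blast
  have Km: "K t \<in> \<mu> \<rightarrow>\<^sub>M subprob_algebra Delta_borel"
    using K_measurable[OF t] measurable_cong_sets[OF \<mu>(2) refl] by blast
  have ne: "space \<mu> \<noteq> {}" using prob_space.not_empty[OF \<mu>(1)] .
  have "distr ?Q Delta_borel (X t) = \<mu> \<bind> K t"
  proof (rule measure_eqI)
    show "sets (distr ?Q Delta_borel (X t)) = sets (\<mu> \<bind> K t)"
      using sets_bind[OF _ ne, of "K t" Delta_borel] by simp
    fix A assume "A \<in> sets (distr ?Q Delta_borel (X t))"
    then have A: "A \<in> sets Delta_borel" by simp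
    have "X t -` A \<inter> space ?Q = {\<omega>\<in>space F. X t \<omega> \<in> A}" by auto
    then have "emeasure (distr ?Q Delta_borel (X t)) A = (\<integral>\<^sup>+z. emeasure (Pr z) {\<omega>\<in>space F. X t \<omega> \<in> A} \<partial>\<mu>)"
      using A Xm by (simp add: emeasure_distr emeasure_mix[OF \<mu> X_event_F[OF t A]])
    also have "\<dots> = emeasure (\<mu> \<bind> K t) A"
      using emeasure_bind[OF ne Km A] by (simp add: emeasure_K[OF t A])
    finally show "emeasure (distr ?Q Delta_borel (X t)) A = emeasure (\<mu> \<bind> K t) A" .
  qed
  moreover have "(\<integral>\<^sup>+y. h y \<partial>distr ?Q Delta_borel (X t)) = (\<integral>\<^sup>+\<omega>. h (X t \<omega>) \<partial>?Q)"
    using Xm h by (intro nn_integral_distr) simp_all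
  ultimately show ?thesis using nn_integral_bind[OF h Km] by simp
qed

end

context subinvariant_right_proc
begin

lemma measurable_m: "measurable m N = measurable borel N"
  by (rule measurable_cong_sets[OF sets_m refl])

context
  fixes v :: "real^'n \<Rightarrow> real" and c :: real
  assumes v: "v \<in> borel_measurable borel" "\<And>x. 0 \<le> v x" "\<And>x. v x \<le> c" "(\<integral>\<^sup>+x. ennreal (v x) \<partial>m) = 1"
begin

abbreviation "\<mu> \<equiv> initial (density m (\<lambda>x. ennreal (v x)))"
abbreviation "Q \<equiv> mix F Pr \<mu>"

lemma v_measurable: "v \<in> borel_measurable m"
  using v(1) measurable_cong_sets[OF sets_m refl] by blast

lemma Some_measurable_m: "Some \<in> density m f \<rightarrow>\<^sub>M Delta_borel"
proof -
  have "measurable (density m f) Delta_borel = measurable borel (Delta_borel :: (real^'n) option measure)"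
    by (rule measurable_cong_sets) (simp_all add: sets_m)
  then show ?thesis by (simp only: measurable_Some)
qed

lemma initial_prob: "prob_space \<mu>" "sets \<mu> = sets Delta_borel"
proof -
  have "prob_space (density m (\<lambda>x. ennreal (v x)))"
    using v(4) v_measurable by (intro prob_spaceI) (simp add: emeasure_density)
  then show "prob_space \<mu>" unfolding initial_def by (rule prob_space.prob_space_distr) (rule Some_measurable_m)
  show "sets \<mu> = sets Delta_borel" by (simp add: initial_def)
qed

lemma nn_integral_Q:
  assumes t: "0 \<le> t" and h: "h \<in> borel_measurable borel"
  shows "(\<integral>\<^sup>+\<omega>. (case X t \<omega> of None \<Rightarrow> 0 | Some y \<Rightarrow> h y) \<partial>Q) = (\<integral>\<^sup>+x. ennreal (v x) * (\<integral>\<^sup>+y. h y \<partial>k t x) \<partial>m)"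
proof -
  have h': "(\<lambda>z. case z of None \<Rightarrow> 0 | Some y \<Rightarrow> h y) \<in> borel_measurable Delta_borel"
    unfolding measurable_Delta_borel_iff using h by (simp add: comp_def)
  have Kh: "(\<lambda>z. \<integral>\<^sup>+y. (case y of None \<Rightarrow> 0 | Some y \<Rightarrow> h y) \<partial>K t z) \<in> borel_measurable Delta_borel"
    by (rule nn_integral_K_measurable[OF t h'])
  have "(\<integral>\<^sup>+\<omega>. (case X t \<omega> of None \<Rightarrow> 0 | Some y \<Rightarrow> h y) \<partial>Q) =
      (\<integral>\<^sup>+z. \<integral>\<^sup>+y. (case y of None \<Rightarrow> 0 | Some y \<Rightarrow> h y) \<partial>K t z \<partial>\<mu>)"
    by (rule nn_integral_mix[OF initial_prob t h'])
  also have "\<dots> = (\<integral>\<^sup>+x. \<integral>\<^sup>+y. (case y of None \<Rightarrow> 0 | Some y \<Rightarrow> h y) \<partial>K t (Some x) \<partial>density m (\<lambda>x. ennreal (v x)))"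
    unfolding initial_def using Kh by (intro nn_integral_distr Some_measurable_m) simp
  also have "\<dots> = (\<integral>\<^sup>+x. \<integral>\<^sup>+y. h y \<partial>k t x \<partial>density m (\<lambda>x. ennreal (v x)))"
    using t by (simp add: nn_integral_k[OF h] max_def)
  also have "\<dots> = (\<integral>\<^sup>+x. ennreal (v x) * (\<integral>\<^sup>+y. h y \<partial>k t x) \<partial>m)"
    using h v_measurable by (intro nn_integral_density nn_kernel_measurable)
      (simp_all add: measurable_cong_sets[OF sets_m refl])
  finally show ?thesis .
qed

lemma v_mult_integrable:
  assumes "integrable m h"
  shows "integrable m (\<lambda>x. v x * h x)"
proof (rule Bochner_Integration.integrable_bound[of _ "\<lambda>x. c * h x"])
  show "AE x in m. norm (v x * h x) \<le> norm (c * h x)"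
    using v(2,3) by (intro AE_I2) (auto simp: abs_mult intro!: mult_right_mono intro: order_trans[OF _ abs_ge_self])
qed (use assms v_measurable in auto)

lemma integral_Q_nonneg:
  assumes t: "0 \<le> t" and h: "integrable m h" "\<And>x. 0 \<le> h x"
  shows "integrable Q (\<lambda>\<omega>. ext0 h (X t \<omega>))" "(LINT \<omega>|Q. ext0 h (X t \<omega>)) = (LINT x|m. v x * p t h x)"
proof -
  have hb: "h \<in> borel_measurable borel" using borel_measurable_integrable[OF h(1)] by (simp add: measurable_m)
  have p0: "0 \<le> p t h x" for x unfolding p_def using h(2) by (intro integral_nonneg_AE AE_I2) simp
  have ext: "ennreal (ext0 h z) = (case z of None \<Rightarrow> 0 | Some y \<Rightarrow> ennreal (h y))" for z
    by (simp add: ext0_def split: option.split)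
  have e0: "0 \<le> ext0 h z" for z using h(2) by (simp add: ext0_def split: option.split)
  have "(\<integral>\<^sup>+\<omega>. ennreal (ext0 h (X t \<omega>)) \<partial>Q) = (\<integral>\<^sup>+x. ennreal (v x) * (\<integral>\<^sup>+y. ennreal (h y) \<partial>k t x) \<partial>m)"
    unfolding ext using hb by (intro nn_integral_Q[OF t]) simp
  also have "\<dots> = (\<integral>\<^sup>+x. ennreal (v x * p t h x) \<partial>m)"
  proof (intro nn_integral_cong_AE, use AE_kernel_integrable[OF t h(1)] in eventually_elim)
    case (elim x)
    then show ?case
      using h(2) v(2) p0 unfolding p_def by (subst nn_integral_eq_integral) (auto simp: ennreal_mult)
  qed
  also have "\<dots> = ennreal (LINT x|m. v x * p t h x)"
    using v(2) p0 by (intro nn_integral_eq_integral v_mult_integrable p_integrable t h(1)) auto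
  finally have *: "(\<integral>\<^sup>+\<omega>. ennreal (ext0 h (X t \<omega>)) \<partial>Q) = ennreal (LINT x|m. v x * p t h x)" .
  have meas: "(\<lambda>\<omega>. ext0 h (X t \<omega>)) \<in> borel_measurable Q"
    unfolding measurable_cong_sets[OF sets_mix refl] by (rule measurable_compose[OF X_measurable[OF t] ext0_measurable[OF hb]])
  show int: "integrable Q (\<lambda>\<omega>. ext0 h (X t \<omega>))"
    using * e0 meas by (intro integrableI_nonneg) auto
  have "ennreal (LINT \<omega>|Q. ext0 h (X t \<omega>)) = ennreal (LINT x|m. v x * p t h x)"
    using * nn_integral_eq_integral[OF int] e0 by simp
  moreover have "0 \<le> (LINT \<omega>|Q. ext0 h (X t \<omega>))" "0 \<le> (LINT x|m. v x * p t h x)"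
    using e0 v(2) p0 by (auto intro!: integral_nonneg_AE AE_I2)
  ultimately show "(LINT \<omega>|Q. ext0 h (X t \<omega>)) = (LINT x|m. v x * p t h x)" by simp
qed

text \<open>The third claim, from v \<le> c and contraction, is uniform in t; Fubini over a time
  interval demands such a bound.\<close>

lemma integral_Q:
  assumes t: "0 \<le> t" and h: "integrable m h"
  shows "integrable Q (\<lambda>\<omega>. ext0 h (X t \<omega>))" "(LINT \<omega>|Q. ext0 h (X t \<omega>)) = (LINT x|m. v x * p t h x)"
    "(LINT \<omega>|Q. \<bar>ext0 h (X t \<omega>)\<bar>) \<le> c * (LINT x|m. \<bar>h x\<bar>)"
proof -
  let ?a = "\<lambda>x. max 0 (h x)" and ?b = "\<lambda>x. max 0 (- h x)"
  have i: "integrable m ?a" "integrable m ?b" using h by auto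
  have eq: "ext0 h z = ext0 ?a z - ext0 ?b z" for z by (auto simp: ext0_def max_def split: option.split)
  note a = integral_Q_nonneg[OF t i(1)] and b = integral_Q_nonneg[OF t i(2)]
  show int: "integrable Q (\<lambda>\<omega>. ext0 h (X t \<omega>))" unfolding eq using a(1) b(1) by auto
  have pi: "integrable m (p t ?a)" "integrable m (p t ?b)" "integrable m (p t h)"
    using t i h by (auto intro: p_integrable)
  have "(LINT \<omega>|Q. ext0 h (X t \<omega>)) = (LINT x|m. v x * p t ?a x) - (LINT x|m. v x * p t ?b x)"
    unfolding eq using a b by simp
  also have "\<dots> = (LINT x|m. v x * p t ?a x - v x * p t ?b x)"
    using v_mult_integrable pi by simp
  also have "\<dots> = (LINT x|m. v x * p t h x)"
  proof (rule integral_cong_AE)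
    have "(\<lambda>x. ?a x - ?b x) = h" by (auto simp: fun_eq_iff)
    then have "AE x in m. p t h x = p t ?a x - p t ?b x" using p_diff_AE[OF t i] by simp
    then show "AE x in m. v x * p t ?a x - v x * p t ?b x = v x * p t h x"
      by eventually_elim (simp add: right_diff_distrib)
  qed (use v_mult_integrable pi in \<open>auto intro!: borel_measurable_integrable\<close>)
  finally show "(LINT \<omega>|Q. ext0 h (X t \<omega>)) = (LINT x|m. v x * p t h x)" .
  have hi: "integrable m (\<lambda>x. \<bar>h x\<bar>)" using h by auto
  have "(LINT \<omega>|Q. \<bar>ext0 h (X t \<omega>)\<bar>) = (LINT \<omega>|Q. ext0 (\<lambda>x. \<bar>h x\<bar>) (X t \<omega>))"
    by (intro Bochner_Integration.integral_cong) (auto simp: ext0_def split: option.split)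
  also have "\<dots> = (LINT x|m. v x * p t (\<lambda>x. \<bar>h x\<bar>) x)"
    by (rule integral_Q_nonneg(2)[OF t hi]) simp
  also have "\<dots> \<le> (LINT x|m. c * \<bar>p t (\<lambda>x. \<bar>h x\<bar>) x\<bar>)"
  proof (rule integral_mono)
    have "0 \<le> p t (\<lambda>x. \<bar>h x\<bar>) x" for x unfolding p_def by (intro integral_nonneg_AE AE_I2) simp
    then show "v x * p t (\<lambda>x. \<bar>h x\<bar>) x \<le> c * \<bar>p t (\<lambda>x. \<bar>h x\<bar>) x\<bar>" for x
      using v(3)[of x] by (simp add: mult_right_mono)
  qed (use p_integrable[OF t hi] v_mult_integrable in auto)
  also have "\<dots> = c * (LINT x|m. \<bar>p t (\<lambda>x. \<bar>h x\<bar>) x\<bar>)" by simp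
  also have "\<dots> \<le> c * (LINT x|m. \<bar>h x\<bar>)"
    using p_contraction[OF t hi] order_trans[OF v(2) v(3)] by (intro mult_left_mono) auto
  finally show "(LINT \<omega>|Q. \<bar>ext0 h (X t \<omega>)\<bar>) \<le> c * (LINT x|m. \<bar>h x\<bar>)" .
qed

text \<open>The martingale starts at 0, so its expectation vanishes. What remains is to rewrite the
  expectations of functions of X s through \<open>integral_Q\<close> and to exchange expectation and
  time integral.\<close>

lemma martingale_identity:
  assumes Y: "continuous_martingale Q Ft
      (\<lambda>t \<omega>. ext0 u (X t \<omega>) - ext0 u (X 0 \<omega>) - (LINT s:{0..t}|lborel. ext0 w (X s \<omega>)))"
    and u: "integrable m u" and w: "integrable m w" and t: "0 \<le> t"
  shows "(LINT x|m. v x * (p t u x - u x)) = (LINT s:{0..t}|lborel. (LINT x|m. v x * p s w x))"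
proof -
  interpret prob_space Q by (rule prob_space_mix[OF initial_prob])
  interpret finite_measure_subalgebra Q "Ft 0"
    by unfold_locales (simp add: subalgebra_def space_Ft sets_Ft)
  let ?Y = "\<lambda>t \<omega>. ext0 u (X t \<omega>) - ext0 u (X 0 \<omega>) - (LINT s:{0..t}|lborel. ext0 w (X s \<omega>))"
  note Y' = Y[unfolded continuous_martingale_def]
  have Yi: "integrable Q (?Y t)"
    using Y'[THEN conjunct1, rule_format, OF t] by (rule conjunct2)
  have Y0: "AE \<omega> in Q. real_cond_exp Q (Ft 0) (?Y t) \<omega> = ?Y 0 \<omega>"
    by (rule Y'[THEN conjunct2, THEN conjunct1, rule_format]) (use t in simp)
  have "(LINT \<omega>|Q. ?Y t \<omega>) = (LINT \<omega>|Q. real_cond_exp Q (Ft 0) (?Y t) \<omega>)"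
    by (rule real_cond_exp_int(2)[OF Yi, symmetric])
  also have "\<dots> = 0"
    using Y0 unfolding LINT_Icc_point by (intro integral_eq_zero_AE) simp
  finally have zero: "(LINT \<omega>|Q. ?Y t \<omega>) = 0" .
  have wb: "w \<in> borel_measurable borel" using borel_measurable_integrable[OF w] by (simp add: measurable_m)
  have QF: "measurable (borel \<Otimes>\<^sub>M Q) N = measurable (borel \<Otimes>\<^sub>M F) N" for N :: "real measure"
    by (intro measurable_cong_sets sets_pair_measure_cong) auto
  have id: "(\<lambda>\<omega>. \<omega>) \<in> F \<rightarrow>\<^sub>M past F X {0..}"
    using sets_past_subset[of "{0..}"] by (intro measurableI) (auto simp: space_past)
  have "(\<lambda>z. (fst z, snd z)) \<in> borel \<Otimes>\<^sub>M F \<rightarrow>\<^sub>M borel \<Otimes>\<^sub>M past F X {0..}"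
    by (intro measurable_Pair measurable_fst measurable_compose[OF measurable_snd id])
  from measurable_compose[OF measurable_compose[OF this jointly_measurable] ext0_measurable[OF wb]]
  have meas: "(\<lambda>(s, \<omega>). ext0 w (X (max 0 s) \<omega>)) \<in> borel_measurable (borel \<Otimes>\<^sub>M Q)"
    unfolding QF by (simp add: case_prod_unfold)
  \<comment> \<open>Joint measurability is known for the coordinates with clamped time, which agree
    with the original ones on {0..t}.\<close>
  have max: "(LINT s:{0..t}|lborel. ext0 w (X (max 0 s) \<omega>)) = (LINT s:{0..t}|lborel. ext0 w (X s \<omega>))" for \<omega>
    by (intro set_lebesgue_integral_cong) auto
  note Fub = Fubini_time[OF sigma_finite_measure_axioms meas, of t "c * (LINT x|m. \<bar>w x\<bar>)"]
  have iF: "integrable Q (\<lambda>\<omega>. LINT s:{0..t}|lborel. ext0 w (X s \<omega>))"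
    using Fub(1) integral_Q(1,3)[OF _ w] t unfolding max by simp
  have "(LINT \<omega>|Q. (LINT s:{0..t}|lborel. ext0 w (X s \<omega>))) = (LINT s:{0..t}|lborel. (LINT \<omega>|Q. ext0 w (X (max 0 s) \<omega>)))"
    using Fub(2) integral_Q(1,3)[OF _ w] t unfolding max by simp
  also have "\<dots> = (LINT s:{0..t}|lborel. (LINT x|m. v x * p s w x))"
    using integral_Q(2)[OF _ w] by (intro set_lebesgue_integral_cong) auto
  finally have rhs: "(LINT \<omega>|Q. (LINT s:{0..t}|lborel. ext0 w (X s \<omega>))) = (LINT s:{0..t}|lborel. (LINT x|m. v x * p s w x))" .
  have "(LINT \<omega>|Q. ?Y t \<omega>) = (LINT x|m. v x * p t u x) - (LINT x|m. v x * p 0 u x) -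
     (LINT s:{0..t}|lborel. (LINT x|m. v x * p s w x))"
    using integral_Q(1,2)[OF t u] integral_Q(1,2)[OF order_refl u] iF rhs by simp
  moreover have "(LINT x|m. v x * p 0 u x) = (LINT x|m. v x * u x)"
    using u by (intro Bochner_Integration.integral_cong) (auto simp: p_0)
  moreover have "(LINT x|m. v x * (p t u x - u x)) = (LINT x|m. v x * p t u x) - (LINT x|m. v x * u x)"
    using v_mult_integrable[OF p_integrable[OF t u]] v_mult_integrable[OF u] by (simp add: right_diff_distrib)
  ultimately show ?thesis using zero by simp
qed

end

text \<open>The function w is merely integrable, so the pointwise orbit integrals of bounded
  functions are not at hand. Instead, the densities 1_A / m(A) give the integrated equation tested
  on A, with an error bound independent of A, and \<open>L1_le_set_integrals\<close> turns this into
  an L^1 estimate.\<close>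

lemma generator_of_martingale_problem:
  assumes Y: "\<And>v. v \<in> bounded_Borel \<Longrightarrow> (\<And>x. 0 \<le> v x) \<Longrightarrow> (\<integral>\<^sup>+x. ennreal (v x) \<partial>m) = 1 \<Longrightarrow>
      continuous_martingale (mix F Pr (initial (density m (\<lambda>x. ennreal (v x))))) Ft
      (\<lambda>t \<omega>. ext0 u (X t \<omega>) - ext0 u (X 0 \<omega>) - (LINT s:{0..t}|lborel. ext0 w (X s \<omega>)))"
    and u: "integrable m u" and w: "integrable m w"
  shows "generator 1 m p u w"
proof -
  have set_identity: "(LINT x|m. indicator A x * (p t u x - u x)) = (LINT s:{0..t}|lborel. (LINT x|m. indicator A x * p s w x))"
    if A: "A \<in> sets m" "emeasure m A < \<infinity>" and t: "0 \<le> t" for A t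
  \<comment> \<open>A null set cannot be normalised to a probability density, but there both sides
    vanish.\<close>
  proof (cases "emeasure m A = 0")
    case True
    then have "AE x in m. x \<notin> A" using A by (intro AE_not_in) auto
    then have "(LINT x|m. indicator A x * f x) = 0" for f :: "real^'n \<Rightarrow> real"
      by (intro integral_eq_zero_AE) (auto elim!: eventually_mono)
    then show ?thesis by simp
  next
    case False
    define a where "a = measure m A"
    have a1: "emeasure m A = ennreal a"
      using A(2) unfolding a_def by (intro emeasure_eq_ennreal_measure) simp
    then have "a \<noteq> 0" using False by auto
    then have "a > 0" unfolding a_def using measure_nonneg[of m A] by linarith
    note a = a1 this
    let ?v = "\<lambda>x. indicator A x / a"
    have vb: "?v \<in> borel_measurable borel" using A(1) by (auto simp: sets_m)
    have v1: "(\<integral>\<^sup>+x. ennreal (?v x) \<partial>m) = 1"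
    proof -
      have "(\<integral>\<^sup>+x. ennreal (?v x) \<partial>m) = (\<integral>\<^sup>+x. ennreal (1 / a) * indicator A x \<partial>m)"
        by (intro nn_integral_cong) (auto split: split_indicator)
      also have "\<dots> = ennreal (1 / a) * ennreal a" using A(1) a(1) by (simp add: nn_integral_cmult_indicator)
      also have "\<dots> = 1" using a(2) by (simp add: ennreal_mult[symmetric])
      finally show ?thesis .
    qed
    have vB: "?v \<in> bounded_Borel"
      unfolding bounded_Borel_def using vb a(2) by (auto intro!: boundedI[where B="1 / a"] split: split_indicator)
    have "(LINT x|m. ?v x * (p t u x - u x)) = (LINT s:{0..t}|lborel. (LINT x|m. ?v x * p s w x))"
      using a(2) by (intro martingale_identity[where c="1 / a", OF vb _ _ v1 Y[OF vB _ v1] u w t])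
        (auto split: split_indicator)
    then show ?thesis using a(2) by (simp add: set_lebesgue_integral_def)
  qed
  have bound: "(LINT x|m. \<bar>(p t u x - u x) / t - w x\<bar>) \<le> 2 * \<epsilon>"
    if t: "0 < t" and e: "\<And>s. s \<in> {0..t} \<Longrightarrow> (LINT x|m. \<bar>p s w x - w x\<bar>) \<le> \<epsilon>" for t \<epsilon>
  proof -
    let ?g = "\<lambda>x. p t u x - u x - t * w x"
    have pi: "integrable m (p t u)" using t u by (intro p_integrable) auto
    have gi: "integrable m ?g" using pi u w by auto
    have mult: "integrable m (\<lambda>x. indicator A x * f x)" if "A \<in> sets m" "integrable m f" for A and f :: "real^'n \<Rightarrow> real"
      using integrable_mult_indicator[OF that] by simp
    have "\<bar>LINT x|m. indicator A x * ?g x\<bar> \<le> \<epsilon> * t" if A: "A \<in> sets m" "emeasure m A < \<infinity>" for A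
    proof -
      have hm: "(\<lambda>s. LINT x|m. indicator A x * p s w x) \<in> borel_measurable borel"
      proof -
        have "(\<lambda>z. indicator A (snd z) * (case z of (s, x) \<Rightarrow> p s w x)) \<in> borel_measurable (borel \<Otimes>\<^sub>M m)"
          using A p_measurable2[OF borel_measurable_integrable[OF w]] by measurable
        then have "(\<lambda>(s, x). indicator A x * p s w x) \<in> borel_measurable (borel \<Otimes>\<^sub>M m)"
          by (simp add: case_prod_unfold)
        then show ?thesis by (rule borel_measurable_lebesgue_integral)
      qed
      have pw: "integrable m (p s w)" if "s \<in> {0..t}" for s using that w by (intro p_integrable) auto
      have diff: "(LINT x|m. indicator A x * p s w x) - (LINT x|m. indicator A x * w x) =
        (LINT x|m. indicator A x * (p s w x - w x))" if "s \<in> {0..t}" for s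
        using mult[OF A(1) pw[OF that]] mult[OF A(1) w] by (simp add: right_diff_distrib)
      have dbound: "\<bar>(LINT x|m. indicator A x * p s w x) - (LINT x|m. indicator A x * w x)\<bar> \<le> \<epsilon>" if "s \<in> {0..t}" for s
      proof -
        have "\<bar>LINT x|m. indicator A x * (p s w x - w x)\<bar> \<le> (LINT x|m. \<bar>indicator A x * (p s w x - w x)\<bar>)"
          by (rule integral_abs_bound)
        also have "\<dots> \<le> (LINT x|m. \<bar>p s w x - w x\<bar>)"
          using mult[OF A(1), of "\<lambda>x. p s w x - w x"] pw[OF that] w
          by (intro integral_mono) (auto split: split_indicator)
        also have "\<dots> \<le> \<epsilon>" by (rule e[OF that])
        finally show ?thesis unfolding diff[OF that] .
      qed
      have si: "set_integrable lborel {0..t} (\<lambda>s. LINT x|m. indicator A x * p s w x)"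
        using hm dbound by (intro set_integrable_Icc_bounded[where c="\<epsilon> + \<bar>LINT x|m. indicator A x * w x\<bar>"]) fastforce+
      have ci: "set_integrable lborel {0..t} (\<lambda>s. LINT x|m. indicator A x * w x)"
        by (intro set_integrable_Icc_bounded[where c="\<bar>LINT x|m. indicator A x * w x\<bar>"]) auto
      have "(LINT x|m. indicator A x * ?g x) = (LINT x|m. indicator A x * (p t u x - u x)) - t * (LINT x|m. indicator A x * w x)"
        using mult[OF A(1) pi] mult[OF A(1) u] mult[OF A(1) w] by (simp add: algebra_simps)
      also have "\<dots> = (LINT s:{0..t}|lborel. (LINT x|m. indicator A x * p s w x)) - (LINT s:{0..t}|lborel. (LINT x|m. indicator A x * w x))"
        using set_identity[OF A, of t] t by (simp add: set_lebesgue_integral_def)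
      also have "\<dots> = (LINT s:{0..t}|lborel. (LINT x|m. indicator A x * p s w x) - (LINT x|m. indicator A x * w x))"
        by (rule set_integral_diff(2)[OF si ci, symmetric])
      also have "\<bar>\<dots>\<bar> \<le> \<epsilon> * (t - 0)"
        using hm dbound t by (intro LINT_Icc_bound) auto
      finally show ?thesis by simp
    qed
    then have "(LINT x|m. \<bar>?g x\<bar>) \<le> 2 * (\<epsilon> * t)"
      by (intro L1_le_set_integrals[OF sigma_finite_measure_axioms gi])
    moreover have "(LINT x|m. \<bar>(p t u x - u x) / t - w x\<bar>) = (LINT x|m. \<bar>?g x\<bar>) / t"
    proof -
      have "\<bar>(p t u x - u x) / t - w x\<bar> = \<bar>?g x\<bar> / t" for x
      proof -
        have "(p t u x - u x) / t - w x = ?g x / t" using t by (simp add: field_simps)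
        then show ?thesis using t by (simp only: abs_divide abs_of_pos)
      qed
      then show ?thesis by simp
    qed
    ultimately show ?thesis using t by (simp add: pos_divide_le_eq mult.assoc)
  qed
  have "((\<lambda>t. LINT x|m. \<bar>(p t u x - u x) / t - w x\<bar>) \<longlongrightarrow> 0) (at_right 0)"
  proof (rule tendstoI)
    fix \<epsilon> :: real assume e: "\<epsilon> > 0"
    \<comment> \<open>A quarter, because \<open>bound\<close> doubles it and the final inequality is
      strict.\<close>
    obtain \<delta> where d: "\<delta> > 0" "\<And>t. 0 \<le> t \<Longrightarrow> t < \<delta> \<Longrightarrow> (LINT x|m. \<bar>p t w x - w x\<bar>) < \<epsilon> / 4"
      using strongly_continuous_ex[OF w, of "\<epsilon> / 4"] e by auto
    have "dist (LINT x|m. \<bar>(p t u x - u x) / t - w x\<bar>) 0 < \<epsilon>" if t: "0 < t" "t < \<delta>" for t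
    proof -
      have "(LINT x|m. \<bar>p s w x - w x\<bar>) \<le> \<epsilon> / 4" if "s \<in> {0..t}" for s
        using d(2)[of s] that t by auto
      then have "(LINT x|m. \<bar>(p t u x - u x) / t - w x\<bar>) \<le> 2 * (\<epsilon> / 4)" by (rule bound[OF t(1)])
      then have "(LINT x|m. \<bar>(p t u x - u x) / t - w x\<bar>) < \<epsilon>" using e by linarith
      then show ?thesis unfolding dist_real_def by (subst abs_of_nonneg) auto
    qed
    then show "\<forall>\<^sub>F t in at_right 0. dist (LINT x|m. \<bar>(p t u x - u x) / t - w x\<bar>) 0 < \<epsilon>"
      using d(1) unfolding eventually_at_right_field by auto
  qed
  moreover have "\<forall>\<^sub>F t in at_right 0. integrable m (\<lambda>x. (p t u x - u x) / t)"
    using eventually_at_right_less[of 0] by eventually_elim (use p_integrable u in auto)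
  ultimately show ?thesis unfolding generator_def Lp_mem_1 Lp_conv_1 using u w by auto
qed

end

section \<open>Path laws\<close>

context right_proc
begin

text \<open>Conditioning on the past up to the second largest time s removes the latest time b: its
  factor becomes a function of X s and is merged into the factor at s. This is why general
  functions, not just indicators, are carried along.\<close>

lemma fdd_step:
  fixes f :: "real \<Rightarrow> (real^'n) option \<Rightarrow> ennreal"
  assumes J: "finite J" "J \<noteq> {}" "J \<subseteq> {0..}" and b: "\<And>j. j \<in> J \<Longrightarrow> j < b"
    and f: "\<And>j. j \<in> insert b J \<Longrightarrow> f j \<in> borel_measurable Delta_borel"
  defines "s \<equiv> Max J"
  shows "(\<integral>\<^sup>+\<omega>. (\<Prod>j\<in>insert b J. f j (X j \<omega>)) \<partial>Pr z) =
    (\<integral>\<^sup>+\<omega>. (\<Prod>j\<in>J. (f(s := \<lambda>y. f s y * (\<integral>\<^sup>+y'. f b y' \<partial>K (b - s) y))) j (X j \<omega>)) \<partial>Pr z)"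
proof -
  have sJ: "s \<in> J" unfolding s_def using J by simp
  have s0: "0 \<le> s" using sJ J by auto
  have sb: "s < b" using b sJ .
  have bJ: "b \<notin> J" using b by blast
  let ?Z = "\<lambda>\<omega>. \<Prod>j\<in>J. f j (X j \<omega>)"
  have Z: "?Z \<in> borel_measurable (Ft s)"
  proof (rule borel_measurable_prod_ennreal)
    fix j assume j: "j \<in> J"
    then have js: "0 \<le> j" "j \<le> s" using J unfolding s_def by auto
    have "subalgebra (Ft s) (Ft j)"
      unfolding subalgebra_def using js s0 mono_Ft by (simp add: space_Ft)
    then show "(\<lambda>\<omega>. f j (X j \<omega>)) \<in> borel_measurable (Ft s)"
      using measurable_from_subalg measurable_compose[OF adapted[OF js(1)] f[of j]] j by blast
  qed
  have "(\<integral>\<^sup>+\<omega>. (\<Prod>j\<in>insert b J. f j (X j \<omega>)) \<partial>Pr z) = (\<integral>\<^sup>+\<omega>. ?Z \<omega> * f b (X (s + (b - s)) \<omega>) \<partial>Pr z)"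
    using J bJ by (simp add: mult.commute)
  also have "\<dots> = (\<integral>\<^sup>+\<omega>. ?Z \<omega> * (\<integral>\<^sup>+y. f b y \<partial>K (b - s) (X s \<omega>)) \<partial>Pr z)"
    using s0 sb f Z by (intro markov_function) auto
  also have "\<dots> = (\<integral>\<^sup>+\<omega>. (\<Prod>j\<in>J. (f(s := \<lambda>y. f s y * (\<integral>\<^sup>+y'. f b y' \<partial>K (b - s) y))) j (X j \<omega>)) \<partial>Pr z)"
  proof (intro nn_integral_cong)
    fix \<omega>
    let ?f = "f(s := \<lambda>y. f s y * (\<integral>\<^sup>+y'. f b y' \<partial>K (b - s) y))"
    have "(\<Prod>j\<in>J. ?f j (X j \<omega>)) = ?f s (X s \<omega>) * (\<Prod>j\<in>J - {s}. ?f j (X j \<omega>))"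
      using J sJ by (intro prod.remove) auto
    also have "(\<Prod>j\<in>J - {s}. ?f j (X j \<omega>)) = (\<Prod>j\<in>J - {s}. f j (X j \<omega>))"
      by (intro prod.cong) auto
    also have "?f s (X s \<omega>) * (\<Prod>j\<in>J - {s}. f j (X j \<omega>)) =
        (f s (X s \<omega>) * (\<Prod>j\<in>J - {s}. f j (X j \<omega>))) * (\<integral>\<^sup>+y. f b y \<partial>K (b - s) (X s \<omega>))"
      by (simp add: mult_ac)
    also have "f s (X s \<omega>) * (\<Prod>j\<in>J - {s}. f j (X j \<omega>)) = ?Z \<omega>"
      using J sJ by (intro prod.remove[symmetric]) auto
    finally show "?Z \<omega> * (\<integral>\<^sup>+y. f b y \<partial>K (b - s) (X s \<omega>)) = (\<Prod>j\<in>J. ?f j (X j \<omega>))" by simp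
  qed
  finally show ?thesis .
qed

lemma emeasure_path_law:
  assumes J: "finite J" "J \<subseteq> {0..}" and A: "\<And>j. j \<in> J \<Longrightarrow> A j \<in> sets Delta_borel"
  shows "emeasure (path_law X (Pr z)) (prod_emb {0..} (\<lambda>_. Delta_borel) J (Pi\<^sub>E J A)) =
    (\<integral>\<^sup>+\<omega>. (\<Prod>j\<in>J. indicator (A j) (X j \<omega>)) \<partial>Pr z)"
proof -
  have meas: "(\<lambda>\<omega>. \<lambda>t\<in>{0..}. X t \<omega>) \<in> Pr z \<rightarrow>\<^sub>M Pi\<^sub>M {0..} (\<lambda>_. Delta_borel)"
    by (rule measurable_restrict) (simp add: X_measurable_Pr)
  have E: "prod_emb {0..} (\<lambda>_. Delta_borel) J (Pi\<^sub>E J A) \<in> sets (Pi\<^sub>M {0..} (\<lambda>_. Delta_borel))"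
    using J A by (intro sets_PiM_I) auto
  have "emeasure (path_law X (Pr z)) (prod_emb {0..} (\<lambda>_. Delta_borel) J (Pi\<^sub>E J A)) =
      (\<integral>\<^sup>+\<omega>. indicator (prod_emb {0..} (\<lambda>_. Delta_borel) J (Pi\<^sub>E J A)) (\<lambda>t\<in>{0..}. X t \<omega>) \<partial>Pr z)"
    unfolding path_law_def using E meas
      nn_integral_distr[OF meas, of "indicator (prod_emb {0..} (\<lambda>_. Delta_borel) J (Pi\<^sub>E J A))"] by simp
  also have "\<dots> = (\<integral>\<^sup>+\<omega>. (\<Prod>j\<in>J. indicator (A j) (X j \<omega>)) \<partial>Pr z)"
  proof (intro nn_integral_cong)
    fix \<omega>
    have r: "restrict (\<lambda>t\<in>{0..}. X t \<omega>) J = (\<lambda>t\<in>J. X t \<omega>)" using J by (auto simp: fun_eq_iff)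
    have "(\<lambda>t\<in>{0..}. X t \<omega>) \<in> prod_emb {0..} (\<lambda>_. Delta_borel) J (Pi\<^sub>E J A) \<longleftrightarrow> (\<forall>j\<in>J. X j \<omega> \<in> A j)"
      unfolding prod_emb_def using r by (auto simp: PiE_iff)
    moreover have "(\<Prod>j\<in>J. indicator (A j) (X j \<omega>) :: ennreal) = (if \<forall>j\<in>J. X j \<omega> \<in> A j then 1 else 0)"
    proof (cases "\<forall>j\<in>J. X j \<omega> \<in> A j")
      case False
      then obtain j where "j \<in> J" "X j \<omega> \<notin> A j" by blast
      then show ?thesis using J(1) False by (simp only: if_False) (auto intro!: prod_zero bexI[of _ j])
    qed (auto intro!: prod.neutral)
    ultimately show "indicator (prod_emb {0..} (\<lambda>_. Delta_borel) J (Pi\<^sub>E J A)) (\<lambda>t\<in>{0..}. X t \<omega>) =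
        (\<Prod>j\<in>J. indicator (A j) (X j \<omega>) :: ennreal)" by (simp add: indicator_def)
  qed
  finally show ?thesis .
qed

lemma prob_path_law: "prob_space (path_law X (Pr z))"
  unfolding path_law_def
  by (intro prob_space.prob_space_distr prob_Pr measurable_restrict) (simp add: X_measurable_Pr)

lemma emeasure_K_Some:
  assumes "0 \<le> t" "B \<in> sets borel"
  shows "emeasure (K t (Some x)) (Some ` B) = ennreal (transition X Pr t (indicator B) x)"
proof -
  interpret prob_space "K t (Some x)" using assms(1) by (rule prob_K)
  have "transition X Pr t (indicator B) x = (\<integral>z. ext0 (indicator B) z \<partial>K t (Some x))"
    unfolding K_def transition_def using assms
    by (intro integral_distr[symmetric] X_measurable_Pr ext0_measurable) auto
  also have "\<dots> = (\<integral>z. indicator (Some ` B) z \<partial>K t (Some x))"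
    by (intro Bochner_Integration.integral_cong) (auto simp: ext0_def split: option.split split_indicator)
  also have "\<dots> = measure (K t (Some x)) (Some ` B)"
    using Some_image_Delta_borel[OF assms(2)] by simp
  finally show ?thesis by (simp add: emeasure_eq_measure)
qed

end

text \<open>The transition function tests only functions that vanish at \<open>None\<close>. The
  mass at \<open>None\<close> is recovered by passing to complements, since the kernels are
  probability measures.\<close>

lemma K_eq_if_transition_eq:
  assumes "right_process F Ft X Pr" "right_process F' Ft' X' Pr'"
    and eq: "\<And>f x. f \<in> bounded_Borel \<Longrightarrow> transition X' Pr' t f x = transition X Pr t f x"
    and t: "0 \<le> t"
  shows "right_proc.K X' Pr' t z = right_proc.K X Pr t z"
proof -
  interpret A: right_proc F Ft X Pr by unfold_locales fact
  interpret B: right_proc F' Ft' X' Pr' by unfold_locales fact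
  show ?thesis
  proof (cases z)
    case None
    then show ?thesis using t by (simp add: A.K_None B.K_None)
  next
    case (Some x)
    have S: "emeasure (B.K t (Some x)) (Some ` C) = emeasure (A.K t (Some x)) (Some ` C)" if C: "C \<in> sets borel" for C
    proof -
      have "indicator C \<in> bounded_Borel"
        unfolding bounded_Borel_def using C by (auto intro!: boundedI[where B=1] split: split_indicator)
      then show ?thesis using eq[of "indicator C" x] t C by (simp add: A.emeasure_K_Some B.emeasure_K_Some)
    qed
    have N: "emeasure (B.K t (Some x)) D = emeasure (A.K t (Some x)) D" if D: "D \<in> sets Delta_borel" "None \<notin> D" for D
    proof -
      have "D = Some ` (Some -` D)"
      proof (intro set_eqI)
        fix y show "y \<in> D \<longleftrightarrow> y \<in> Some ` (Some -` D)" using D(2) by (cases y) auto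
      qed
      then show ?thesis using S[of "Some -` D"] D(1) by (simp only: sets_Delta_borel)
    qed
    have "B.K t (Some x) = A.K t (Some x)"
    proof (rule measure_eqI)
      fix D assume "D \<in> sets (B.K t (Some x))"
      then have D: "D \<in> sets Delta_borel" by simp
      show "emeasure (B.K t (Some x)) D = emeasure (A.K t (Some x)) D"
      proof (cases "None \<in> D")
        case True
        interpret PA: prob_space "A.K t (Some x)" by (rule A.prob_K[OF t])
        interpret PB: prob_space "B.K t (Some x)" by (rule B.prob_K[OF t])
        have c: "UNIV - D \<in> sets Delta_borel" using sets.compl_sets[OF D] by simp
        then have "emeasure (B.K t (Some x)) (UNIV - D) = emeasure (A.K t (Some x)) (UNIV - D)"
          using True by (intro N) auto
        then have "PB.prob (UNIV - D) = PA.prob (UNIV - D)" by (simp add: measure_def)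
        then have "PB.prob D = PA.prob D"
          using PA.prob_compl[of D] PB.prob_compl[of D] D by simp
        then show ?thesis by (simp add: PA.emeasure_eq_measure PB.emeasure_eq_measure)
      qed (use N D in simp)
    qed simp
    then show ?thesis using Some by simp
  qed
qed

lemma path_law_eq_if_transition_eq:
  fixes X :: "real \<Rightarrow> 'w \<Rightarrow> (real^'n::finite) option" and X' :: "real \<Rightarrow> 'v \<Rightarrow> (real^'n) option"
  assumes "right_process F Ft X Pr" "right_process F' Ft' X' Pr'"
    and eq: "\<And>t f x. 0 \<le> t \<Longrightarrow> f \<in> bounded_Borel \<Longrightarrow> transition X' Pr' t f x = transition X Pr t f x"
  shows "path_law X' (Pr' z) = path_law X (Pr z)"
proof -
  interpret A: right_proc F Ft X Pr by unfold_locales fact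
  interpret B: right_proc F' Ft' X' Pr' by unfold_locales fact
  have K: "B.K t z = A.K t z" if "0 \<le> t" for t z
    using K_eq_if_transition_eq[OF assms(1,2) eq[OF that] that] .
  \<comment> \<open>Induction removes the largest time; f stays arbitrary because each removal
    changes the factor at the preceding time.\<close>
  have fdd: "(\<integral>\<^sup>+\<omega>. (\<Prod>j\<in>J. f j (X' j \<omega>)) \<partial>Pr' z) = (\<integral>\<^sup>+\<omega>. (\<Prod>j\<in>J. f j (X j \<omega>)) \<partial>Pr z)"
    if "finite J" "J \<subseteq> {0..}" "\<And>j. j \<in> J \<Longrightarrow> f j \<in> borel_measurable Delta_borel" for J f
    using that
  proof (induction J arbitrary: f rule: finite_linorder_max_induct)
    case empty
    show ?case
      using prob_space.emeasure_space_1[OF A.prob_Pr] prob_space.emeasure_space_1[OF B.prob_Pr] by simp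
  next
    case (insert b J)
    have b: "0 \<le> b" "f b \<in> borel_measurable Delta_borel" using insert.prems by auto
    show ?case
    proof (cases "J = {}")
      case True
      then show ?thesis
        using A.nn_integral_K[OF b, of z] B.nn_integral_K[OF b, of z] K[OF b(1)] by simp
    next
      case False
      define s where "s = Max J"
      define f' where "f' = f(s := \<lambda>y. f s y * (\<integral>\<^sup>+y'. f b y' \<partial>A.K (b - s) y))"
      have sJ: "s \<in> J" unfolding s_def using insert.hyps(1) False by simp
      then have bs: "0 \<le> b - s" using insert.hyps(2) by (simp add: less_imp_le)
      have "f' = f(s := \<lambda>y. f s y * (\<integral>\<^sup>+y'. f b y' \<partial>B.K (b - s) y))"
        unfolding f'_def K[OF bs] ..
      then have "(\<integral>\<^sup>+\<omega>. (\<Prod>j\<in>insert b J. f j (X' j \<omega>)) \<partial>Pr' z) = (\<integral>\<^sup>+\<omega>. (\<Prod>j\<in>J. f' j (X' j \<omega>)) \<partial>Pr' z)"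
        using B.fdd_step[OF insert.hyps(1) False, of b f z] insert.hyps(2) insert.prems unfolding s_def by simp
      also have "\<dots> = (\<integral>\<^sup>+\<omega>. (\<Prod>j\<in>J. f' j (X j \<omega>)) \<partial>Pr z)"
      proof (rule insert.IH)
        show "f' j \<in> borel_measurable Delta_borel" if "j \<in> J" for j
          unfolding f'_def using that insert.prems(2) sJ A.nn_integral_K_measurable[OF bs b(2)] by auto
      qed (use insert.prems in auto)
      also have "\<dots> = (\<integral>\<^sup>+\<omega>. (\<Prod>j\<in>insert b J. f j (X j \<omega>)) \<partial>Pr z)"
        using A.fdd_step[OF insert.hyps(1) False, of b f z] insert.hyps(2) insert.prems
        unfolding s_def f'_def by simp
      finally show ?thesis .
    qed
  qed
  show ?thesis
  proof (rule measure_eqI_PiM_infinite[where I="{0..}" and M="\<lambda>_. Delta_borel"])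
    show "sets (path_law X' (Pr' z)) = sets (Pi\<^sub>M {0..} (\<lambda>_. Delta_borel))"
      "sets (path_law X (Pr z)) = sets (Pi\<^sub>M {0..} (\<lambda>_. Delta_borel))"
      by (simp_all add: path_law_def)
    show "finite_measure (path_law X' (Pr' z))"
      using B.prob_path_law by (simp add: prob_space_def)
    fix S and J :: "real set"
    assume J: "finite J" "J \<subseteq> {0..}" and S: "\<And>j. j \<in> J \<Longrightarrow> S j \<in> sets (Delta_borel :: (real^'n) option measure)"
    have "emeasure (path_law X' (Pr' z)) (prod_emb {0..} (\<lambda>_. Delta_borel) J (Pi\<^sub>E J S)) =
        (\<integral>\<^sup>+\<omega>. (\<Prod>j\<in>J. indicator (S j) (X' j \<omega>)) \<partial>Pr' z)"
      by (rule B.emeasure_path_law[OF J S])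
    also have "\<dots> = (\<integral>\<^sup>+\<omega>. (\<Prod>j\<in>J. indicator (S j) (X j \<omega>)) \<partial>Pr z)"
      using S by (intro fdd[of J "\<lambda>j. indicator (S j)"] J borel_measurable_indicator)
    also have "\<dots> = emeasure (path_law X (Pr z)) (prod_emb {0..} (\<lambda>_. Delta_borel) J (Pi\<^sub>E J S))"
      by (rule A.emeasure_path_law[OF J S, symmetric])
    finally show "emeasure (path_law X' (Pr' z)) (prod_emb {0..} (\<lambda>_. Delta_borel) J (Pi\<^sub>E J S)) =
      emeasure (path_law X (Pr z)) (prod_emb {0..} (\<lambda>_. Delta_borel) J (Pi\<^sub>E J S))" .
  qed
qed

section \<open>Continuous versions, finiteness of m on balls, cut-off functions\<close>

lemma continuous_AE_eq_imp_eq: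
  fixes f g :: "real^'n::finite \<Rightarrow> real"
  assumes f: "continuous_on UNIV f" and g: "continuous_on UNIV g"
    and eq: "AE x in lborel. f x = g x"
  shows "f x = g x"
proof (rule ccontr)
  assume "f x \<noteq> g x"
  then have ne: "{x. f x \<noteq> g x} \<noteq> {}" by auto
  have op: "open {x. f x \<noteq> g x}" by (rule open_Collect_neq[OF f g])
  have "{x \<in> space lborel. \<not> f x = g x} \<in> null_sets lborel"
    using eq op by (subst AE_iff_null[symmetric]) auto
  then have "negligible {x. f x \<noteq> g x}"
    by (simp add: negligible_iff_null_sets null_sets_completionI)
  then show False using open_not_negligible[OF op ne] by simp
qed

lemma emeasure_m_of_ball:
  fixes \<rho> :: "real^'n::finite \<Rightarrow> real"
  assumes "continuous_on UNIV \<rho>"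
  shows "emeasure (m_of \<rho>) (ball 0 r) < \<infinity>"
proof -
  have \<rho>: "\<rho> \<in> borel_measurable borel" using assms by (rule borel_measurable_continuous_onI)
  have "compact (\<rho> ` cball 0 r)"
    using assms by (intro compact_continuous_image) (auto intro: continuous_on_subset)
  then obtain C where C: "\<And>x. x \<in> cball 0 r \<Longrightarrow> \<bar>\<rho> x\<bar> \<le> C"
    using compact_imp_bounded[of "\<rho> ` cball 0 r"] unfolding bounded_iff by force
  have "emeasure (m_of \<rho>) (ball 0 r) = (\<integral>\<^sup>+x. ennreal (\<rho> x) * indicator (ball (0 :: real^'n) r) x \<partial>lborel)"
    unfolding m_of_def using \<rho> by (intro emeasure_density) auto
  also have "\<dots> \<le> (\<integral>\<^sup>+x. ennreal C * indicator (ball (0 :: real^'n) r) x \<partial>lborel)"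
  proof (intro nn_integral_mono)
    fix x :: "real^'n" show "ennreal (\<rho> x) * indicator (ball 0 r) x \<le> ennreal C * indicator (ball 0 r) x"
      using C[of x] by (auto split: split_indicator intro!: ennreal_leI)
  qed
  also have "\<dots> = ennreal C * emeasure lborel (ball (0 :: real^'n) r)"
    by (intro nn_integral_cmult_indicator) simp
  also have "\<dots> < \<infinity>" using emeasure_bounded_finite[of "ball (0 :: real^'n) r"] by (simp add: ennreal_mult_less_top)
  finally show ?thesis .
qed

text \<open>Equality of the transition functions is obtained first for functions that are also
  integrable. Bounded functions, such as constants, may fail to be integrable and are reached by
  this pointwise limit.\<close>

lemma transition_ball_tendsto:
  assumes "right_process F Ft X Pr" and f: "f \<in> bounded_Borel" and t: "0 \<le> t"
  shows "(\<lambda>n. transition X Pr t (\<lambda>y. f y * indicator (ball 0 (real n)) y) x) \<longlonglongrightarrow> transition X Pr t f x"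
proof -
  interpret right_proc F Ft X Pr by unfold_locales fact
  interpret prob_space "Pr (Some x)" by (rule prob_Pr)
  have fb: "f \<in> borel_measurable borel" using f unfolding bounded_Borel_def by simp
  obtain C where C: "\<And>y. \<bar>f y\<bar> \<le> C" using f unfolding bounded_Borel_def bounded_iff by auto
  have C0: "C \<ge> 0" using C[of 0] by simp
  show ?thesis
    unfolding transition_def
  proof (rule integral_dominated_convergence[where w="\<lambda>_. C"])
    show "(\<lambda>\<omega>. ext0 f (X t \<omega>)) \<in> borel_measurable (Pr (Some x))"
      by (intro measurable_compose[OF X_measurable_Pr[OF t] ext0_measurable[OF fb]])
    show "(\<lambda>\<omega>. ext0 (\<lambda>y. f y * indicator (ball 0 (real n)) y) (X t \<omega>)) \<in> borel_measurable (Pr (Some x))" for n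
    proof (rule measurable_compose[OF X_measurable_Pr[OF t] ext0_measurable])
      show "(\<lambda>y. f y * indicator (ball 0 (real n)) y) \<in> borel_measurable borel"
        by (intro borel_measurable_times fb borel_measurable_indicator) simp
    qed
    show "AE \<omega> in Pr (Some x). (\<lambda>n. ext0 (\<lambda>y. f y * indicator (ball 0 (real n)) y) (X t \<omega>)) \<longlonglongrightarrow> ext0 f (X t \<omega>)"
    proof (rule AE_I2)
      fix \<omega>
      show "(\<lambda>n. ext0 (\<lambda>y. f y * indicator (ball 0 (real n)) y) (X t \<omega>)) \<longlonglongrightarrow> ext0 f (X t \<omega>)"
      proof (cases "X t \<omega>")
        case (Some y)
        obtain N where N: "norm y < real N" using reals_Archimedean2 by blast
        have "\<forall>\<^sub>F n in sequentially. ext0 (\<lambda>y. f y * indicator (ball 0 (real n)) y) (X t \<omega>) = ext0 f (X t \<omega>)"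
          using eventually_ge_at_top[of N] by eventually_elim (use N Some in \<open>simp add: ext0_def\<close>)
        then show ?thesis by (rule tendsto_eventually)
      qed (simp add: ext0_def)
    qed
    show "AE \<omega> in Pr (Some x). norm (ext0 (\<lambda>y. f y * indicator (ball 0 (real n)) y) (X t \<omega>)) \<le> C" for n
      using C C0 by (intro AE_I2) (auto simp: ext0_def split: option.split split_indicator)
  qed auto
qed

section \<open>Identification with the given semigroup and invariance\<close>

context subinvariant_right_proc
begin

lemma transition_eq_semigroup_AE:
  assumes T: "C0_semigroup 1 m T" "extends_L A G m T" and uniq: "L1_unique A G m"
    and mp: "solves_martingale_problem A G m F Ft X Pr"
  shows p_extends_L: "extends_L A G m p"
    and p_eq_T_AE: "0 \<le> t \<Longrightarrow> integrable m f \<Longrightarrow> AE x in m. p t f x = T t f x"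
proof -
  show ext: "extends_L A G m p"
    unfolding extends_L_def
  proof
    fix u :: "real^'n \<Rightarrow> real" assume u: "u \<in> test_functions UNIV"
    then have "generator 1 m T u (L_op A G u)" using T(2) unfolding extends_L_def by blast
    then have i: "integrable m u" "integrable m (L_op A G u)"
      unfolding generator_def Lp_mem_1 Lp_conv_1 by auto
    have "m_version m (L_op A G u) (L_op A G u)"
      unfolding m_version_def using i(2) by auto
    with mp u show "generator 1 m p u (L_op A G u)"
      unfolding solves_martingale_problem_def by (intro generator_of_martingale_problem i) blast
  qed
  have C0: "C0_semigroup 1 m p" by (rule C0_semigroup_p[OF strongly_continuous])
  obtain S where S: "\<And>S' t f. C0_semigroup 1 m S' \<Longrightarrow> extends_L A G m S' \<Longrightarrow> 0 \<le> t \<Longrightarrow> Lp_mem 1 m f \<Longrightarrow>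
      AE x in m. S' t f x = S t f x"
    using uniq unfolding L1_unique_def by blast
  show "AE x in m. p t f x = T t f x" if "0 \<le> t" "integrable m f"
  proof -
    have "AE x in m. p t f x = S t f x" "AE x in m. T t f x = S t f x"
      using S[OF C0 ext that(1), of f] S[OF T that(1), of f] that(2) by (simp_all add: Lp_mem_1)
    then show ?thesis by eventually_elim simp
  qed
qed

lemma mass_conserved:
  assumes T: "C0_semigroup 1 m T" "extends_L A G m T" and uniq: "L1_unique A G m"
    and mp: "solves_martingale_problem A G m F Ft X Pr"
    and L0: "\<And>u. u \<in> test_functions UNIV \<Longrightarrow> (LINT x|m. L_op A G u x) = 0"
    and f: "integrable m f" "\<And>x. \<bar>f x\<bar> \<le> c" "\<And>x. 0 \<le> f x" and t: "0 \<le> t"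
  shows "(LINT x|m. p t f x) = (LINT x|m. f x)"
\<comment> \<open>The reinjection argument needs a nonzero integral. If it is 0, then f has norm 0,
  being nonnegative, and contraction suffices.\<close>
proof (cases "(LINT x|m. f x) = 0")
  case True
  have "(LINT x|m. \<bar>p t f x\<bar>) \<le> (LINT x|m. \<bar>f x\<bar>)" by (rule p_contraction[OF t f(1)])
  then have "(LINT x|m. \<bar>p t f x\<bar>) \<le> 0" using f(3) True by simp
  then have "(LINT x|m. p t f x) = 0" using integral_abs_bound[of m "p t f"] by linarith
  then show ?thesis using True by simp
next
  case False
  let ?D = "{(u, L_op A G u) |u. u \<in> test_functions UNIV}"
  note ext = p_extends_L[OF T uniq mp]
  have C0: "C0_semigroup 1 m p" by (rule C0_semigroup_p[OF strongly_continuous])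
  obtain S where S: "\<And>S' t f. C0_semigroup 1 m S' \<Longrightarrow> extends_L A G m S' \<Longrightarrow> 0 \<le> t \<Longrightarrow> Lp_mem 1 m f \<Longrightarrow>
      AE x in m. S' t f x = S t f x"
    using uniq unfolding L1_unique_def by blast
  show ?thesis
  proof (rule mass_conserved_if_unique[where D="?D" and c=c])
    show "generator 1 m p u w" "(LINT x|m. w x) = 0" if "(u, w) \<in> ?D" for u w
      using that ext L0 unfolding extends_L_def by auto
    show "AE x in m. S' t f x = p t f x"
      if S': "C0_semigroup 1 m S'" "\<And>u w. (u, w) \<in> ?D \<Longrightarrow> generator 1 m S' u w" and t: "0 \<le> t" and f: "integrable m f" for S' t f
    proof -
      have "extends_L A G m S'" unfolding extends_L_def using S'(2) by blast
      then have "AE x in m. S' t f x = S t f x" "AE x in m. p t f x = S t f x"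
        using S[OF S'(1) _ t, of f] S[OF C0 ext t, of f] f by (simp_all add: Lp_mem_1)
      then show ?thesis by eventually_elim simp
    qed
  qed (use f False t in auto)
qed

text \<open>\<open>T_Lr\<close> ties g to \<open>T t\<close> only through some sequence
  approximating f. Along it \<open>T t\<close> and \<open>p t\<close> agree, and contractivity
  carries \<open>p t\<close> to the limit.\<close>

lemma T_Lr_1_AE:
  assumes T: "\<And>f. integrable m f \<Longrightarrow> AE x in m. p t f x = T t f x" and t: "0 \<le> t"
    and fg: "T_Lr m T 1 t f g"
  shows "AE x in m. p t f x = g x"
proof -
  obtain fs where fs: "\<And>n. integrable m (fs n)" and f: "integrable m f" and g: "integrable m g"
    and lim: "(\<lambda>n. LINT x|m. \<bar>fs n x - f x\<bar>) \<longlonglongrightarrow> 0" "(\<lambda>n. LINT x|m. \<bar>T t (fs n) x - g x\<bar>) \<longlonglongrightarrow> 0"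
    and ev: "\<forall>\<^sub>F n in sequentially. integrable m (T t (fs n))"
    using fg unfolding T_Lr_def Lp_mem_1 Lp_conv_1 by auto
  have pi: "integrable m (p t f)" "integrable m (p t (fs n))" for n using t f fs by (auto intro: p_integrable)
  have le: "\<forall>\<^sub>F n in sequentially. (LINT x|m. \<bar>p t f x - g x\<bar>) \<le> (LINT x|m. \<bar>fs n x - f x\<bar>) + (LINT x|m. \<bar>T t (fs n) x - g x\<bar>)"
    using ev
  proof eventually_elim
    case (elim n)
    have "(LINT x|m. \<bar>p t f x - g x\<bar>) \<le> (LINT x|m. \<bar>p t f x - p t (fs n) x\<bar>) + (LINT x|m. \<bar>p t (fs n) x - g x\<bar>)"
      by (rule L1_triangle[OF pi g])
    also have "(LINT x|m. \<bar>p t f x - p t (fs n) x\<bar>) \<le> (LINT x|m. \<bar>f x - fs n x\<bar>)"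
      by (rule p_L1_dist[OF t f fs])
    also have "\<dots> = (LINT x|m. \<bar>fs n x - f x\<bar>)" by (simp add: abs_minus_commute)
    also have "(LINT x|m. \<bar>p t (fs n) x - g x\<bar>) = (LINT x|m. \<bar>T t (fs n) x - g x\<bar>)"
    proof (rule integral_cong_AE)
      show "AE x in m. \<bar>p t (fs n) x - g x\<bar> = \<bar>T t (fs n) x - g x\<bar>"
        using T[OF fs[of n]] by eventually_elim simp
      show "(\<lambda>x. \<bar>p t (fs n) x - g x\<bar>) \<in> borel_measurable m"
        "(\<lambda>x. \<bar>T t (fs n) x - g x\<bar>) \<in> borel_measurable m"
        using pi(2)[of n] g elim by auto
    qed
    finally show ?case by simp
  qed
  have "(LINT x|m. \<bar>p t f x - g x\<bar>) \<le> 0"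
    using tendsto_add[OF lim] le by (intro tendsto_lowerbound) auto
  then show ?thesis using pi(1) g by (intro L1_eq_0_AE) (auto intro: antisym)
qed

end

theorem proposition4p8:
  fixes p :: real
    and A C :: "real^'n::finite \<Rightarrow> real^'n^'n"
    and H G :: "real^'n \<Rightarrow> real^'n"
    and \<rho> :: "real^'n \<Rightarrow> real"
    and m :: "(real^'n) measure"
    and T P :: "real \<Rightarrow> (real^'n \<Rightarrow> real) \<Rightarrow> real^'n \<Rightarrow> real"
    and F :: "'w measure" and Ft :: "real \<Rightarrow> 'w measure"
    and X :: "real \<Rightarrow> 'w \<Rightarrow> (real^'n) option" and Pr :: "(real^'n) option \<Rightarrow> 'w measure"
    and F' :: "'v measure" and Ft' :: "real \<Rightarrow> 'v measure"
    and X' :: "real \<Rightarrow> 'v \<Rightarrow> (real^'n) option" and Pr' :: "(real^'n) option \<Rightarrow> 'v measure"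
  assumes dim: "CARD('n) \<ge> 2"
    and a: "assumption_a p A C H"
    and G: "G = drift A C H"
    and b: "assumption_b p G"
    and rho: "density_function p A G \<rho>"
    and m: "m = m_of \<rho>"
    and T: "stannat_semigroup A G \<rho> T"
    and P: "continuous_version_of m T P"
    and M: "hunt_process F Ft X Pr" "continuous_paths F X" "has_transition_semigroup X Pr P"
    and Ft': "Ft' = natural_filtration F' X' Pr'"
    and M': "right_process F' Ft' X' Pr'"
            "solves_martingale_problem A G m F' Ft' X' Pr'"
            "sub_invariant m X' Pr'"
    and uniq: "L1_unique A G m"
  shows "((\<forall>f\<in>bounded_Borel. Lp_mem 1 m f \<longrightarrow>
             (\<forall>t\<ge>0. m_version m (T t f) (transition X' Pr' t f))) \<and>
          invariant m X' Pr') \<and>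
         (strong_Feller X' Pr' \<longrightarrow>
             (\<forall>x. path_law X' (Pr' (Some x)) = path_law X (Pr (Some x))))"
proof -
  have \<rho>c: "continuous_on UNIV \<rho>" and \<rho>0: "\<And>x. \<rho> x > 0"
    and \<rho>L: "\<And>\<phi>. \<phi> \<in> test_functions UNIV \<Longrightarrow> (LINT x|lborel. L_op A G \<phi> x * \<rho> x) = 0"
    using rho unfolding density_function_def by auto
  have \<rho>b: "\<rho> \<in> borel_measurable borel" using \<rho>c by (rule borel_measurable_continuous_onI)
  have T0: "C0_semigroup 1 m T" "extends_L A G m T"
    using T unfolding stannat_semigroup_def Let_def m by blast+
  interpret X': subinvariant_right_proc F' Ft' X' Pr' m
  proof
    show "right_process F' Ft' X' Pr'" by (rule M'(1))
    show "sets m = sets borel" unfolding m m_of_def by simp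
    show "emeasure m (ball 0 r) < \<infinity>" for r unfolding m by (rule emeasure_m_of_ball[OF \<rho>c])
    show "sub_invariant m X' Pr'" by (rule M'(3))
  qed
  have X_right: "right_process F Ft X Pr" using M(1) unfolding hunt_process_def by blast
  have pT: "AE x in m. X'.p t f x = T t f x" if "0 \<le> t" "integrable m f" for t f
    by (rule X'.p_eq_T_AE[OF T0 uniq M'(2) that])
  have tr: "transition X' Pr' t f = X'.p t f" if "f \<in> bounded_Borel" "0 \<le> t" for t f
    using that X'.p_eq_transition[of f t] unfolding bounded_Borel_def by auto
  \<comment> \<open>The equation for \<rho> is stated with Lebesgue measure. The change of measure
    needs \<open>L_op A G u\<close> to be measurable, which is known because it is a generator value
    of T.\<close>
  have L0: "(LINT x|m. L_op A G u x) = 0" if u: "u \<in> test_functions UNIV" for u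
  proof -
    have "generator 1 m T u (L_op A G u)" using T0(2) u unfolding extends_L_def by blast
    then have "integrable m (L_op A G u)" unfolding generator_def Lp_conv_1 by auto
    then have "L_op A G u \<in> borel_measurable borel"
      using X'.measurable_m[of borel] by (auto dest: borel_measurable_integrable)
    then have "(LINT x|m. L_op A G u x) = (LINT x|lborel. \<rho> x *\<^sub>R L_op A G u x)"
      unfolding m m_of_def using \<rho>b \<rho>0 by (intro integral_density) (auto intro: less_imp_le)
    then show ?thesis using \<rho>L[OF u] by (simp add: mult.commute)
  qed
  have version: "m_version m (T t f) (transition X' Pr' t f)"
    if f: "f \<in> bounded_Borel" "Lp_mem 1 m f" and t: "0 \<le> t" for f t
    unfolding m_version_def tr[OF f(1) t]
    using pT[OF t] X'.p_integrable[OF t] f(2) unfolding Lp_mem_1 by auto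
  have inv: "invariant m X' Pr'"
    unfolding invariant_def
  proof (intro ballI impI allI; elim conjE)
    fix f :: "real^'n \<Rightarrow> real" and t :: real
    assume f: "f \<in> bounded_Borel" "\<forall>x. 0 \<le> f x" "Lp_mem 1 m f" and t: "0 \<le> t"
    have fi: "integrable m f" using f(3) by (simp add: Lp_mem_1)
    obtain c where c: "\<And>x. \<bar>f x\<bar> \<le> c" using f(1) unfolding bounded_Borel_def bounded_iff by auto
    have p0: "0 \<le> X'.p t f x" for x unfolding X'.p_def using f(2) by (intro integral_nonneg_AE AE_I2) simp
    have "(LINT x|m. X'.p t f x) = (LINT x|m. f x)"
      by (rule X'.mass_conserved[OF T0 uniq M'(2) L0 fi c _ t]) (use f(2) in auto)
    then show "(\<integral>\<^sup>+x. ennreal (transition X' Pr' t f x) \<partial>m) = (\<integral>\<^sup>+x. ennreal (f x) \<partial>m)"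
      unfolding tr[OF f(1) t] using p0 f(2) fi X'.p_integrable[OF t fi] by (simp add: nn_integral_eq_integral)
  qed
  have law: "path_law X' (Pr' (Some x)) = path_law X (Pr (Some x))" if sF: "strong_Feller X' Pr'" for x
  proof (rule path_law_eq_if_transition_eq[OF X_right M'(1)])
    fix t f x assume t: "0 \<le> (t :: real)" and f: "f \<in> (bounded_Borel :: (real^'n \<Rightarrow> real) set)"
    have P_eq: "transition X Pr t h x = P t h x" if "h \<in> bounded_Borel" for h x
      using M(3) t that unfolding has_transition_semigroup_def by blast
    show "transition X' Pr' t f x = transition X Pr t f x"
    \<comment> \<open>Continuity of the versions is available for positive times only; at time 0
      both transition functions are the identity.\<close>
    proof (cases "t = 0")
      case True
      have "P 0 f = f" using P unfolding continuous_version_of_def by blast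
      moreover have "X'.p 0 f x = f x"
        using f by (intro X'.p_0) (auto simp: bounded_Borel_def X'.measurable_m X'.space_m)
      ultimately show ?thesis using P_eq[OF f] tr[OF f order_refl] True by simp
    next
      case False
      then have t0: "0 < t" using t by simp
      have eq: "transition X' Pr' t h y = transition X Pr t h y" if h: "h \<in> bounded_Borel" "integrable m h" for h y
      proof -
        have c': "continuous_on UNIV (transition X' Pr' t h)"
          using sF t0 h unfolding strong_Feller_def by blast
        have P1: "T_Lr m T 1 t h (P t h)" and P2: "continuous_on (UNIV \<times> {0<..}) (\<lambda>(x, t). P t h x)"
          using P h(2) t0 unfolding continuous_version_of_def Lp_mem_1[symmetric] by (auto dest!: spec[of _ 1])
        have c: "continuous_on UNIV (P t h)"
        proof -
          have "continuous_on UNIV (\<lambda>x :: real^'n. (x, t))" by (intro continuous_intros)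
          moreover have "range (\<lambda>x :: real^'n. (x, t)) \<subseteq> UNIV \<times> {0<..}" using t0 by auto
          ultimately show ?thesis using continuous_on_compose2[OF P2, of UNIV "\<lambda>x. (x, t)"] by simp
        qed
        have "AE x in m. X'.p t h x = P t h x"
          by (rule X'.T_Lr_1_AE[OF pT[OF t] t P1])
        \<comment> \<open>Since \<rho> > 0, the measures m and \<open>lborel\<close> have the same
          null sets.\<close>
        then have "AE x in lborel. X'.p t h x = P t h x"
          unfolding m m_of_def using \<rho>b \<rho>0 by (subst (asm) AE_density) auto
        then have "X'.p t h y = P t h y"
          using c' c unfolding tr[OF h(1) t] by (intro continuous_AE_eq_imp_eq)
        then show ?thesis using tr[OF h(1) t] P_eq[OF h(1)] by simp
      qed
      \<comment> \<open>The cut-offs are integrable because m is finite on balls, so the equality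
        just proved applies to them; f itself need not be integrable.\<close>
      let ?f = "\<lambda>n y. f y * indicator (ball 0 (real n)) y"
      have fb: "f \<in> borel_measurable borel" using f unfolding bounded_Borel_def by simp
      obtain c where c: "\<And>x. \<bar>f x\<bar> \<le> c" using f unfolding bounded_Borel_def bounded_iff by auto
      have c0: "c \<ge> 0" using c[of 0] by simp
      have fnb: "?f n \<in> borel_measurable borel" for n
        by (intro borel_measurable_times fb borel_measurable_indicator) simp
      have fn: "?f n \<in> bounded_Borel" for n
        unfolding bounded_Borel_def using fnb[of n] c c0 by (auto intro!: boundedI[where B=c] split: split_indicator)
      have fi: "integrable m (?f n)" for n
      proof (rule Bochner_Integration.integrable_bound[of _ "\<lambda>x. c * indicator (ball 0 (real n)) x"])
        show "integrable m (\<lambda>x. c * indicator (ball 0 (real n)) x)"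
          using X'.finite_ball by (intro integrable_mult_right integrable_real_indicator) (simp_all add: X'.sets_m)
        show "?f n \<in> borel_measurable m" unfolding X'.measurable_m by (rule fnb)
        show "AE x in m. norm (?f n x) \<le> norm (c * indicator (ball 0 (real n)) x)"
          using c by (intro AE_I2) (auto split: split_indicator intro: order_trans[OF _ abs_ge_self])
      qed
      show ?thesis
        using transition_ball_tendsto[OF M'(1) f t, of x] transition_ball_tendsto[OF X_right f t, of x]
        unfolding eq[OF fn fi] by (rule LIMSEQ_unique)
    qed
  qed
  show ?thesis using version inv law by blast
qed

end
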